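(* Suppose that $\lambda=0$, that either $r_0\subset\mathcal{A}_{0,I}$ or $r_0\subset\mathcal{A}_{0,III}$, and that either $r_L\subset\mathcal{A}_{m,II}$ or $r_L\subset\mathcal{A}_{m,IV}$. Assume that for every $i\in\{0,\dots,m\}$ there are $d_i,e_i\in\{c_{1,i},c_{2,i}\}$ with $d_i\neq e_i$ and integers $0\leq\alpha_i<\beta_i$ such that, for every $\kappa\in\{I,III\}$, $$\mathcal{T}_{i,\kappa+1}(d_i)+\mathcal{T}_{i,\kappa+2}(d_i)+\alpha_i\mathcal{T}_i(d_i)>\tau_i,\qquad \mathcal{T}_{i,\kappa}(e_i)+\mathcal{T}_{i,\kappa+1}(e_i)+\beta_i\mathcal{T}_i(e_i)<\tau_i,$$ and that $$\mathcal{S}_{i,II\to I}\leq\varsigma_i\quad\text{and}\quad\mathcal{S}_{i,IV\to III}\leq\varsigma_i\qquad\text{for all } i\in\{0,\dots,m-1\}.$$ Then, for each such choice of $r_0$ and $r_L$, the boundary value problem $$x'=h(y),\quad y'=-\lambda x-a(t)g(x),\quad (x(0),y(0))\in r_0,\quad (x(L),y(L))\in r_L$$ has at least $$2^m\prod_{i=0}^m(\beta_i-\alpha_i)$$ solutions. Moreover, these solutions are classified by their nodal properties as follows. Let $\kappa_0\in\{I,III\}$ and $q_L\in\{II,IV\}$ be such that $r_0\subset\mathcal{A}_{0,\kappa_0}$ and $r_L\subset\mathcal{A}_{m,q_L}$. For every $(\kappa_1,\dots,\kappa_m)\in\{I,III\}^m$ and every $(j_0,\dots,j_m)$ with $1\leq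 j_i\leq\beta_i-\alpha_i$, there is at least one such solution with $(x(t_i),y(t_i))\in\mathcal{A}_{i,\kappa_i}$ for all $i\in\{0,\dots,m\}$ and: \begin{itemize} \item for $i\leq m-1$ with $\kappa_{i+1}=\kappa_i$: $x$ has exactly $2(\alpha_i+j_i)-1$ zeroes in $(t_i,s_i)$ and $y$ has exactly $2(\alpha_i+j_i)$ zeroes in $[t_i,s_i]$; \item for $i\leq m-1$ with $\kappa_{i+1}\neq\kappa_i$: $x$ has exactly $2(\alpha_i+j_i)$ zeroes in $(t_i,s_i)$ and $y$ has exactly $2(\alpha_i+j_i)+1$ zeroes in $[t_i,s_i]$; \item for $i\leq m-1$: $x$ has exactly one zero and $y$ has no zero in $[s_i,t_{i+1}]$; \item on the last interval: $x$ has exactly $2(\alpha_m+j_m)-1$ zeroes in $(t_m,s_m)$ and $y$ exactly $2(\alpha_m+j_m)$ zeroes in $[t_m,s_m]$ if $q_L=\kappa_m-1$, while $x$ has exactly $2(\alpha_m+j_m)$ zeroes in $(t_m,s_m)$ and $y$ exactly $2(\alpha_m+j_m)+1$ zeroes in $[t_m,s_m]$ if $q_L=\kappa_m+1$. \end{itemize}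
   Context: Setting. $m\geq1$, $0=t_0<s_0<t_1<\dots<s_{m-1}<t_m<s_m=L$, $\tau_i:=s_i-t_i$, $\varsigma_i:=t_{i+1}-s_i$. The weight is $a(t)=\mu_i>0$ for $t\in[t_i,s_i]$, $i\in\{0,\dots,m\}$, and $a=0$ on $(s_i,t_{i+1})$, $i\in\{0,\dots,m-1\}$. The function $h:(\varrho_-,\varrho_+)\to\mathbb{R}$, $-\infty\leq\varrho_-<0<\varrho_+\leq+\infty$, is the inverse of an increasing homeomorphism between open intervals containing $0$ (so $h$ is continuous and strictly increasing), with $h(0)=0$; $g:\mathbb{R}\to\mathbb{R}$ is continuous with $g(0)=0$ and $g(s)s>0$ for $s\neq0$. Let $(\mathcal{N}_{i,\lambda})$ be $x'=h(y)$, $y'=-\lambda x-\mu_i g(x)$ and $(\mathcal{L}_\lambda)$ be $x'=h(y)$, $y'=-\lambda x$. Uniqueness of solutions of all initial value problems for these systems is assumed; solutions are in the Carathéodory sense. Put $H(y)=\int_0^y h$, $G(x)=\int_0^x g$, $F_{i,\lambda}(x)=\frac{\lambda}{2}x^2+\mu_iG(x)$, $\mathcal{H}_i(x,y)=H(y)+F_{i,\lambda}(x)$, $H(\varrho_\pm)=\lim_{y\to\varrho_\pm}H(y)$, $H^*=\min\{H(\varrho_-),H(\varrho_+)\}$. $H_+^{-1}$, $H_-^{-1}$ are the inverses of $H$ restricted to $[0,\varrho_+)$, $(\varrho_-,0]$, and $G_+^{-1}$, $G_-^{-1}$ the inverses of $G$ on the positive and negative half-lines. Annuli. For each $i$, $0<c_{1,i}<c_{2,i}<H^*$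 are such that for every $c\in[c_{1,i},c_{2,i}]$ there are $x_-(c)<0<x_+(c)$ with $F_{i,\lambda}(x_\pm(c))=c$, $F_{i,\lambda}<c$ on $(x_-(c),x_+(c))$, $F_{i,\lambda}'(x_-(c))<0<F_{i,\lambda}'(x_+(c))$. The annulus $\mathcal{A}_i=\{c_{1,i}\leq\mathcal{H}_i\leq c_{2,i}\}$ is the union of the corresponding closed orbits around the origin and is assumed to lie in $\mathbb{R}\times(\varrho_-,\varrho_+)$. $\mathcal{A}_{i,j}$, $j\in\{I,II,III,IV\}$, is the intersection of $\mathcal{A}_i$ with the $j$-th closed quadrant. $y_-(c)<0<y_+(c)$ are given by $H(y_\pm(c))=c$. The sets $r_0\subset\mathcal{A}_0$ and $r_L\subset\mathcal{A}_m$ are arcs, each connecting the inner with the outer boundary of the corresponding annulus. Times. $\mathcal{T}_{i,I}(c)=\int_0^{x_+(c)}\frac{dx}{(h\circ H_+^{-1})(c-F_{i,\lambda}(x))}$, $\mathcal{T}_{i,IV}(c)=\int_0^{x_+(c)}\frac{dx}{-(h\circ H_-^{-1})(c-F_{i,\lambda}(x))}$, $\mathcal{T}_{i,III}(c)=\int_{x_-(c)}^0\frac{dx}{-(h\circ H_-^{-1})(c-F_{i,\lambda}(x))}$, $\mathcal{T}_{i,II}(c)=\int_{x_-(c)}^0\frac{dx}{(h\circ H_+^{-1})(c-F_{i,\lambda}(x))}$ are the times spent in each quadrant by the orbit $\mathcal{H}_i=c$, and $\mathcal{T}_i(c)$ is their sum (the period). Quadrant indices are added in the cyclic clockwise order $IV\prec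 III\prec II\prec I\prec IV$: $I+1=IV$, $IV+1=III$, $III+1=II$, $II+1=I$ (so $I-1=II$, $III-1=IV$). Transition times for $\lambda=0$. With $y_{+,i}=\min\{y_+(c_{1,i}),y_+(c_{1,i+1})\}$ and $y_{-,i}=\max\{y_-(c_{1,i}),y_-(c_{1,i+1})\}$, $$\mathcal{S}_{i,II\to I}=\frac{G_+^{-1}(\mu_{i+1}^{-1}[c_{2,i+1}-H(y_{+,i})])-G_-^{-1}(\mu_i^{-1}[c_{2,i}-H(y_{+,i})])}{h(y_{+,i})},$$ $$\mathcal{S}_{i,IV\to III}=\frac{G_+^{-1}(\mu_i^{-1}[c_{2,i}-H(y_{-,i})])-G_-^{-1}(\mu_{i+1}^{-1}[c_{2,i+1}-H(y_{-,i})])}{-h(y_{-,i})}.$$ *)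

theory Defs
  imports "HOL-Analysis.Analysis"
begin

datatype quadrant = QI | QII | QIII | QIV

text \<open>The successor is taken in the clockwise order, i.e. in the order in which the orbits run
  through the quadrants.\<close>

fun qnext :: "quadrant \<Rightarrow> quadrant" where
  "qnext QI = QIV"
| "qnext QIV = QIII"
| "qnext QIII = QII"
| "qnext QII = QI"

fun qprev :: "quadrant \<Rightarrow> quadrant" where
  "qprev QI = QII"
| "qprev QII = QIII"
| "qprev QIII = QIV"
| "qprev QIV = QI"

fun closed_quadrant :: "quadrant \<Rightarrow> (real \<times> real) set" where
  "closed_quadrant QI = {(x, y). 0 \<le> x \<and> 0 \<le> y}"
| "closed_quadrant QII = {(x, y). x \<le> 0 \<and> 0 \<le> y}"
| "closed_quadrant QIII = {(x, y). x \<le> 0 \<and> y \<le> 0}"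
| "closed_quadrant QIV = {(x, y). 0 \<le> x \<and> y \<le> 0}"

text \<open>The interval integral is signed, so this is also right for negative \<open>y\<close>.  It provides
  both \<open>H\<close> (from \<open>h\<close>) and \<open>G\<close> (from \<open>g\<close>).\<close>

definition primitive :: "(real \<Rightarrow> real) \<Rightarrow> real \<Rightarrow> real" where
  "primitive f y = (LBINT u=0..ereal y. f u)"

definition potential :: "(real \<Rightarrow> real) \<Rightarrow> real \<Rightarrow> real \<Rightarrow> real \<Rightarrow> real" where
  "potential g lam mu x = lam / 2 * x\<^sup>2 + mu * primitive g x"

definition energy ::
    "(real \<Rightarrow> real) \<Rightarrow> (real \<Rightarrow> real) \<Rightarrow> real \<Rightarrow> real \<Rightarrow> real \<times> real \<Rightarrow> real" where
  "energy h g lam mu = (\<lambda>(x, y). primitive h y + potential g lam mu x)"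

text \<open>The end points \<open>\<rho>m\<close> and \<open>\<rho>p\<close> of the domain of \<open>h\<close> may be infinite, so the limits of \<open>H\<close>
  there are taken over the extended reals; they may be infinite as well.\<close>

definition H_star :: "ereal \<Rightarrow> ereal \<Rightarrow> (real \<Rightarrow> real) \<Rightarrow> ereal" where
  "H_star \<rho>m \<rho>p h =
     min (Lim (at_right \<rho>m) (\<lambda>y. ereal (primitive h (real_of_ereal y))))
         (Lim (at_left \<rho>p) (\<lambda>y. ereal (primitive h (real_of_ereal y))))"

definition H_inv_pos :: "ereal \<Rightarrow> (real \<Rightarrow> real) \<Rightarrow> real \<Rightarrow> real" where
  "H_inv_pos \<rho>p h = inv_into {y. 0 \<le> y \<and> ereal y < \<rho>p} (primitive h)"

definition H_inv_neg :: "ereal \<Rightarrow> (real \<Rightarrow> real) \<Rightarrow> real \<Rightarrow> real" where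
  "H_inv_neg \<rho>m h = inv_into {y. \<rho>m < ereal y \<and> y \<le> 0} (primitive h)"

definition G_inv_pos :: "(real \<Rightarrow> real) \<Rightarrow> real \<Rightarrow> real" where
  "G_inv_pos g = inv_into {0..} (primitive g)"

definition G_inv_neg :: "(real \<Rightarrow> real) \<Rightarrow> real \<Rightarrow> real" where
  "G_inv_neg g = inv_into {..0} (primitive g)"

text \<open>\<open>H\<close> is only meaningful on the domain of \<open>h\<close>, hence the restriction of \<open>y\<close>.\<close>

definition annulus ::
    "ereal \<Rightarrow> ereal \<Rightarrow> (real \<Rightarrow> real) \<Rightarrow> (real \<Rightarrow> real) \<Rightarrow> real \<Rightarrow> real \<Rightarrow> real \<Rightarrow> real
      \<Rightarrow> (real \<times> real) set" where
  "annulus \<rho>m \<rho>p h g lam mu c1 c2 =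
     {(x, y). y \<in> einterval \<rho>m \<rho>p \<and>
              c1 \<le> energy h g lam mu (x, y) \<and> energy h g lam mu (x, y) \<le> c2}"

definition annulus_arc ::
    "ereal \<Rightarrow> ereal \<Rightarrow> (real \<Rightarrow> real) \<Rightarrow> (real \<Rightarrow> real) \<Rightarrow> real \<Rightarrow> real \<Rightarrow> real \<Rightarrow> real
      \<Rightarrow> (real \<times> real) set \<Rightarrow> bool" where
  "annulus_arc \<rho>m \<rho>p h g lam mu c1 c2 r \<longleftrightarrow>
     r \<subseteq> annulus \<rho>m \<rho>p h g lam mu c1 c2 \<and>
     (\<exists>\<gamma>. arc \<gamma> \<and> path_image \<gamma> = r \<and>
          energy h g lam mu (pathstart \<gamma>) = c1 \<and> energy h g lam mu (pathfinish \<gamma>) = c2)"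

text \<open>Here \<open>xm\<close> and \<open>xp\<close> give the abscissae at which an orbit of given energy crosses the
  \<open>x\<close>-axis.  The integrals are improper at these points.\<close>

fun quadrant_time ::
    "ereal \<Rightarrow> ereal \<Rightarrow> (real \<Rightarrow> real) \<Rightarrow> (real \<Rightarrow> real) \<Rightarrow> real \<Rightarrow> real
      \<Rightarrow> (real \<Rightarrow> real) \<Rightarrow> (real \<Rightarrow> real) \<Rightarrow> quadrant \<Rightarrow> real \<Rightarrow> real" where
  "quadrant_time \<rho>m \<rho>p h g lam mu xm xp QI c =
     (LBINT x=0..ereal (xp c). 1 / h (H_inv_pos \<rho>p h (c - potential g lam mu x)))"
| "quadrant_time \<rho>m \<rho>p h g lam mu xm xp QIV c =
     (LBINT x=0..ereal (xp c). 1 / (- h (H_inv_neg \<rho>m h (c - potential g lam mu x))))"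
| "quadrant_time \<rho>m \<rho>p h g lam mu xm xp QIII c =
     (LBINT x=ereal (xm c)..0. 1 / (- h (H_inv_neg \<rho>m h (c - potential g lam mu x))))"
| "quadrant_time \<rho>m \<rho>p h g lam mu xm xp QII c =
     (LBINT x=ereal (xm c)..0. 1 / h (H_inv_pos \<rho>p h (c - potential g lam mu x)))"

definition period ::
    "ereal \<Rightarrow> ereal \<Rightarrow> (real \<Rightarrow> real) \<Rightarrow> (real \<Rightarrow> real) \<Rightarrow> real \<Rightarrow> real
      \<Rightarrow> (real \<Rightarrow> real) \<Rightarrow> (real \<Rightarrow> real) \<Rightarrow> real \<Rightarrow> real" where
  "period \<rho>m \<rho>p h g lam mu xm xp c =
     quadrant_time \<rho>m \<rho>p h g lam mu xm xp QI c + quadrant_time \<rho>m \<rho>p h g lam mu xm xp QII c +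
     quadrant_time \<rho>m \<rho>p h g lam mu xm xp QIII c + quadrant_time \<rho>m \<rho>p h g lam mu xm xp QIV c"

definition transition_II_I ::
    "ereal \<Rightarrow> (real \<Rightarrow> real) \<Rightarrow> (real \<Rightarrow> real) \<Rightarrow> (nat \<Rightarrow> real) \<Rightarrow> (nat \<Rightarrow> real) \<Rightarrow> (nat \<Rightarrow> real)
      \<Rightarrow> nat \<Rightarrow> real" where
  "transition_II_I \<rho>p h g mu c1 c2 i =
     (let y = min (H_inv_pos \<rho>p h (c1 i)) (H_inv_pos \<rho>p h (c1 (Suc i))) in
      (G_inv_pos g ((c2 (Suc i) - primitive h y) / mu (Suc i)) -
       G_inv_neg g ((c2 i - primitive h y) / mu i)) / h y)"

definition transition_IV_III ::
    "ereal \<Rightarrow> (real \<Rightarrow> real) \<Rightarrow> (real \<Rightarrow> real) \<Rightarrow> (nat \<Rightarrow> real) \<Rightarrow> (nat \<Rightarrow> real) \<Rightarrow> (nat \<Rightarrow> real)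
      \<Rightarrow> nat \<Rightarrow> real" where
  "transition_IV_III \<rho>m h g mu c1 c2 i =
     (let y = max (H_inv_neg \<rho>m h (c1 i)) (H_inv_neg \<rho>m h (c1 (Suc i))) in
      (G_inv_pos g ((c2 i - primitive h y) / mu i) -
       G_inv_neg g ((c2 (Suc i) - primitive h y) / mu (Suc i))) / (- h y))"

definition absolutely_cont_on :: "real \<Rightarrow> real \<Rightarrow> (real \<Rightarrow> real) \<Rightarrow> bool" where
  "absolutely_cont_on a b f \<longleftrightarrow>
     (\<forall>\<epsilon>>0. \<exists>\<delta>>0. \<forall>n. \<forall>u v :: nat \<Rightarrow> real.
        (\<forall>k<n. a \<le> u k \<and> u k \<le> v k \<and> v k \<le> b) \<longrightarrow>
        (\<forall>k<n. \<forall>l<n. k \<noteq> l \<longrightarrow> {u k<..<v k} \<inter> {u l<..<v l} = {}) \<longrightarrow>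
        (\<Sum>k<n. v k - u k) < \<delta> \<longrightarrow>
        (\<Sum>k<n. \<bar>f (v k) - f (u k)\<bar>) < \<epsilon>)"

text \<open>Caratheodory solutions on \<open>[a, b]\<close> of \<open>x' = h(y)\<close>, \<open>y' = -lam x - w(t) g(x)\<close>, where \<open>h\<close> is
  defined on \<open>(\<rho>m, \<rho>p)\<close>.  The autonomous systems of the setting are those with a constant
  weight \<open>w\<close>.\<close>

definition caratheodory_sol ::
    "ereal \<Rightarrow> ereal \<Rightarrow> (real \<Rightarrow> real) \<Rightarrow> (real \<Rightarrow> real) \<Rightarrow> real \<Rightarrow> (real \<Rightarrow> real)
      \<Rightarrow> real \<Rightarrow> real \<Rightarrow> (real \<Rightarrow> real) \<Rightarrow> (real \<Rightarrow> real) \<Rightarrow> bool" where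
  "caratheodory_sol \<rho>m \<rho>p h g lam w a b x y \<longleftrightarrow>
     absolutely_cont_on a b x \<and> absolutely_cont_on a b y \<and>
     (\<forall>t\<in>{a..b}. y t \<in> einterval \<rho>m \<rho>p) \<and>
     (AE t in lborel. t \<in> {a..b} \<longrightarrow>
        (x has_real_derivative h (y t)) (at t within {a..b}) \<and>
        (y has_real_derivative (- lam * x t - w t * g (x t))) (at t within {a..b}))"

definition ivp_uniqueness ::
    "ereal \<Rightarrow> ereal \<Rightarrow> (real \<Rightarrow> real) \<Rightarrow> (real \<Rightarrow> real) \<Rightarrow> real \<Rightarrow> (real \<Rightarrow> real) \<Rightarrow> bool" where
  "ivp_uniqueness \<rho>m \<rho>p h g lam w \<longleftrightarrow>
     (\<forall>a b t0 x y u v.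
        t0 \<in> {a..b} \<longrightarrow>
        caratheodory_sol \<rho>m \<rho>p h g lam w a b x y \<longrightarrow>
        caratheodory_sol \<rho>m \<rho>p h g lam w a b u v \<longrightarrow>
        x t0 = u t0 \<longrightarrow> y t0 = v t0 \<longrightarrow>
        (\<forall>t\<in>{a..b}. x t = u t \<and> y t = v t))"

text \<open>Solutions are functions on \<open>[0, L]\<close>; extensionality makes equality of solutions mean
  equality there, so that cardinalities count each solution once.\<close>

definition bvp_solutions ::
    "ereal \<Rightarrow> ereal \<Rightarrow> (real \<Rightarrow> real) \<Rightarrow> (real \<Rightarrow> real) \<Rightarrow> real \<Rightarrow> (real \<Rightarrow> real)
      \<Rightarrow> real \<Rightarrow> (real \<times> real) set \<Rightarrow> (real \<times> real) set \<Rightarrow> ((real \<Rightarrow> real) \<times> (real \<Rightarrow> real)) set" where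
  "bvp_solutions \<rho>m \<rho>p h g lam w L r0 rL =
     {(x, y). x \<in> extensional {0..L} \<and> y \<in> extensional {0..L} \<and>
              caratheodory_sol \<rho>m \<rho>p h g lam w 0 L x y \<and>
              (x 0, y 0) \<in> r0 \<and> (x L, y L) \<in> rL}"

definition exactly_zeros :: "nat \<Rightarrow> (real \<Rightarrow> real) \<Rightarrow> real set \<Rightarrow> bool" where
  "exactly_zeros n f A \<longleftrightarrow> finite {t \<in> A. f t = 0} \<and> card {t \<in> A. f t = 0} = n"

end

theory Submission
  imports Defs
begin

text \<open>The orbits inside an annulus are constructed explicitly.  In each quadrant
  \<open>\<bar>x\<bar> - \<bar>y\<bar>\<close> is strictly monotone along them, with speed \<open>\<bar>h(y)\<bar> + \<mu> \<bar>g(x)\<bar>\<close> bounded away from zero,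
  so the elapsed time is a proper integral that depends continuously on the energy.  A path
  within a quadrant that connects the two boundaries of an annulus is wound up by the flow, because
  the twist conditions make the rotation slow at one boundary and fast at the other; it therefore
  contains a subpath whose image crosses a prescribed quadrant, after a prescribed number of turns,
  from the \<open>x\<close>-axis to the \<open>y\<close>-axis.  Where the weight vanishes the flow is the shear
  \<open>(x, y) \<mapsto> (x + h(y) \<varsigma>, y)\<close>, which fixes the \<open>x\<close>-axis and carries the points at a certain
  height beyond the next annulus, so that the sheared crossing contains a connection of the two
  boundaries of that annulus.  After the last interval the crossing meets the arc \<open>rL\<close> by the
  Fashoda meet theorem.\<close>

subsection \<open>Crossings and piecewise solutions\<close>

text \<open>\<open>h\<close> and \<open>g\<close> are merely continuous. Conservation of energy
  yields the orbits, and their joint continuity in energy and time comes from inverting continuous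
  bijections of compact sets.

  Quarter turns are numbered by consecutive naturals \<open>n\<close>, so that a number records both
  the quadrant and the winding. For a path in quarter \<open>k0\<close>, the first twist condition
  says that its end of energy \<open>d\<close> does not arrive in quarter
  \<open>k0 + 3 + 4 * \<alpha>\<close> even from the most advanced starting point, the second that
  its end of energy \<open>e\<close> has left quarter \<open>k0 + 1 + 4 * \<beta>\<close> even from
  the least advanced one. All odd numbers from the former to the latter are crossed; among them are
  exactly \<beta> - \<alpha> for each of the quadrants II and IV. This gives the factors of the
  product; the factor 2^m is the choice of quadrant I or III at \<open>t 1\<close>, ...,
  \<open>t m\<close>.

  What passes from one interval to the next is a path each point of which is the end of some
  solution with the prescribed zeros; these solutions need not depend continuously on the
  point.\<close>

lemma last_zero:
  fixes u :: "real \<Rightarrow> real"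
  assumes "a \<le> b" "continuous_on {a..b} u" "u a \<le> 0" "0 \<le> u b"
  obtains c where "c \<in> {a..b}" "u c = 0" "\<And>s. s \<in> {c..b} \<Longrightarrow> 0 \<le> u s"
proof -
  let ?K = "{a..b} \<inter> u -` {0}"
  have cont: "continuous_on {c..b} u" if "a \<le> c" for c
    using continuous_on_subset[OF assms(2)] that by auto
  have closed: "closed ?K"
    by (intro continuous_closed_preimage assms) auto
  have "\<exists>x\<ge>a. x \<le> b \<and> u x = 0"
    using IVT'[of u a 0 b] assms by auto
  then have ne: "?K \<noteq> {}" by auto
  have bdd: "bdd_above ?K" by (rule bdd_aboveI[of _ b]) auto
  have c: "Sup ?K \<in> ?K" by (rule closed_contains_Sup[OF ne bdd closed])
  show ?thesis
  proof
    show "Sup ?K \<in> {a..b}" "u (Sup ?K) = 0" using c by auto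
    fix s assume s: "s \<in> {Sup ?K..b}"
    show "0 \<le> u s"
    proof (rule ccontr)
      assume neg: "\<not> 0 \<le> u s"
      have as: "a \<le> s" using s c by auto
      obtain x where "s \<le> x" "x \<le> b" "u x = 0"
        using IVT'[of u s 0 b] neg assms s cont[OF as] by auto
      moreover have "x \<in> ?K" using calculation as by auto
      then have "x \<le> Sup ?K" by (rule cSup_upper[OF _ bdd])
      ultimately have "x = s" using s by auto
      then show False using neg \<open>u x = 0\<close> by simp
    qed
  qed
qed

text \<open>After the last zero of \<open>u\<close>, stop at the first point where \<open>u\<close>
  equals one; in between, \<open>u\<close> can cross neither bound.\<close>

lemma crossing:
  fixes u :: "real \<Rightarrow> real"
  assumes "a \<le> b" "continuous_on {a..b} u" "u a \<le> 0" "1 \<le> u b"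
  obtains c d where "a \<le> c" "c < d" "d \<le> b" "u c = 0" "u d = 1"
    "\<And>s. s \<in> {c..d} \<Longrightarrow> 0 \<le> u s \<and> u s \<le> 1"
proof -
  obtain c where c: "c \<in> {a..b}" "u c = 0" "\<And>s. s \<in> {c..b} \<Longrightarrow> 0 \<le> u s"
    using last_zero[OF assms(1-3)] assms(4) by (metis order_trans zero_le_one)
  \<comment> \<open>Reversing time and replacing \<open>u\<close> by \<open>1 - u\<close> turns the
    first point with value one into a last zero.\<close>
  have "continuous_on {-b..-c} (\<lambda>s. 1 - u (-s))"
    using c by (intro continuous_intros continuous_on_compose2[OF assms(2)]) auto
  then obtain d where d: "d \<in> {-b..-c}" "1 - u (-d) = 0" "\<And>s. s \<in> {d..-c} \<Longrightarrow> 0 \<le> 1 - u (-s)"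
    using last_zero[of "-b" "-c" "\<lambda>s. 1 - u (-s)"] c assms(4) by auto
  show ?thesis
  proof (rule that[of c "-d"])
    show "c < -d" using c(2) d(1,2) by (cases "c = -d") auto
    show "0 \<le> u s \<and> u s \<le> 1" if "s \<in> {c..-d}" for s
      using c(3)[of s] d(3)[of "-s"] that d(1) by auto
  qed (use c d in auto)
qed

lemma path_crossing:
  fixes p :: "real \<Rightarrow> 'a::real_normed_vector"
  assumes "path p" "continuous_on (path_image p) u" "u (pathstart p) \<le> lo" "hi \<le> u (pathfinish p)" "lo < (hi::real)"
  obtains q where "path q" "path_image q \<subseteq> path_image p" "u (pathstart q) = lo" "u (pathfinish q) = hi"
    "\<And>z. z \<in> path_image q \<Longrightarrow> lo \<le> u z \<and> u z \<le> hi"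
proof -
  let ?w = "\<lambda>s. (u (p s) - lo) / (hi - lo)"
  have "continuous_on {0..1} (\<lambda>s. u (p s))"
    using assms(1,2) unfolding path_def path_image_def
    by (intro continuous_on_compose2[OF assms(2)]) (auto simp: path_image_def)
  then have "continuous_on {0..1} ?w" using assms(5) by (intro continuous_intros) auto
  moreover have "?w 0 \<le> 0" "1 \<le> ?w 1" using assms(3-5)
      by (simp_all add: pathstart_def pathfinish_def divide_nonpos_pos)
  ultimately obtain c d where cd: "0 \<le> c" "c < d" "d \<le> 1" "?w c = 0" "?w d = 1"
    "\<And>s. s \<in> {c..d} \<Longrightarrow> 0 \<le> ?w s \<and> ?w s \<le> 1"
    using crossing[of 0 1 ?w] by (metis zero_le_one)
  show ?thesis
  proof (rule that[of "subpath c d p"])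
    show "path (subpath c d p)" using assms(1) cd by (intro path_subpath) auto
    show "path_image (subpath c d p) \<subseteq> path_image p" using cd by (intro path_image_subpath_subset) auto
    show "u (pathstart (subpath c d p)) = lo" "u (pathfinish (subpath c d p)) = hi"
      using cd(4,5) assms(5) by (auto simp: divide_eq_eq)
    fix z assume "z \<in> path_image (subpath c d p)"
    then obtain s where "s \<in> {c..d}" "z = p s" using cd(2) by (auto simp: path_image_subpath)
    then show "lo \<le> u z \<and> u z \<le> hi" using cd(6)[of s] assms(5) by (simp add: field_simps)
  qed
qed

lemma path_last_zero:
  fixes p :: "real \<Rightarrow> 'a::real_normed_vector"
  assumes "path p" "continuous_on (path_image p) u" "u (pathstart p) \<le> (0::real)" "0 \<le> u (pathfinish p)"
  obtains q where "path q" "path_image q \<subseteq> path_image p" "u (pathstart q) = 0" "pathfinish q = pathfinish p"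
    "\<And>z. z \<in> path_image q \<Longrightarrow> 0 \<le> u z"
proof -
  have "continuous_on {0..1} (\<lambda>s. u (p s))"
    using assms(1,2) unfolding path_def path_image_def
    by (intro continuous_on_compose2[OF assms(2)]) (auto simp: path_image_def)
  then obtain c where c: "c \<in> {0..1}" "u (p c) = 0" "\<And>s. s \<in> {c..1} \<Longrightarrow> 0 \<le> u (p s)"
    using last_zero[of 0 1 "\<lambda>s. u (p s)"] assms(3-4) by (auto simp: pathstart_def pathfinish_def)
  show ?thesis
  proof (rule that[of "subpath c 1 p"])
    show "path (subpath c 1 p)" using assms(1) c by (intro path_subpath) auto
    show "path_image (subpath c 1 p) \<subseteq> path_image p" using c by (intro path_image_subpath_subset) auto
    show "u (pathstart (subpath c 1 p)) = 0" "pathfinish (subpath c 1 p) = pathfinish p"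
      using c by (simp_all add: pathfinish_def pathstart_def subpath_def)
    fix z assume "z \<in> path_image (subpath c 1 p)"
    then obtain s where "s \<in> {c..1}" "z = p s" using c by (auto simp: path_image_subpath)
    then show "0 \<le> u z" using c(3)[of s] by simp
  qed
qed

text \<open>Classical solutions up to finitely many instants, without the linear term since
  \<open>lam\<close> is zero in the theorem. The exceptional set absorbs the axis crossings and the
  jumps of the weight, so that restriction, translation and joining need no measure theory.\<close>

definition piecewise_sol ::
    "real set \<Rightarrow> (real \<Rightarrow> real) \<Rightarrow> (real \<Rightarrow> real) \<Rightarrow> (real \<Rightarrow> real)
      \<Rightarrow> real \<Rightarrow> real \<Rightarrow> (real \<Rightarrow> real) \<Rightarrow> (real \<Rightarrow> real) \<Rightarrow> bool" where
  "piecewise_sol J h g w a b x y \<longleftrightarrow>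
     continuous_on {a..b} x \<and> continuous_on {a..b} y \<and> y ` {a..b} \<subseteq> J \<and>
     (\<exists>S. finite S \<and> (\<forall>t\<in>{a<..<b} - S.
        (x has_real_derivative h (y t)) (at t) \<and>
        (y has_real_derivative (- (w t * g (x t)))) (at t)))"

lemma piecewise_sol_cong:
  assumes "piecewise_sol J h g w a b x y" "\<And>t. t \<in> {a..b} \<Longrightarrow> x' t = x t" "\<And>t. t \<in> {a..b} \<Longrightarrow> y' t = y t"
    "\<And>t. t \<in> {a<..<b} \<Longrightarrow> w' t = w t"
  shows "piecewise_sol J h g w' a b x' y'"
proof -
  obtain S where S: "finite S" "\<And>t. t\<in>{a<..<b} - S \<Longrightarrow>
        (x has_real_derivative h (y t)) (at t) \<and>
        (y has_real_derivative (- (w t * g (x t)))) (at t)"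
    using assms(1) unfolding piecewise_sol_def by blast
  have "(x' has_real_derivative h (y' t)) (at t) \<and> (y' has_real_derivative (- (w' t * g (x' t)))) (at t)"
    if t: "t \<in> {a<..<b} - S" for t
  proof -
    have ev: "eventually (\<lambda>s. s \<in> {a<..<b}) (nhds t)"
      using t by (intro eventually_nhds_in_open) auto
    have "eventually (\<lambda>s. x' s = x s) (nhds t)" "eventually (\<lambda>s. y' s = y s) (nhds t)"
      using ev by (auto elim!: eventually_mono simp: assms)
    then show ?thesis using S(2)[OF t] t assms by (simp add: DERIV_cong_ev)
  qed
  moreover have "continuous_on {a..b} x'" "continuous_on {a..b} y'" "y' ` {a..b} \<subseteq> J"
    using assms continuous_on_cong[of "{a..b}" "{a..b}" x' x] continuous_on_cong[of "{a..b}" "{a..b}" y' y]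
    by (auto simp: piecewise_sol_def)
  ultimately show ?thesis unfolding piecewise_sol_def using S(1) by blast
qed

lemma piecewise_sol_subinterval:
  assumes "piecewise_sol J h g w a b x y" "a \<le> a'" "b' \<le> b"
  shows "piecewise_sol J h g w a' b' x y"
proof -
  have "{a'..b'} \<subseteq> {a..b}" "{a'<..<b'} \<subseteq> {a<..<b}" using assms by auto
  then show ?thesis using assms(1) unfolding piecewise_sol_def
    by (meson continuous_on_subset image_mono order_trans DiffE DiffI subsetD)
qed

lemma piecewise_sol_join:
  assumes 1: "piecewise_sol J h g w a b x y" and 2: "piecewise_sol J h g w b c u v"
    and "x b = u b" "y b = v b" "a \<le> b" "b \<le> c"
  shows "piecewise_sol J h g w a c (\<lambda>t. if t \<le> b then x t else u t) (\<lambda>t. if t \<le> b then y t else v t)"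
    (is "piecewise_sol J h g w a c ?x ?y")
proof -
  have 1: "piecewise_sol J h g w a b ?x ?y" by (rule piecewise_sol_cong[OF 1]) auto
  have 2: "piecewise_sol J h g w b c ?x ?y" by (rule piecewise_sol_cong[OF 2]) (use assms(3,4) in auto)
  obtain S where S: "finite S" "\<And>t. t\<in>{a<..<b} - S \<Longrightarrow>
        (?x has_real_derivative h (?y t)) (at t) \<and>
        (?y has_real_derivative (- (w t * g (?x t)))) (at t)"
    using 1 unfolding piecewise_sol_def by blast
  obtain S' where S': "finite S'" "\<And>t. t\<in>{b<..<c} - S' \<Longrightarrow>
        (?x has_real_derivative h (?y t)) (at t) \<and>
        (?y has_real_derivative (- (w t * g (?x t)))) (at t)"
    using 2 unfolding piecewise_sol_def by blast
  have eq: "{a..c} = {a..b} \<union> {b..c}" using assms(5,6) by auto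
  have "continuous_on {a..c} ?x" "continuous_on {a..c} ?y"
    unfolding eq using 1 2 by (auto intro!: continuous_on_closed_Un simp: piecewise_sol_def)
  moreover have "?y ` {a..c} \<subseteq> J" unfolding eq image_Un using 1 2 unfolding piecewise_sol_def by blast
  moreover have "t \<in> {a<..<b} - S \<or> t \<in> {b<..<c} - S'" if "t \<in> {a<..<c} - (S \<union> S' \<union> {b})" for t
    using that by auto
  ultimately show ?thesis unfolding piecewise_sol_def using S S'
    by (intro conjI exI[of _ "S \<union> S' \<union> {b}"]) blast+
qed

lemma piecewise_sol_shift:
  assumes "piecewise_sol J h g (\<lambda>_. k) a b x y"
  shows "piecewise_sol J h g (\<lambda>_. k) (a - c) (b - c) (\<lambda>t. x (t + c)) (\<lambda>t. y (t + c))"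
proof -
  obtain S where S: "finite S" "\<And>t. t\<in>{a<..<b} - S \<Longrightarrow>
        (x has_real_derivative h (y t)) (at t) \<and>
        (y has_real_derivative (- (k * g (x t)))) (at t)"
    using assms unfolding piecewise_sol_def by blast
  have "continuous_on {a - c..b - c} (\<lambda>t. x (t + c))" "continuous_on {a - c..b - c} (\<lambda>t. y (t + c))"
    using assms unfolding piecewise_sol_def
    by (auto intro!: continuous_on_compose2[of "{a..b}" _ "{a-c..b-c}" "\<lambda>t. t + c"] continuous_intros)
  moreover have "(\<lambda>t. y (t + c)) ` {a - c..b - c} \<subseteq> J"
    using assms unfolding piecewise_sol_def by auto
  moreover have "finite ((\<lambda>t. t - c) ` S)" using S by auto
  moreover have "((\<lambda>t. x (t + c)) has_real_derivative h (y (t + c))) (at t) \<and>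
     ((\<lambda>t. y (t + c)) has_real_derivative (- (k * g (x (t + c))))) (at t)"
    if "t \<in> {a - c<..<b - c} - (\<lambda>t. t - c) ` S" for t
  proof -
    have "t + c \<in> {a<..<b} - S" using that by (auto simp: image_iff algebra_simps)
    from S(2)[OF this] show ?thesis by (simp add: DERIV_shift)
  qed
  ultimately show ?thesis unfolding piecewise_sol_def by blast
qed

lemma lipschitz_absolutely_cont:
  fixes f :: "real \<Rightarrow> real"
  assumes "\<And>u v. a \<le> u \<Longrightarrow> u \<le> v \<Longrightarrow> v \<le> b \<Longrightarrow> \<bar>f v - f u\<bar> \<le> M * (v - u)"
  shows "absolutely_cont_on a b f"
  unfolding absolutely_cont_on_def
proof (intro allI impI)
  fix \<epsilon> :: real assume e: "\<epsilon> > 0"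
  \<comment> \<open>\<open>M\<close> need not be positive, for instance when \<open>f\<close> is
    constant; \<open>?M\<close> is, and can be divided by.\<close>
  let ?M = "\<bar>M\<bar> + 1"
  show "\<exists>\<delta>>0. \<forall>n. \<forall>u v :: nat \<Rightarrow> real.
        (\<forall>k<n. a \<le> u k \<and> u k \<le> v k \<and> v k \<le> b) \<longrightarrow>
        (\<forall>k<n. \<forall>l<n. k \<noteq> l \<longrightarrow> {u k<..<v k} \<inter> {u l<..<v l} = {}) \<longrightarrow>
        (\<Sum>k<n. v k - u k) < \<delta> \<longrightarrow> (\<Sum>k<n. \<bar>f (v k) - f (u k)\<bar>) < \<epsilon>"
  proof (intro exI[of _ "\<epsilon> / ?M"] conjI allI impI)
    show "0 < \<epsilon> / ?M" using e by (simp add: add_nonneg_pos)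
    fix n and u v :: "nat \<Rightarrow> real"
    assume *: "\<forall>k<n. a \<le> u k \<and> u k \<le> v k \<and> v k \<le> b" "(\<Sum>k<n. v k - u k) < \<epsilon> / ?M"
    have "(\<Sum>k<n. \<bar>f (v k) - f (u k)\<bar>) \<le> (\<Sum>k<n. ?M * (v k - u k))"
    proof (rule sum_mono)
      fix k assume "k \<in> {..<n}"
      then have k: "a \<le> u k" "u k \<le> v k" "v k \<le> b" using * by auto
      have "M * (v k - u k) \<le> ?M * (v k - u k)" using k by (intro mult_right_mono) auto
      then show "\<bar>f (v k) - f (u k)\<bar> \<le> ?M * (v k - u k)" using assms[OF k] by linarith
    qed
    also have "\<dots> = ?M * (\<Sum>k<n. v k - u k)" by (simp add: sum_distrib_left)
    also have "\<dots> < ?M * (\<epsilon> / ?M)" using *(2) by (intro mult_strict_left_mono) auto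
    also have "\<dots> = \<epsilon>" by simp
    finally show "(\<Sum>k<n. \<bar>f (v k) - f (u k)\<bar>) < \<epsilon>" .
  qed
qed

text \<open>Integrating the derivative over \<open>{u..v}\<close> shows that \<open>f\<close> is
  Lipschitz; finitely many missing derivatives do not affect the integral.\<close>

lemma piecewise_derivative_absolutely_cont:
  fixes f :: "real \<Rightarrow> real"
  assumes "finite S" "continuous_on {a..b} f"
    and "\<And>t. t \<in> {a<..<b} - S \<Longrightarrow> (f has_real_derivative f' t) (at t) \<and> \<bar>f' t\<bar> \<le> M"
  shows "absolutely_cont_on a b f"
proof (rule lipschitz_absolutely_cont)
  fix u v assume uv: "a \<le> u" "u \<le> v" "v \<le> b"
  \<comment> \<open>The value zero at the exceptional points and outside the open interval makes the
    bound on the integrand hold everywhere.\<close>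
  let ?f = "\<lambda>t. if t \<in> {u<..<v} - S then f' t else 0"
  have "(?f has_integral (f v - f u)) {u..v}"
  proof (rule fundamental_theorem_of_calculus_interior_strong[OF assms(1) uv(2)])
    show "continuous_on {u..v} f" using assms(2) uv by (auto intro: continuous_on_subset)
    fix x assume "x \<in> {u<..<v} - S"
    then show "(f has_vector_derivative ?f x) (at x)"
      using assms(3)[of x] uv by (auto simp: has_real_derivative_iff_has_vector_derivative)
  qed
  then have "norm (f v - f u) \<le> \<bar>M\<bar> * measure lborel (cbox u v)"
    unfolding cbox_interval[symmetric]
  proof (rule has_integral_bound[rotated])
    fix x show "norm (?f x) \<le> \<bar>M\<bar>"
      using assms(3)[of x] uv by auto
  qed auto
  then show "\<bar>f v - f u\<bar> \<le> \<bar>M\<bar> * (v - u)" using uv by auto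
qed

text \<open>Compactness of \<open>{a..b}\<close> bounds \<open>h (y t)\<close> and
  \<open>g (x t)\<close>, hence both derivatives, which gives absolute continuity; the finite
  exceptional set has measure zero.\<close>

lemma piecewise_sol_caratheodory:
  assumes sol: "piecewise_sol (einterval \<rho>m \<rho>p) h g w a b x y"
    and h: "continuous_on (einterval \<rho>m \<rho>p) h" and g: "continuous_on UNIV g"
    and w: "\<And>t. t \<in> {a..b} \<Longrightarrow> \<bar>w t\<bar> \<le> W"
  shows "caratheodory_sol \<rho>m \<rho>p h g 0 w a b x y"
proof -
  obtain S where S: "finite S" "\<And>t. t\<in>{a<..<b} - S \<Longrightarrow>
        (x has_real_derivative h (y t)) (at t) \<and>
        (y has_real_derivative (- (w t * g (x t)))) (at t)"
    using sol unfolding piecewise_sol_def by blast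
  have cx: "continuous_on {a..b} x" and cy: "continuous_on {a..b} y"
    and J: "y ` {a..b} \<subseteq> einterval \<rho>m \<rho>p" using sol unfolding piecewise_sol_def by auto
  have "bounded ((\<lambda>t. h (y t)) ` {a..b})"
    by (intro compact_imp_bounded compact_continuous_image continuous_on_compose2[OF h cy J]) auto
  then obtain M where M: "\<And>t. t \<in> {a..b} \<Longrightarrow> \<bar>h (y t)\<bar> \<le> M"
    unfolding bounded_iff real_norm_def by blast
  have "bounded ((\<lambda>t. g (x t)) ` {a..b})"
    by (intro compact_imp_bounded compact_continuous_image continuous_on_compose2[OF g cx]) auto
  then obtain K where K: "\<And>t. t \<in> {a..b} \<Longrightarrow> \<bar>g (x t)\<bar> \<le> K"
    unfolding bounded_iff real_norm_def by blast
  have ax: "absolutely_cont_on a b x"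
    by (rule piecewise_derivative_absolutely_cont[OF S(1) cx, where f' = "\<lambda>t. h (y t)" and M = M])
      (use S M in auto)
  have ay: "absolutely_cont_on a b y"
  proof (rule piecewise_derivative_absolutely_cont[OF S(1) cy, where f' = "\<lambda>t. - (w t * g (x t))" and M = "W * K"])
    fix t assume t: "t \<in> {a<..<b} - S"
    then have "\<bar>w t\<bar> * \<bar>g (x t)\<bar> \<le> W * K" using w[of t] K[of t] by (intro mult_mono) auto
    then show "(y has_real_derivative - (w t * g (x t))) (at t) \<and> \<bar>- (w t * g (x t))\<bar> \<le> W * K"
      using S(2)[OF t] by (simp add: abs_mult)
  qed
  have "AE t in lborel. t \<notin> S \<union> {a, b}"
    using S(1) by (intro AE_not_in finite_imp_null_set_lborel) auto
  then have "AE t in lborel. t \<in> {a..b} \<longrightarrow>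
        (x has_real_derivative h (y t)) (at t within {a..b}) \<and>
        (y has_real_derivative (- 0 * x t - w t * g (x t))) (at t within {a..b})"
  proof (rule AE_mp, intro AE_I2 impI)
    fix t assume "t \<notin> S \<union> {a, b}" "t \<in> {a..b}"
    then have "t \<in> {a<..<b} - S" by auto
    from S(2)[OF this] show "(x has_real_derivative h (y t)) (at t within {a..b}) \<and>
        (y has_real_derivative (- 0 * x t - w t * g (x t))) (at t within {a..b})"
      by (auto intro: has_field_derivative_at_within)
  qed
  with ax ay J show ?thesis unfolding caratheodory_sol_def by auto
qed

subsection \<open>Orbits of a quarter turn\<close>

lemma continuous_inverse_on_interval:
  fixes F :: "real \<Rightarrow> real"
  assumes "0 \<le> A" "continuous_on {0..A} F" "strict_mono_on {0..A} F" "F 0 = 0"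
  shows "inv_into {0..A} F ` {0..F A} \<subseteq> {0..A}" "\<And>c. c \<in> {0..F A} \<Longrightarrow> F (inv_into {0..A} F c) = c"
    "continuous_on {0..F A} (inv_into {0..A} F)" "F ` {0..A} = {0..F A}"
proof -
  have inj: "inj_on F {0..A}" using assms(3) by (rule strict_mono_on_imp_inj_on)
  show im: "F ` {0..A} = {0..F A}"
  proof
    show "F ` {0..A} \<subseteq> {0..F A}"
      using strict_mono_on_imp_mono_on[OF assms(3)] assms(1,4) unfolding mono_on_def by force
    show "{0..F A} \<subseteq> F ` {0..A}"
      using IVT'[of F 0 _ A] assms by (auto simp: image_iff) (metis atLeastAtMost_iff)
  qed
  show "inv_into {0..A} F ` {0..F A} \<subseteq> {0..A}"
    unfolding im[symmetric] by (auto simp: inv_into_f_f[OF inj])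
  show "F (inv_into {0..A} F c) = c" if "c \<in> {0..F A}" for c
    using f_inv_into_f[of c F "{0..A}"] im that by simp
  show "continuous_on {0..F A} (inv_into {0..A} F)"
    using continuous_on_inv[OF assms(2) compact_Icc, of "inv_into {0..A} F"] im inj by simp
qed

lemma positive_derivative_strict_mono_on:
  fixes F f :: "real \<Rightarrow> real"
  assumes "\<And>u. u \<in> {0..A} \<Longrightarrow> (F has_real_derivative f u) (at u within {0..A})"
    and "\<And>u. u \<in> {0<..A} \<Longrightarrow> 0 < f u"
  shows "strict_mono_on {0..A} F"
proof (rule strict_mono_onI)
  fix r s assume rs: "r \<in> {0..A}" "s \<in> {0..A}" "r < s"
  have "continuous_on {0..A} F" using assms(1)
    by (meson DERIV_continuous continuous_on_eq_continuous_within)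
  then have "continuous_on {r..s} F" using rs by (auto intro: continuous_on_subset)
  then show "F r < F s"
  proof (rule DERIV_pos_imp_increasing_open[OF rs(3), rotated])
    fix x assume x: "r < x" "x < s"
    then have "at x within {0..A} = at x" using rs by (intro at_within_Icc_at) auto
    with assms(1)[of x] assms(2)[of x] x rs show "\<exists>y. (F has_real_derivative y) (at x) \<and> 0 < y" by auto
  qed
qed

text \<open>The system \<open>p' = f1(q)\<close>, \<open>q' = -f2(p)\<close> in the first quadrant with energy \<open>F1(q) + F2(p)\<close>;
  the motion in every quadrant takes this form after a rotation by a multiple of a right angle.\<close>

locale quarter_orbits =
  fixes f1 f2 F1 F2 :: "real \<Rightarrow> real" and A1 A2 c1 C :: real
  assumes c1: "0 < c1" "c1 \<le> C" and A: "0 < A1" "0 < A2"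
    and F0: "F1 0 = 0" "F2 0 = 0" and FA: "F1 A1 = C" "F2 A2 = C"
    and F1': "\<And>q. q \<in> {0..A1} \<Longrightarrow> (F1 has_real_derivative f1 q) (at q within {0..A1})"
    and F2': "\<And>p. p \<in> {0..A2} \<Longrightarrow> (F2 has_real_derivative f2 p) (at p within {0..A2})"
    and f_cont: "continuous_on {0..A1} f1" "continuous_on {0..A2} f2"
    and f0: "f1 0 = 0" "f2 0 = 0"
    and f_pos: "\<And>q. q \<in> {0<..A1} \<Longrightarrow> 0 < f1 q" "\<And>p. p \<in> {0<..A2} \<Longrightarrow> 0 < f2 p"
begin

definition q0 where "q0 = inv_into {0..A1} F1"
definition p0 where "p0 = inv_into {0..A2} F2"
definition E where "E = (\<lambda>(p, q). F1 q + F2 p)"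
definition D where "D = {z. fst z \<in> {0..A2} \<and> snd z \<in> {0..A1} \<and> E z \<in> {c1..C}}"
text \<open>On the level \<open>c\<close> the difference of the coordinates runs from
  \<open>- q0 c\<close> on the second axis to \<open>p0 c\<close> on the first; \<open>R\<close>
  rescales it to \<open>{0..1}\<close> on every level.\<close>

definition R where "R = (\<lambda>z. (fst z - snd z + q0 (E z)) / (p0 (E z) + q0 (E z)))"

lemma F_cont: "continuous_on {0..A1} F1" "continuous_on {0..A2} F2"
  by (rule DERIV_continuous_on, rule F1', assumption) (rule DERIV_continuous_on, rule F2', assumption)

lemma F_mono: "strict_mono_on {0..A1} F1" "strict_mono_on {0..A2} F2"
  using positive_derivative_strict_mono_on[OF F1' f_pos(1)] positive_derivative_strict_mono_on[OF F2' f_pos(2)]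
  by auto

lemmas F1_less = strict_mono_onD[OF F_mono(1)]
lemmas F2_less = strict_mono_onD[OF F_mono(2)]

lemma F1_less_iff: "u \<in> {0..A1} \<Longrightarrow> v \<in> {0..A1} \<Longrightarrow> F1 u < F1 v \<longleftrightarrow> u < v"
  using F1_less[of u v] F1_less[of v u] by (cases u v rule: linorder_cases) auto
lemma F2_less_iff: "u \<in> {0..A2} \<Longrightarrow> v \<in> {0..A2} \<Longrightarrow> F2 u < F2 v \<longleftrightarrow> u < v"
  using F2_less[of u v] F2_less[of v u] by (cases u v rule: linorder_cases) auto

lemma F1_nonneg: "q \<in> {0..A1} \<Longrightarrow> 0 \<le> F1 q" and F2_nonneg: "p \<in> {0..A2} \<Longrightarrow> 0 \<le> F2 p"
  using F1_less[of 0 q] F2_less[of 0 p] F0 A by (auto simp: le_less)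

lemma q0: "c \<in> {0..C} \<Longrightarrow> q0 c \<in> {0..A1}" "c \<in> {0..C} \<Longrightarrow> F1 (q0 c) = c" "continuous_on {0..C} q0"
  "q \<in> {0..A1} \<Longrightarrow> q0 (F1 q) = q"
  using continuous_inverse_on_interval[OF _ F_cont(1) F_mono(1) F0(1)] A
    inv_into_f_f[OF strict_mono_on_imp_inj_on[OF F_mono(1)]]
  unfolding q0_def FA by (auto simp: image_subset_iff)

lemma p0: "c \<in> {0..C} \<Longrightarrow> p0 c \<in> {0..A2}" "c \<in> {0..C} \<Longrightarrow> F2 (p0 c) = c" "continuous_on {0..C} p0"
  "p \<in> {0..A2} \<Longrightarrow> p0 (F2 p) = p"
  using continuous_inverse_on_interval[OF _ F_cont(2) F_mono(2) F0(2)] A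
    inv_into_f_f[OF strict_mono_on_imp_inj_on[OF F_mono(2)]]
  unfolding p0_def FA by (auto simp: image_subset_iff)

lemma pq0_pos: assumes "c \<in> {c1..C}" shows "0 < q0 c" "0 < p0 c"
proof -
  have "c \<in> {0..C}" "c > 0" using assms c1 by auto
  then show "0 < q0 c" "0 < p0 c" using q0(1,2)[of c] p0(1,2)[of c] F0
    by (metis atLeastAtMost_iff less_le less_irrefl)+
qed

lemma E_cont: "continuous_on {z. fst z \<in> {0..A2} \<and> snd z \<in> {0..A1}} E"
  unfolding E_def case_prod_unfold
  by (intro continuous_intros continuous_on_compose2[OF F_cont(1)] continuous_on_compose2[OF F_cont(2)]) auto

lemma E_cont_D: "continuous_on D E"
  by (rule continuous_on_subset[OF E_cont]) (auto simp: D_def)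

lemma compact_D: "compact D"
proof -
  have *: "{z. fst z \<in> {0..A2} \<and> snd z \<in> {0..A1}} = {0..A2} \<times> {0..A1}" by auto
  have "D = ({0..A2} \<times> {0..A1}) \<inter> E -` {c1..C}" unfolding D_def by auto
  moreover have "closed (({0..A2} \<times> {0..A1}) \<inter> E -` {c1..C})"
    using E_cont unfolding * by (intro continuous_closed_preimage closed_Times) auto
  moreover have "compact ({0..A2} \<times> {0..A1})" by (intro compact_Times) auto
  ultimately show ?thesis by (metis closed_Int_compact inf.absorb_iff1 inf_le1)
qed

lemma D_le: assumes "z \<in> D" shows "fst z \<le> p0 (E z)" "snd z \<le> q0 (E z)" "E z \<in> {0..C}"
proof -
  obtain p q where z: "z = (p, q)" by (cases z)
  have *: "p \<in> {0..A2}" "q \<in> {0..A1}" "E z = F1 q + F2 p" and c: "E z \<in> {0..C}"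
    using assms c1 unfolding z D_def E_def by auto
  show "E z \<in> {0..C}" by fact
  have "\<not> p0 (E z) < p" using F2_less[of "p0 (E z)" p] p0(1,2)[OF c] F1_nonneg[of q] * by auto
  then show "fst z \<le> p0 (E z)" using z by simp
  have "\<not> q0 (E z) < q" using F1_less[of "q0 (E z)" q] q0(1,2)[OF c] F2_nonneg[of p] * by auto
  then show "snd z \<le> q0 (E z)" using z by simp
qed

lemma R_cont: "continuous_on D R"
proof -
  have 1: "continuous_on D (\<lambda>z. q0 (E z))" "continuous_on D (\<lambda>z. p0 (E z))"
    using D_le by (auto intro!: continuous_on_compose2[OF q0(3) E_cont_D] continuous_on_compose2[OF p0(3) E_cont_D])
  show ?thesis unfolding R_def
    using pq0_pos by (intro continuous_intros 1) (fastforce simp: D_def)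
qed

lemma R_range: assumes "z \<in> D" shows "R z \<in> {0..1}"
  using D_le[OF assms] pq0_pos[of "E z"] assms unfolding R_def by (auto simp: D_def field_simps)

text \<open>Between two points with the same difference of coordinates both coordinates change in
  the same direction, and then the energy, strictly increasing in each of them, changes as
  well.\<close>

lemma inj_ER: "inj_on (\<lambda>z. (E z, R z)) D"
proof (rule inj_onI)
  fix z w assume zw: "z \<in> D" "w \<in> D" and eq: "(E z, R z) = (E w, R w)"
  have "E z \<in> {c1..C}" using zw by (auto simp: D_def)
  then have pos: "p0 (E z) + q0 (E z) \<noteq> 0" using pq0_pos[of "E z"] by auto
  have d: "fst z - snd z = fst w - snd w" using eq pos unfolding R_def by auto
  have en: "F1 (snd z) + F2 (fst z) = F1 (snd w) + F2 (fst w)" using eq unfolding E_def by (simp add: case_prod_unfold)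
  have r: "fst z \<in> {0..A2}" "snd z \<in> {0..A1}" "fst w \<in> {0..A2}" "snd w \<in> {0..A1}" using zw by (auto simp: D_def)
  show "z = w"
  proof (cases "fst z" "fst w" rule: linorder_cases)
    case less then show ?thesis using F1_less[of "snd z" "snd w"] F2_less[of "fst z" "fst w"] d en r by auto
  next
    case greater then show ?thesis using F1_less[of "snd w" "snd z"] F2_less[of "fst w" "fst z"] d en r by auto
  qed (use d in \<open>auto simp: prod_eq_iff\<close>)
qed

text \<open>On the curve \<open>q = q0 (c - F2 p)\<close> the difference \<open>p - q\<close> takes
  every value between those at the two ends, by the intermediate value theorem.\<close>

lemma surj_ER: "(\<lambda>z. (E z, R z)) ` D = {c1..C} \<times> {0..1}"
proof (rule equalityI)
  show "(\<lambda>z. (E z, R z)) ` D \<subseteq> {c1..C} \<times> {0..1}" using R_range by (auto simp: D_def)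
  show "{c1..C} \<times> {0..1} \<subseteq> (\<lambda>z. (E z, R z)) ` D"
  proof clarify
    fix c r assume c: "c \<in> {c1..C}" and r: "r \<in> {0..1::real}"
    have c': "c \<in> {0..C}" using c c1 by auto
    note pos = pq0_pos[OF c]
    have sub: "F2 p \<in> {0..c}" if "p \<in> {0..p0 c}" for p
      using F2_less[of p "p0 c"] p0(1,2)[OF c'] F2_nonneg[of p] that by (cases "p = p0 c") auto
    have sub': "c - F2 p \<in> {0..C}" if "p \<in> {0..p0 c}" for p
      using sub[OF that] c' by auto
    have cq: "continuous_on {0..p0 c} (\<lambda>p. q0 (c - F2 p))"
      using sub' p0(1)[OF c'] by (intro continuous_on_compose2[OF q0(3)] continuous_intros
          continuous_on_subset[OF F_cont(2)]) auto
    let ?s = "\<lambda>p. p - q0 (c - F2 p)"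
    have s0: "?s 0 = - q0 c" using F0 by simp
    have "q0 0 = 0" using q0(4)[of 0] A F0 by simp
    then have s1: "?s (p0 c) = p0 c" using p0(2)[OF c'] by simp
    have "0 \<le> r * (p0 c + q0 c)" "r * (p0 c + q0 c) \<le> 1 * (p0 c + q0 c)"
      using r pos by (auto intro!: mult_nonneg_nonneg mult_right_mono)
    then have "- q0 c \<le> - q0 c + r * (p0 c + q0 c)" "- q0 c + r * (p0 c + q0 c) \<le> p0 c" unfolding mult_1 by linarith+
    then have "\<exists>p\<ge>0. p \<le> p0 c \<and> ?s p = - q0 c + r * (p0 c + q0 c)"
      using s0 s1 pos by (intro IVT' continuous_intros cq) auto
    then obtain p where p: "p \<in> {0..p0 c}" "?s p = - q0 c + r * (p0 c + q0 c)" by auto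
    let ?z = "(p, q0 (c - F2 p))"
    have Ez: "E ?z = c" unfolding E_def using q0(2)[OF sub'[OF p(1)]] by simp
    have "?z \<in> D" unfolding D_def mem_Collect_eq Ez using p p0(1)[OF c'] q0(1)[OF sub'[OF p(1)]] c by auto
    moreover have "R ?z = r" unfolding R_def Ez using p(2) pos by (simp add: field_simps)
    ultimately show "(c, r) \<in> (\<lambda>z. (E z, R z)) ` D" using Ez by (intro image_eqI[of _ _ ?z]) auto
  qed
qed

text \<open>\<open>Z\<close> parametrises all quarter orbits at once, by energy and relative
  position. Since \<open>D\<close> is compact, this inverse of a continuous bijection is continuous
  jointly in both parameters.\<close>

definition Z where "Z = (SOME Z. homeomorphism D ({c1..C} \<times> {0..1}) (\<lambda>z. (E z, R z)) Z)"

lemma Z_homeo: "homeomorphism D ({c1..C} \<times> {0..1}) (\<lambda>z. (E z, R z)) Z"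
  unfolding Z_def
  by (rule someI_ex[OF homeomorphism_compact[OF compact_D continuous_on_Pair[OF E_cont_D R_cont] surj_ER inj_ER]])

lemma Z_cont: "continuous_on ({c1..C} \<times> {0..1}) Z" using Z_homeo by (simp add: homeomorphism_def)

lemma Z_D: "c \<in> {c1..C} \<Longrightarrow> r \<in> {0..1} \<Longrightarrow> Z (c, r) \<in> D"
  using homeomorphism_image2[OF Z_homeo] by blast

lemma Z_ER: "z \<in> D \<Longrightarrow> Z (E z, R z) = z"
  using homeomorphism_apply1[OF Z_homeo] by simp

lemma Z_E: "c \<in> {c1..C} \<Longrightarrow> r \<in> {0..1} \<Longrightarrow> E (Z (c, r)) = c"
  and Z_R: "c \<in> {c1..C} \<Longrightarrow> r \<in> {0..1} \<Longrightarrow> R (Z (c, r)) = r"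
  using homeomorphism_apply2[OF Z_homeo, of "(c, r)"] by simp_all

lemma Z_start: assumes "c \<in> {c1..C}" shows "Z (c, 0) = (0, q0 c)"
proof -
  have "c \<in> {0..C}" using assms c1 by auto
  then have "E (0, q0 c) = c" "(0, q0 c) \<in> D" "R (0, q0 c) = 0" unfolding D_def E_def R_def
    using q0(1,2)[of c] F0 A assms by auto
  then show ?thesis using Z_ER[of "(0, q0 c)"] by simp
qed

lemma Z_end: assumes "c \<in> {c1..C}" shows "Z (c, 1) = (p0 c, 0)"
proof -
  have "c \<in> {0..C}" using assms c1 by auto
  then have E: "E (p0 c, 0) = c" "(p0 c, 0) \<in> D" unfolding D_def E_def
    using p0(1,2)[of c] F0 A assms by auto
  then have "R (p0 c, 0) = 1" unfolding R_def using pq0_pos[OF assms] by simp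
  then show ?thesis using Z_ER[OF E(2)] E by simp
qed

text \<open>By injectivity of \<open>F1\<close> and \<open>F2\<close>, a point of level
  \<open>c\<close> on one of the axes is an end point of the orbit, and \<open>R\<close> separates
  the end points from the other positions.\<close>

lemma Z_pos:
  assumes "c \<in> {c1..C}" "r \<in> {0..1}"
  shows "0 < r \<Longrightarrow> 0 < fst (Z (c, r))" "r < 1 \<Longrightarrow> 0 < snd (Z (c, r))"
proof -
  have Z: "Z (c, r) \<in> D" "E (Z (c, r)) = c" using Z_D Z_E assms by auto
  have c': "c \<in> {0..C}" using assms c1 by auto
  have nn: "0 \<le> fst (Z (c, r))" "0 \<le> snd (Z (c, r))" using Z(1) by (auto simp: D_def)
  obtain p q where pq: "Z (c, r) = (p, q)" by fastforce
  have pq': "p \<in> {0..A2}" "q \<in> {0..A1}" "F1 q + F2 p = c" using Z unfolding pq D_def E_def by auto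
  show "0 < fst (Z (c, r))" if "0 < r"
  proof (rule ccontr)
    assume "\<not> 0 < fst (Z (c, r))"
    then have "p = 0" using nn pq by simp
    then have "q = q0 c" using pq' q0(4) F0 by auto
    then have "Z (c, r) = Z (c, 0)" using pq \<open>p = 0\<close> Z_start assms by simp
    then show False using Z_R[of c r] Z_R[of c 0] assms that by auto
  qed
  show "0 < snd (Z (c, r))" if "r < 1"
  proof (rule ccontr)
    assume "\<not> 0 < snd (Z (c, r))"
    then have "q = 0" using nn pq by simp
    then have "p = p0 c" using pq' p0(4) F0 by auto
    then have "Z (c, r) = Z (c, 1)" using pq \<open>q = 0\<close> Z_end assms by simp
    then show False using Z_R[of c r] Z_R[of c 1] assms that by auto
  qed
qed

end

text \<open>\<open>swap\<close> tells the quarters that run from the \<open>x\<close>-axis to the \<open>y\<close>-axis (in the quadrants II and IV)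
  from the others.\<close>

definition quarter_flow ::
  "(real \<times> real \<Rightarrow> real) \<Rightarrow> (real \<times> real) set \<Rightarrow> real \<Rightarrow> real \<Rightarrow> (real \<Rightarrow> real) \<Rightarrow> (real \<Rightarrow> real) \<Rightarrow> bool
    \<Rightarrow> (real \<Rightarrow> real) \<Rightarrow> (real \<times> real \<Rightarrow> real \<times> real) \<Rightarrow> (real \<times> real \<Rightarrow> real) \<Rightarrow> bool" where
  "quarter_flow En A c1 C h k swap T U \<tau> \<longleftrightarrow>
     continuous_on {c1..C} T \<and> (\<forall>c\<in>{c1..C}. 0 < T c) \<and>
     continuous_on {(c, t). c \<in> {c1..C} \<and> t \<in> {0..T c}} U \<and>
     (\<forall>c\<in>{c1..C}. \<forall>t\<in>{0..T c}. U (c, t) \<in> A \<and> En (U (c, t)) = c \<and>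
        (fst (U (c, t)) = 0 \<longleftrightarrow> t = (if swap then T c else 0)) \<and>
        (snd (U (c, t)) = 0 \<longleftrightarrow> t = (if swap then 0 else T c))) \<and>
     (\<forall>c\<in>{c1..C}. \<forall>t\<in>{0<..<T c}.
        ((\<lambda>t. fst (U (c, t))) has_real_derivative h (snd (U (c, t)))) (at t) \<and>
        ((\<lambda>t. snd (U (c, t))) has_real_derivative - k (fst (U (c, t)))) (at t)) \<and>
     continuous_on A En \<and> continuous_on A \<tau> \<and>
     (\<forall>z\<in>A. En z \<in> {c1..C} \<and> \<tau> z \<in> {0..T (En z)} \<and> U (En z, \<tau> z) = z)"

section \<open>Elapsed time along a quarter orbit\<close>

context quarter_orbits
begin

text \<open>Under \<open>p' = f1(q)\<close>, \<open>q' = -f2(p)\<close> the difference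
  \<open>p - q\<close> grows at the rate \<open>speed\<close> through an interval of length
  \<open>len c\<close>. Hence \<open>psi\<close> is the derivative of time with respect to the
  relative position.\<close>

definition len where "len c = p0 c + q0 c"
definition speed where "speed z = f1 (snd z) + f2 (fst z)"
definition psi where "psi = (\<lambda>(c, r). len c / speed (Z (c, r)))"
text \<open>The integral of \<open>psi\<close> over \<open>{0..r}\<close> after a linear
  substitution: with a fixed interval of integration, joint continuity in energy and position is
  continuity of a parameter integral.\<close>

definition T where "T = (\<lambda>(c, r). integral {0..1} (\<lambda>u. r * psi (c, r * u)))"

lemma len_pos: "c \<in> {c1..C} \<Longrightarrow> 0 < len c" using pq0_pos unfolding len_def by (simp add: add_pos_pos)

lemma f_nonneg: "q \<in> {0..A1} \<Longrightarrow> 0 \<le> f1 q" "p \<in> {0..A2} \<Longrightarrow> 0 \<le> f2 p"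
  using f_pos f0 by (cases "q = 0", auto simp: less_imp_le) (cases "p = 0", auto simp: less_imp_le)

text \<open>Both terms vanish together only at the origin, which has energy zero and is excluded
  from \<open>D\<close> by \<open>0 < c1\<close>.\<close>

lemma speed_pos: assumes "z \<in> D" shows "0 < speed z"
proof -
  obtain p q where z: "z = (p, q)" by (cases z)
  have *: "p \<in> {0..A2}" "q \<in> {0..A1}" "0 < F1 q + F2 p" using assms c1 unfolding z D_def E_def by auto
  then have "p \<noteq> 0 \<or> q \<noteq> 0" using F0 by auto
  then show ?thesis using * f_nonneg(1)[of q] f_nonneg(2)[of p] f_pos(1)[of q] f_pos(2)[of p] unfolding z speed_def
    by (auto simp: add_pos_nonneg add_nonneg_pos)
qed

text \<open>At fixed energy, \<open>q\<close> is a function \<open>qf\<close> of \<open>p\<close>,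
  and so is the relative position, \<open>rf\<close>. As \<open>rf\<close> has a positive
  derivative, \<open>p\<close> is differentiated by the rule for inverse functions and
  \<open>q\<close> by the chain rule. At interior positions \<open>f1 q\<close> is positive and can
  be divided by.\<close>

lemma Z_deriv:
  assumes c: "c \<in> {c1..C}" and r: "0 < r" "r < 1"
  defines "p \<equiv> fst (Z (c, r))" and "q \<equiv> snd (Z (c, r))"
  shows "((\<lambda>r. fst (Z (c, r))) has_real_derivative psi (c, r) * f1 q) (at r)"
    and "((\<lambda>r. snd (Z (c, r))) has_real_derivative - (psi (c, r) * f2 p)) (at r)"
proof -
  let ?P = "\<lambda>r. fst (Z (c, r))"
  define qf where "qf = (\<lambda>p. q0 (c - F2 p))"
  define rf where "rf = (\<lambda>p. (p - qf p + q0 c) / len c)"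
  have c': "c \<in> {0..C}" using c c1 by auto
  have ZD: "Z (c, s) \<in> D" "E (Z (c, s)) = c" if "s \<in> {0..1}" for s using Z_D Z_E c that by auto
  have snd_eq: "snd (Z (c, s)) = qf (?P s)" if "s \<in> {0..1}" for s
  proof -
    have "F1 (snd (Z (c, s))) + F2 (?P s) = c" "snd (Z (c, s)) \<in> {0..A1}"
      using ZD[OF that] by (auto simp: D_def E_def case_prod_unfold)
    then show ?thesis unfolding qf_def using q0(4)[of "snd (Z (c, s))"] by (metis add_diff_cancel_right')
  qed
  have rf_P: "rf (?P s) = s" if "s \<in> {0..1}" for s
  proof -
    have "R (Z (c, s)) = s" using Z_R c that by auto
    then show ?thesis unfolding R_def ZD(2)[OF that] rf_def len_def snd_eq[OF that] .
  qed
  have pq: "0 < p" "0 < q" using Z_pos[OF c, of r] r unfolding p_def q_def by auto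
  have pA: "p \<le> A2" "q \<le> A1" "F1 q + F2 p = c"
    using ZD[of r] r unfolding p_def q_def by (auto simp: D_def E_def case_prod_unfold)
  have FP: "0 < F1 q" "0 < F2 p" using F1_less[of 0 q] F2_less[of 0 p] F0 pq pA by auto
  have "F1 q < F1 A1" "F2 p < F2 A2" using FP pA FA c by auto
  then have pA': "p < A2" "q < A1" using F1_less_iff[of q A1] F2_less_iff[of p A2] pq pA by auto
  have q_eq: "q = qf p" using snd_eq[of r] r unfolding p_def q_def by auto
  have F1q: "(F1 has_real_derivative f1 q) (at q)"
    using F1'[of q] pq pA' by (simp add: at_within_Icc_at)
  have F2p: "(F2 has_real_derivative f2 p) (at p)"
    using F2'[of p] pq pA' by (simp add: at_within_Icc_at)
  have cF: "c - F2 p = F1 q" using pA by simp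
  have fq: "f1 q > 0" "f2 p > 0" using f_pos(1)[of q] f_pos(2)[of p] pq pA by auto
  have "isCont q0 (c - F2 p)"
    using q0(3) FP pA c by (intro continuous_on_interior[of "{0..C}"]) (auto simp: interior_atLeastAtMost_real)
  then have "(q0 has_real_derivative inverse (f1 q)) (at (c - F2 p))"
    using F1q FP q0(2) fq c' pA unfolding cF
    by (intro DERIV_inverse_function[where f = F1 and a = 0 and b = C]) (auto simp: q0(4) pq pA' less_imp_le)
  then have "((\<lambda>p. q0 (c - F2 p)) has_real_derivative inverse (f1 q) * - f2 p) (at p)"
    by (rule DERIV_chain2) (use F2p in \<open>auto intro!: derivative_eq_intros\<close>)
  then have qf': "(qf has_real_derivative - (f2 p / f1 q)) (at p)"
    unfolding qf_def by (simp add: field_simps)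
  have rf': "(rf has_real_derivative (1 + f2 p / f1 q) / len c) (at p)"
    unfolding rf_def using len_pos[OF c] by (auto intro!: derivative_eq_intros qf')
  have cZ: "continuous_on {0..1} (\<lambda>r. Z (c, r))"
    using c by (intro continuous_on_compose2[OF Z_cont] continuous_intros) auto
  have "isCont ?P r"
    using r by (intro continuous_on_interior[of "{0..1}"] continuous_intros cZ) auto
  then have P': "(?P has_real_derivative inverse ((1 + f2 p / f1 q) / len c)) (at r)"
    using rf' len_pos[OF c] fq r unfolding p_def
    by (intro DERIV_inverse_function[where f = rf and a = 0 and b = 1 and g = ?P]) (auto simp: rf_P add_pos_pos less_imp_neq[symmetric])
  have eq: "inverse ((1 + f2 p / f1 q) / len c) = psi (c, r) * f1 q"
    unfolding psi_def speed_def p_def[symmetric] q_def[symmetric] prod.case using fq len_pos[OF c] by (simp add: field_simps)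
  show 1: "(?P has_real_derivative psi (c, r) * f1 q) (at r)" using P' unfolding eq .
  have "((\<lambda>s. qf (?P s)) has_real_derivative - (f2 p / f1 q) * (psi (c, r) * f1 q)) (at r)"
    by (rule DERIV_chain2[OF _ 1]) (use qf' in \<open>simp add: p_def\<close>)
  moreover have "- (f2 p / f1 q) * (psi (c, r) * f1 q) = - (psi (c, r) * f2 p)" using fq by simp
  ultimately have 2: "((\<lambda>s. qf (?P s)) has_real_derivative - (psi (c, r) * f2 p)) (at r)" by simp
  have ev: "eventually (\<lambda>s. qf (?P s) = snd (Z (c, s))) (nhds r)"
  proof -
    have "eventually (\<lambda>s. s \<in> {0<..<1}) (nhds r)" using r by (intro eventually_nhds_in_open) auto
    then show ?thesis by eventually_elim (simp add: snd_eq)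
  qed
  from 2 show "((\<lambda>r. snd (Z (c, r))) has_real_derivative - (psi (c, r) * f2 p)) (at r)"
    using DERIV_cong_ev[OF refl ev refl] by blast
qed

lemma psi_cont: "continuous_on ({c1..C} \<times> {0..1}) psi"
proof -
  have 1: "continuous_on ({c1..C} \<times> {0..1}) (\<lambda>x. f1 (snd (Z x)))" "continuous_on ({c1..C} \<times> {0..1}) (\<lambda>x. f2 (fst (Z x)))"
    using Z_D by (auto intro!: continuous_on_compose2[OF f_cont(1)] continuous_on_compose2[OF f_cont(2)]
      continuous_intros Z_cont simp: D_def)
  have 2: "continuous_on ({c1..C} \<times> {0..1::real}) (\<lambda>x. p0 (fst x))" "continuous_on ({c1..C} \<times> {0..1::real}) (\<lambda>x. q0 (fst x))"
    using c1 by (auto intro!: continuous_on_compose2[OF p0(3)] continuous_on_compose2[OF q0(3)] continuous_intros)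
  have "speed (Z x) \<noteq> 0" if "x \<in> {c1..C} \<times> {0..1}" for x
    using speed_pos[of "Z x"] Z_D[of "fst x" "snd x"] that by auto
  then show ?thesis unfolding psi_def case_prod_unfold prod.collapse speed_def len_def
    by (intro continuous_intros 1 2) auto
qed

lemma psi_pos: "c \<in> {c1..C} \<Longrightarrow> r \<in> {0..1} \<Longrightarrow> 0 < psi (c, r)"
  unfolding psi_def using len_pos speed_pos Z_D by auto

lemma psi_cont': "c \<in> {c1..C} \<Longrightarrow> continuous_on {0..1} (\<lambda>r. psi (c, r))"
  by (intro continuous_on_compose2[OF psi_cont] continuous_intros) auto

lemma T_cont: "continuous_on ({c1..C} \<times> {0..1}) T"
proof -
  have *: "snd x * t \<in> {0..1}" if "x \<in> {c1..C} \<times> {0..1::real}" "t \<in> {0..1::real}" for x t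
    using that by (auto intro: mult_le_one)
  have "continuous_on (({c1..C} \<times> {0..1}) \<times> cbox 0 1) (\<lambda>(x, u). snd x * psi (fst x, snd x * u))"
    unfolding case_prod_unfold using *
    by (intro continuous_intros continuous_on_compose2[OF psi_cont]) (auto simp: mem_Times_iff)
  from integral_continuous_on_param[OF this] show ?thesis by (simp add: T_def case_prod_unfold)
qed

lemma T_eq: assumes "c \<in> {c1..C}" "r \<in> {0..1}" shows "T (c, r) = integral {0..r} (\<lambda>u. psi (c, u))"
proof -
  have "((\<lambda>u. r *\<^sub>R psi (c, r * u)) has_integral integral {r * 0..r * 1} (\<lambda>u. psi (c, u))) {0..1}"
  proof (rule has_integral_substitution[where c = 0 and d = 1])
    show "(*) r ` {0..1} \<subseteq> {0..1}" using assms by (auto intro: mult_le_one)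
  qed (use assms psi_cont'[OF assms(1)] in \<open>auto intro!: derivative_eq_intros\<close>)
  then show ?thesis unfolding T_def prod.case by (intro integral_unique) simp
qed

lemma T_deriv: assumes "c \<in> {c1..C}" "r \<in> {0..1}"
  shows "((\<lambda>r. T (c, r)) has_real_derivative psi (c, r)) (at r within {0..1})"
proof -
  have "((\<lambda>r. integral {0..r} (\<lambda>u. psi (c, u))) has_real_derivative psi (c, r)) (at r within {0..1})"
    by (rule integral_has_real_derivative[OF psi_cont'[OF assms(1)] assms(2)])
  then show ?thesis
    by (rule has_field_derivative_transform_within[OF _ zero_less_one assms(2)]) (use assms T_eq in auto)
qed

lemma T_0: "T (c, 0) = 0" unfolding T_def by simp

lemma T_mono: assumes "c \<in> {c1..C}" shows "strict_mono_on {0..1} (\<lambda>r. T (c, r))"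
  using positive_derivative_strict_mono_on[OF T_deriv[OF assms] psi_pos[OF assms]] by auto

definition quarter_time where "quarter_time c = T (c, 1)"
definition W where "W = {(c, t). c \<in> {c1..C} \<and> t \<in> {0..quarter_time c}}"

lemma quarter_time_cont: "continuous_on {c1..C} quarter_time"
  unfolding quarter_time_def by (intro continuous_on_compose2[OF T_cont] continuous_intros) auto

text \<open>On each level, time increases strictly from zero to \<open>quarter_time c\<close>.
  \<open>W\<close> collects these time intervals, whose length depends on the energy.\<close>

lemma T_bij:
  "inj_on (\<lambda>x. (fst x, T x)) ({c1..C} \<times> {0..1})" "(\<lambda>x. (fst x, T x)) ` ({c1..C} \<times> {0..1}) = W"
proof -
  show "inj_on (\<lambda>x. (fst x, T x)) ({c1..C} \<times> {0..1})"
  proof (rule inj_onI)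
    fix x y assume xy: "x \<in> {c1..C} \<times> {0..1}" "y \<in> {c1..C} \<times> {0..1}" "(fst x, T x) = (fst y, T y)"
    then have "fst y = fst x" "T (fst x, snd x) = T (fst x, snd y)" "fst x \<in> {c1..C}"
      by (auto simp: mem_Times_iff)  (metis prod.collapse)
    then show "x = y" using inj_onD[OF strict_mono_on_imp_inj_on[OF T_mono], of "fst x" "snd x" "snd y"] xy
      by (auto simp: prod_eq_iff mem_Times_iff)
  qed
  have surj: "\<exists>r\<in>{0..1}. T (c, r) = t" if "c \<in> {c1..C}" "0 \<le> t" "t \<le> T (c, 1)" for c t
  proof -
    have "continuous_on {0..1} (\<lambda>r. T (c, r))" using that(1)
      by (intro continuous_on_compose2[OF T_cont] continuous_intros) auto
    then show ?thesis using IVT'[of "\<lambda>r. T (c, r)" 0 t 1] that T_0 by auto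
  qed
  have "T (c, r) \<in> {0..T (c, 1)}" if "c \<in> {c1..C}" "r \<in> {0..1}" for c r
    using strict_mono_on_imp_mono_on[OF T_mono[OF that(1)]] that(2) T_0[of c] unfolding mono_on_def
    by (metis atLeastAtMost_iff order_refl zero_le_one)
  note range = this
  show "(\<lambda>x. (fst x, T x)) ` ({c1..C} \<times> {0..1}) = W"
  proof (rule equalityI)
    show "(\<lambda>x. (fst x, T x)) ` ({c1..C} \<times> {0..1}) \<subseteq> W"
      using range unfolding W_def quarter_time_def by auto
    show "W \<subseteq> (\<lambda>x. (fst x, T x)) ` ({c1..C} \<times> {0..1})"
    proof clarify
      fix c t assume "(c, t) \<in> W"
      then have c: "c \<in> {c1..C}" "0 \<le> t" "t \<le> T (c, 1)" unfolding W_def quarter_time_def by auto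
      then obtain r where "r \<in> {0..1}" "T (c, r) = t" using surj by blast
      then show "(c, t) \<in> (\<lambda>x. (fst x, T x)) ` ({c1..C} \<times> {0..1})"
        using c(1) by (intro image_eqI[of _ _ "(c, r)"]) auto
    qed
  qed
qed

text \<open>\<open>U\<close> is \<open>Z\<close> reparametrised by time. The factor
  \<open>psi\<close> in \<open>Z_deriv\<close> cancels against the derivative \<open>1 / psi\<close>
  of the position with respect to time, which leaves the vector field itself.\<close>

lemma quarter_flow_ex: "\<exists>T U \<tau>. quarter_flow E D c1 C f1 f2 False T U \<tau>"
proof -
  let ?K = "{c1..C} \<times> {0..1::real}"
  have "compact ?K" by (intro compact_Times) auto
  moreover have "continuous_on ?K (\<lambda>x. (fst x, T x))" by (intro continuous_intros T_cont)
  ultimately obtain V where V: "homeomorphism ?K W (\<lambda>x. (fst x, T x)) V"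
    using homeomorphism_compact[OF _ _ T_bij(2,1)] by blast
  have V1: "V (c, T (c, r)) = (c, r)" if "c \<in> {c1..C}" "r \<in> {0..1}" for c r
    using homeomorphism_apply1[OF V, of "(c, r)"] that by simp
  have V2: "V x \<in> ?K" "fst (V x) = fst x" "T (V x) = snd x" if "x \<in> W" for x
    using homeomorphism_image2[OF V] homeomorphism_apply2[OF V that] that by (auto simp: prod_eq_iff)
  have Vc: "continuous_on W V" using V by (simp add: homeomorphism_def)
  define U where "U = (\<lambda>x. Z (V x))"
  define \<tau> where "\<tau> = (\<lambda>z. T (E z, R z))"
  have qt: "0 < quarter_time c" if "c \<in> {c1..C}" for c
    using strict_mono_onD[OF T_mono[OF that], of 0 1] T_0 unfolding quarter_time_def by simp
  have ER: "(E z, R z) \<in> ?K" if "z \<in> D" for z using that R_range by (auto simp: D_def)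
  have VW: "V (c, t) = (c, snd (V (c, t)))" "snd (V (c, t)) \<in> {0..1}" "T (c, snd (V (c, t))) = t" "c \<in> {c1..C}"
    if "(c, t) \<in> W" for c t
    using V2[OF that] by (auto simp: prod_eq_iff mem_Times_iff) (metis fst_conv prod.collapse)
  have UD: "U (c, t) \<in> D" "E (U (c, t)) = c" if "(c, t) \<in> W" for c t
    unfolding U_def using VW[OF that] Z_D[of c "snd (V (c, t))"] Z_E[of c "snd (V (c, t))"] by simp_all
  have "quarter_flow E D c1 C f1 f2 False quarter_time U \<tau>"
    unfolding quarter_flow_def
  proof (intro conjI ballI)
    show "continuous_on {c1..C} quarter_time" by (rule quarter_time_cont)
    show "continuous_on {(c, t). c \<in> {c1..C} \<and> t \<in> {0..quarter_time c}} U"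
      unfolding U_def W_def[symmetric] by (rule continuous_on_compose2[OF Z_cont Vc]) (use V2(1) in blast)
    fix c assume c: "c \<in> {c1..C}"
    show "0 < quarter_time c" by (rule qt[OF c])
    fix t assume t: "t \<in> {0..quarter_time c}"
    have W: "(c, t) \<in> W" using c t unfolding W_def by simp
    note v = VW[OF W]
    show "U (c, t) \<in> D" "E (U (c, t)) = c" using UD[OF W] by auto
    have "fst (U (c, t)) \<noteq> 0" if "t \<noteq> 0"
    proof -
      have "snd (V (c, t)) \<noteq> 0" using v(3) T_0 that by auto
      then show ?thesis unfolding U_def using v Z_pos(1)[OF c, of "snd (V (c, t))"] by auto
    qed
    moreover have "fst (U (c, 0)) = 0" unfolding U_def using V1[OF c, of 0] T_0 Z_start[OF c] by simp
    ultimately show "fst (U (c, t)) = 0 \<longleftrightarrow> t = (if False then quarter_time c else 0)" by auto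
    have "snd (U (c, t)) \<noteq> 0" if "t \<noteq> quarter_time c"
    proof -
      have "snd (V (c, t)) \<noteq> 1" using v(3) that unfolding quarter_time_def by auto
      then show ?thesis unfolding U_def using v Z_pos(2)[OF c, of "snd (V (c, t))"] by auto
    qed
    moreover have "snd (U (c, quarter_time c)) = 0"
      unfolding U_def quarter_time_def using V1[OF c, of 1] Z_end[OF c] by simp
    ultimately show "snd (U (c, t)) = 0 \<longleftrightarrow> t = (if False then 0 else quarter_time c)" by auto
  next
    show "continuous_on D E" by (rule E_cont_D)
    show "continuous_on D \<tau>" unfolding \<tau>_def using ER
      by (intro continuous_on_compose2[OF T_cont] continuous_intros E_cont_D R_cont) auto
  next
    fix z assume z: "z \<in> D"
    have "(E z, T (E z, R z)) \<in> W"
      using imageI[OF ER[OF z], of "\<lambda>x. (fst x, T x)"] unfolding T_bij(2) by simp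
    then show "E z \<in> {c1..C}" "\<tau> z \<in> {0..quarter_time (E z)}" unfolding \<tau>_def W_def by auto
    show "U (E z, \<tau> z) = z" unfolding \<tau>_def U_def using V1 ER[OF z] Z_ER[OF z] by simp
  next
    fix c t assume c: "c \<in> {c1..C}" and t': "t \<in> {0<..<quarter_time c}"
    then have t: "0 < t" "t < quarter_time c" by auto
    define \<rho> where "\<rho> = (\<lambda>t. snd (V (c, t)))"
    have W: "(c, s) \<in> W" if "s \<in> {0..quarter_time c}" for s using that c unfolding W_def by auto
    have \<rho>: "\<rho> s \<in> {0..1}" "T (c, \<rho> s) = s" "V (c, s) = (c, \<rho> s)" if "s \<in> {0..quarter_time c}" for s
      using VW[OF W[OF that]] unfolding \<rho>_def by auto
    have "\<rho> t \<noteq> 0" "\<rho> t \<noteq> 1" using \<rho>(2)[of t] t T_0 unfolding quarter_time_def by auto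
    then have \<rho>01: "0 < \<rho> t" "\<rho> t < 1" using \<rho>(1)[of t] t by auto
    have "continuous_on {0..quarter_time c} \<rho>" unfolding \<rho>_def
      using W by (intro continuous_intros continuous_on_compose2[OF Vc]) auto
    then have "isCont \<rho> t" using t by (intro continuous_on_interior[of "{0..quarter_time c}"]) auto
    moreover have "((\<lambda>r. T (c, r)) has_real_derivative psi (c, \<rho> t)) (at (\<rho> t))"
      using T_deriv[OF c, of "\<rho> t"] \<rho>01 by (simp add: at_within_Icc_at)
    ultimately have \<rho>': "(\<rho> has_real_derivative inverse (psi (c, \<rho> t))) (at t)"
      using psi_pos[OF c, of "\<rho> t"] \<rho>01 t \<rho>
      by (intro DERIV_inverse_function[where f = "\<lambda>r. T (c, r)" and a = 0 and b = "quarter_time c"]) auto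
    have pp: "psi (c, \<rho> t) > 0" using psi_pos[OF c, of "\<rho> t"] \<rho>01 by auto
    have U: "U (c, s) = Z (c, \<rho> s)" if "s \<in> {0..quarter_time c}" for s unfolding U_def using \<rho>(3)[OF that] by simp
    have ev: "eventually (\<lambda>s. U (c, s) = Z (c, \<rho> s)) (nhds t)"
    proof -
      have "eventually (\<lambda>s. s \<in> {0<..<quarter_time c}) (nhds t)" using t by (intro eventually_nhds_in_open) auto
      then show ?thesis by eventually_elim (simp add: U)
    qed
    have "((\<lambda>t. fst (Z (c, \<rho> t))) has_real_derivative psi (c, \<rho> t) * f1 (snd (Z (c, \<rho> t))) * inverse (psi (c, \<rho> t))) (at t)"
      by (rule DERIV_chain2[OF Z_deriv(1)[OF c \<rho>01] \<rho>'])
    then have 1: "((\<lambda>t. fst (Z (c, \<rho> t))) has_real_derivative f1 (snd (Z (c, \<rho> t)))) (at t)" by (rule DERIV_cong) (use pp in simp)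
    have "((\<lambda>t. snd (Z (c, \<rho> t))) has_real_derivative - (psi (c, \<rho> t) * f2 (fst (Z (c, \<rho> t)))) * inverse (psi (c, \<rho> t))) (at t)"
      by (rule DERIV_chain2[OF Z_deriv(2)[OF c \<rho>01] \<rho>'])
    then have 2: "((\<lambda>t. snd (Z (c, \<rho> t))) has_real_derivative - f2 (fst (Z (c, \<rho> t)))) (at t)" by (rule DERIV_cong) (use pp in simp)
    have ev1: "eventually (\<lambda>s. fst (U (c, s)) = fst (Z (c, \<rho> s))) (nhds t)"
      and ev2: "eventually (\<lambda>s. snd (U (c, s)) = snd (Z (c, \<rho> s))) (nhds t)"
      using ev by (auto elim!: eventually_mono)
    have Ut: "U (c, t) = Z (c, \<rho> t)" using U t by simp
    show "((\<lambda>t. fst (U (c, t))) has_real_derivative f1 (snd (U (c, t)))) (at t)"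
      "((\<lambda>t. snd (U (c, t))) has_real_derivative - f2 (fst (U (c, t)))) (at t)"
      using 1 2 DERIV_cong_ev[OF refl ev1 refl] DERIV_cong_ev[OF refl ev2 refl] unfolding Ut by blast+
  qed
  then show ?thesis by blast
qed

end

subsection \<open>The flow in an annulus\<close>

text \<open>The unit vector \<open>(a, b)\<close> encodes a rotation by a multiple of a right angle:
  \<open>L\<close> carries the model quadrant to the actual one, and \<open>M\<close> is its
  inverse. The assumption \<open>field\<close> says that the rotated model field is
  \<open>(h(y), -k(x))\<close>. The axes are exchanged exactly when \<open>a = 0\<close>.\<close>

lemma (in quarter_orbits) rotated_quarter_flow:
  fixes a b :: real
  assumes ab: "(a, b) \<in> {(1,0), (0,1), (-1,0), (0,-1)}"
    and A_eq: "\<And>z. z \<in> A \<longleftrightarrow> (a * fst z - b * snd z, b * fst z + a * snd z) \<in> D"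
    and En: "\<And>p q. (p, q) \<in> D \<Longrightarrow> En (a * p + b * q, a * q - b * p) = F1 q + F2 p"
    and field: "\<And>p q. (p, q) \<in> D \<Longrightarrow>
      a * f1 q - b * f2 p = h (a * q - b * p) \<and> a * f2 p + b * f1 q = k (a * p + b * q)"
  shows "\<exists>T U \<tau>. quarter_flow En A c1 C h k (a = 0) T U \<tau>"
proof -
  obtain T U \<tau> where "quarter_flow E D c1 C f1 f2 False T U \<tau>" using quarter_flow_ex by blast
  note U = this[unfolded quarter_flow_def]
  define L where "L = (\<lambda>z :: real \<times> real. (a * fst z + b * snd z, a * snd z - b * fst z))"
  define M where "M = (\<lambda>z :: real \<times> real. (a * fst z - b * snd z, b * fst z + a * snd z))"
  have inv_LM: "M (L z) = z \<and> L (M z) = z" for z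
    unfolding L_def M_def using ab by (auto simp: prod_eq_iff)
  have AM: "z \<in> A \<longleftrightarrow> M z \<in> D" for z unfolding M_def by (rule A_eq)
  have EnL: "En (L z) = E z" if "z \<in> D" for z
    using En[of "fst z" "snd z"] that unfolding L_def E_def by (simp add: case_prod_unfold)
  have contL: "continuous_on S L" for S unfolding L_def by (intro continuous_intros)
  have contM: "continuous_on S M" for S unfolding M_def by (intro continuous_intros)
  have "quarter_flow En A c1 C h k (a = 0) T (\<lambda>x. L (U x)) (\<lambda>z. \<tau> (M z))"
    unfolding quarter_flow_def
  proof (intro conjI ballI)
    show "continuous_on {(c, t). c \<in> {c1..C} \<and> t \<in> {0..T c}} (\<lambda>x. L (U x))"
      using U by (intro continuous_on_compose2[OF contL[of UNIV]]) auto
    have "continuous_on A (\<lambda>z. E (M z))"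
      using AM by (intro continuous_on_compose2[OF E_cont_D contM]) auto
    moreover have "En z = E (M z)" if "z \<in> A" for z using EnL[of "M z"] that AM inv_LM by simp
    ultimately show "continuous_on A En" using continuous_on_cong[of A A En "\<lambda>z. E (M z)"] by simp
    have "continuous_on D \<tau>" using U by (elim conjE)
    then show "continuous_on A (\<lambda>z. \<tau> (M z))"
      using AM by (intro continuous_on_compose2[OF _ contM]) auto
    fix c assume c: "c \<in> {c1..C}"
    show "0 < T c" using U c by (elim conjE) blast
    fix t assume t: "t \<in> {0..T c}"
    have *: "U (c, t) \<in> D \<and> E (U (c, t)) = c \<and> (fst (U (c, t)) = 0 \<longleftrightarrow> t = 0) \<and> (snd (U (c, t)) = 0 \<longleftrightarrow> t = T c)"
      using U c t by simp
    then show "L (U (c, t)) \<in> A" "En (L (U (c, t))) = c" using AM inv_LM EnL by auto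
    show "fst (L (U (c, t))) = 0 \<longleftrightarrow> t = (if a = 0 then T c else 0)"
      "snd (L (U (c, t))) = 0 \<longleftrightarrow> t = (if a = 0 then 0 else T c)"
      using ab * unfolding L_def by auto
  next
    fix c t assume c: "c \<in> {c1..C}" and t: "t \<in> {0<..<T c}"
    have UD: "U (c, t) \<in> D" using U c t by simp
    have d: "((\<lambda>t. fst (U (c, t))) has_real_derivative f1 (snd (U (c, t)))) (at t)"
      "((\<lambda>t. snd (U (c, t))) has_real_derivative - f2 (fst (U (c, t)))) (at t)"
      using U c t by simp_all
    have f: "a * f1 (snd (U (c, t))) - b * f2 (fst (U (c, t))) = h (snd (L (U (c, t))))"
       "a * f2 (fst (U (c, t))) + b * f1 (snd (U (c, t))) = k (fst (L (U (c, t))))"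
      using field[of "fst (U (c, t))" "snd (U (c, t))"] UD unfolding L_def by auto
    show "((\<lambda>t. fst (L (U (c, t)))) has_real_derivative h (snd (L (U (c, t))))) (at t)"
      "((\<lambda>t. snd (L (U (c, t)))) has_real_derivative - k (fst (L (U (c, t))))) (at t)"
      unfolding f[symmetric] unfolding L_def by (auto intro!: derivative_eq_intros d)
  next
    fix z assume z: "z \<in> A"
    have "En z = E (M z)" "M z \<in> D" using EnL[of "M z"] z AM inv_LM by simp_all
    moreover have "E (M z) \<in> {c1..C} \<and> \<tau> (M z) \<in> {0..T (E (M z))} \<and> U (E (M z), \<tau> (M z)) = M z"
      using U \<open>M z \<in> D\<close> by simp
    ultimately show "En z \<in> {c1..C}" "\<tau> (M z) \<in> {0..T (En z)}" "L (U (En z, \<tau> (M z))) = z"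
      using inv_LM by simp_all
  qed (use U in simp)
  then show ?thesis by blast
qed

text \<open>One side of a potential well, up to the height \<open>C\<close>. The negative side
  enters through the reflection of \<open>u\<close> to \<open>- u\<close>; thus four instances, two
  for \<open>h\<close> and two for the restoring force, serve all four quadrants.\<close>

definition half_potential :: "real \<Rightarrow> (real \<Rightarrow> real) \<Rightarrow> (real \<Rightarrow> real) \<Rightarrow> real \<Rightarrow> bool" where
  "half_potential C f F A \<longleftrightarrow> 0 < A \<and> F 0 = 0 \<and> F A = C \<and> f 0 = 0 \<and> continuous_on {0..A} f \<and>
     (\<forall>u\<in>{0<..A}. 0 < f u) \<and> (\<forall>u\<in>{0..A}. (F has_real_derivative f u) (at u within {0..A}))"

lemma quarter_orbits_half_potential:
  assumes "half_potential C f1 F1 A1" "half_potential C f2 F2 A2" "0 < c1" "c1 \<le> C"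
  shows "quarter_orbits f1 f2 F1 F2 A1 A2 c1 C"
  using assms unfolding half_potential_def by unfold_locales auto

text \<open>Numbers the quadrants in the order of motion, starting with I. Keeping \<open>n\<close>
  rather than its remainder modulo 4 also records the completed turns.\<close>

definition quad :: "nat \<Rightarrow> quadrant" where "quad n = (qnext ^^ n) QI"

lemma quad_simps [simp]: "quad 0 = QI" "quad (Suc n) = qnext (quad n)"
  by (simp_all add: quad_def)

lemma quad_add_mult_4: "quad (n + 4 * j) = quad n"
proof (induction j)
  case (Suc j)
  have "qnext (qnext (qnext (qnext q))) = q" for q by (cases q) auto
  then show ?case using Suc by (simp add: numeral_eq_Suc)
qed simp

text \<open>\<open>k\<close> will be \<mu> times \<open>g\<close>, and \<open>V\<close> will be
  \<mu> times its primitive. The bounds \<open>ym\<close>, \<open>yp\<close>, \<open>xm\<close>,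
  \<open>xp\<close> are the points at which the outer orbit, of energy \<open>C\<close>, meets the
  axes.\<close>

locale annulus_flow =
  fixes h k H V :: "real \<Rightarrow> real" and ym yp xm xp c1 C :: real
  assumes c1: "0 < c1" "c1 \<le> C"
    and h_pos: "half_potential C h H yp"
    and h_neg: "half_potential C (\<lambda>u. - h (- u)) (\<lambda>u. H (- u)) (- ym)"
    and k_pos: "half_potential C k V xp"
    and k_neg: "half_potential C (\<lambda>u. - k (- u)) (\<lambda>u. V (- u)) (- xm)"
begin

definition En :: "real \<times> real \<Rightarrow> real" where "En = (\<lambda>(x, y). H y + V x)"

definition A :: "nat \<Rightarrow> (real \<times> real) set" where
  "A n = {z. fst z \<in> {xm..xp} \<and> snd z \<in> {ym..yp} \<and> En z \<in> {c1..C}} \<inter> closed_quadrant (quad n)"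

lemma bounds: "0 < xp" "xm < 0" "0 < yp" "ym < 0"
  using h_pos h_neg k_pos k_neg by (auto simp: half_potential_def)

lemma quarter_flow_ex_less_4:
  assumes "n < 4" shows "\<exists>T U \<tau>. quarter_flow En (A n) c1 C h k (odd n) T U \<tau>"
proof -
  \<comment> \<open>The model coordinates (p, q) are (x, y), (-y, x), (-x, -y) and (y, -x) in the
    quadrants I, IV, III and II.\<close>
  from assms consider "n = 0" | "n = 1" | "n = 2" | "n = 3" by linarith
  then show ?thesis
  proof cases
    case 1
    interpret quarter_orbits h k H V yp xp c1 C
      by (rule quarter_orbits_half_potential[OF h_pos k_pos c1])
    have "\<exists>T U \<tau>. quarter_flow En (A n) c1 C h k (1 = (0::real)) T U \<tau>"
      by (rule rotated_quarter_flow[of 1 0])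
        (use bounds in \<open>auto simp: 1 A_def annulus_flow.A_def D_def E_def En_def\<close>)
    then show ?thesis using 1 by simp
  next
    case 2
    interpret quarter_orbits k "\<lambda>u. - h (- u)" V "\<lambda>u. H (- u)" xp "- ym" c1 C
      by (rule quarter_orbits_half_potential[OF k_pos h_neg c1])
    have "\<exists>T U \<tau>. quarter_flow En (A n) c1 C h k (0 = (0::real)) T U \<tau>"
      by (rule rotated_quarter_flow[of 0 1])
        (use bounds in \<open>auto simp: 2 A_def D_def E_def En_def add.commute\<close>)
    then show ?thesis using 2 by simp
  next
    case 3
    interpret quarter_orbits "\<lambda>u. - h (- u)" "\<lambda>u. - k (- u)" "\<lambda>u. H (- u)" "\<lambda>u. V (- u)" "- ym" "- xm" c1 C
      by (rule quarter_orbits_half_potential[OF h_neg k_neg c1])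
    have "\<exists>T U \<tau>. quarter_flow En (A n) c1 C h k (- 1 = (0::real)) T U \<tau>"
      by (rule rotated_quarter_flow[of "- 1" 0])
        (use bounds in \<open>auto simp: 3 A_def D_def E_def En_def numeral_2_eq_2\<close>)
    then show ?thesis using 3 by simp
  next
    case 4
    interpret quarter_orbits "\<lambda>u. - k (- u)" h "\<lambda>u. V (- u)" H "- xm" yp c1 C
      by (rule quarter_orbits_half_potential[OF k_neg h_pos c1])
    have "\<exists>T U \<tau>. quarter_flow En (A n) c1 C h k (0 = (0::real)) T U \<tau>"
      by (rule rotated_quarter_flow[of 0 "- 1"])
        (use bounds in \<open>auto simp: 4 A_def D_def E_def En_def numeral_3_eq_3 add.commute\<close>)
    then show ?thesis using 4 by simp
  qed
qed

end

text \<open>The inverse function of \<open>x\<close> is an antiderivative of \<open>1 / v\<close>.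
  Since the integrand is nonnegative, the fundamental theorem holds on the open interval with limits
  at its ends, so \<open>1 / v\<close> may be unbounded there, as happens where an orbit meets the
  \<open>x\<close>-axis.\<close>

lemma time_integral_increasing:
  fixes x w v :: "real \<Rightarrow> real"
  assumes T: "0 < T" and cx: "continuous_on {0..T} x" and cw: "continuous_on {0<..<T} w"
    and x': "\<And>t. t \<in> {0<..<T} \<Longrightarrow> (x has_real_derivative w t) (at t) \<and> 0 < w t \<and> v (x t) = w t"
  shows "(LBINT u=ereal (x 0)..ereal (x T). 1 / v u) = T"
proof -
  have less: "x r < x s" if "r \<in> {0..T}" "s \<in> {0..T}" "r < s" for r s
  proof (rule DERIV_pos_imp_increasing_open[OF that(3)])
    show "continuous_on {r..s} x" by (rule continuous_on_subset[OF cx]) (use that in auto)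
    fix t assume "r < t" "t < s"
    then show "\<exists>y. (x has_real_derivative y) (at t) \<and> 0 < y" using x'[of t] that by auto
  qed
  then have mono: "strict_mono_on {0..T} x" by (auto intro: strict_mono_onI)
  note inj = strict_mono_on_imp_inj_on[OF mono]
  define g where "g = inv_into {0..T} x"
  have gx: "g (x t) = t" if "t \<in> {0..T}" for t unfolding g_def using inv_into_f_f[OF inj that] .
  have im: "x ` {0..T} = {x 0..x T}"
  proof (rule equalityI)
    show "x ` {0..T} \<subseteq> {x 0..x T}" using strict_mono_on_imp_mono_on[OF mono] T by (auto simp: mono_on_def)
    show "{x 0..x T} \<subseteq> x ` {0..T}"
    proof
      fix u assume "u \<in> {x 0..x T}"
      then have "\<exists>t\<ge>0. t \<le> T \<and> x t = u" using T by (intro IVT' cx) auto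
      then show "u \<in> x ` {0..T}" by auto
    qed
  qed
  have xg: "x (g u) = u" "g u \<in> {0..T}" if "u \<in> {x 0..x T}" for u
    using that gx unfolding im[symmetric] by auto
  have cg: "continuous_on {x 0..x T} g"
    using continuous_on_inv[OF cx compact_Icc, of g] gx im by simp
  have g_open: "g u \<in> {0<..<T}" if "x 0 < u" "u < x T" for u
  proof -
    have "g u \<noteq> 0" "g u \<noteq> T" "g u \<in> {0..T}" using xg[of u] that by auto
    then show ?thesis by auto
  qed
  have isg: "isCont g u" if "x 0 < u" "u < x T" for u
    by (rule continuous_on_interior[OF cg]) (use that in auto)
  have g': "(g has_real_derivative 1 / v u) (at u)" if u: "x 0 < u" "u < x T" for u
  proof -
    have "(g has_real_derivative inverse (w (g u))) (at u)"
      using x'[OF g_open[OF u]] u xg isg by (intro DERIV_inverse_function[where f = x and a = "x 0" and b = "x T"]) auto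
    then show ?thesis using x'[OF g_open[OF u]] xg(1)[of u] u by (simp add: inverse_eq_divide)
  qed
  have v: "v u = w (g u)" "0 < w (g u)" if "x 0 < u" "u < x T" for u
    using x'[OF g_open[OF that]] xg(1)[of u] that by auto
  have cont: "isCont (\<lambda>u. 1 / v u) u" if u: "x 0 < u" "u < x T" for u
  proof -
    have "isCont w (g u)" using cw g_open[OF u] by (simp add: continuous_on_eq_continuous_at)
    then have "isCont (\<lambda>u. 1 / w (g u)) u"
      using v(2)[OF u] by (intro continuous_intros isCont_o2[OF isg[OF u]]) auto
    moreover have ev: "eventually (\<lambda>s. 1 / v s = 1 / w (g s)) (nhds u)"
    proof -
      have "eventually (\<lambda>s. s \<in> {x 0<..<x T}) (nhds u)" using u by (intro eventually_nhds_in_open) auto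
      then show ?thesis by eventually_elim (simp add: v)
    qed
    ultimately show ?thesis using isCont_cong[OF ev] by simp
  qed
  have xx: "x 0 < x T" using less[of 0 T] T by simp
  have lim: "(g \<longlongrightarrow> g (x 0)) (at_right (x 0))" "(g \<longlongrightarrow> g (x T)) (at_left (x T))"
    using continuous_on_Icc_at_rightD[OF cg xx] continuous_on_Icc_at_leftD[OF cg xx] .
  have "(LBINT u=ereal (x 0)..ereal (x T). 1 / v u) = g (x T) - g (x 0)"
    using xx g' cont lim v
    by (intro interval_integral_FTC_nonneg) (auto simp: ereal_tendsto_simps less_imp_le)
  then show ?thesis using gx[of 0] gx[of T] T by simp
qed

text \<open>Reversing time reduces this to the increasing case.\<close>

lemma time_integral_decreasing:
  fixes x w v :: "real \<Rightarrow> real"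
  assumes T: "0 < T" and cx: "continuous_on {0..T} x" and cw: "continuous_on {0<..<T} w"
    and x': "\<And>t. t \<in> {0<..<T} \<Longrightarrow> (x has_real_derivative - w t) (at t) \<and> 0 < w t \<and> v (x t) = w t"
  shows "(LBINT u=ereal (x T)..ereal (x 0). 1 / v u) = T"
proof -
  have "continuous_on {0..T} (\<lambda>t. x (T - t))" "continuous_on {0<..<T} (\<lambda>t. w (T - t))"
    by (auto intro!: continuous_on_compose2[OF cx] continuous_on_compose2[OF cw] continuous_intros)
  moreover have "((\<lambda>t. x (T - t)) has_real_derivative w (T - t)) (at t)" if "t \<in> {0<..<T}" for t
  proof -
    have "(x has_real_derivative - w (T - t)) (at (T - t))" using x'[of "T - t"] that by auto
    then have "((\<lambda>t. x (T - t)) has_real_derivative - w (T - t) * (- 1)) (at t)"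
      by (rule DERIV_chain2) (auto intro!: derivative_eq_intros)
    then show ?thesis by simp
  qed
  ultimately show ?thesis
    using time_integral_increasing[of T "\<lambda>t. x (T - t)" "\<lambda>t. w (T - t)" v] T x' by simp
qed

lemma exactly_zeros_shift:
  assumes "exactly_zeros n f B" "\<And>t. t \<in> B' \<longleftrightarrow> t + c \<in> B"
  shows "exactly_zeros n (\<lambda>t. f (t + c)) B'"
proof -
  have eq: "{t \<in> B'. f (t + c) = 0} = (\<lambda>t. t - c) ` {t \<in> B. f t = 0}"
  proof (rule equalityI; rule subsetI)
    fix t assume "t \<in> {t \<in> B'. f (t + c) = 0}"
    then show "t \<in> (\<lambda>t. t - c) ` {t \<in> B. f t = 0}" using assms(2) by (intro image_eqI[of _ _ "t + c"]) auto
  next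
    fix t assume "t \<in> (\<lambda>t. t - c) ` {t \<in> B. f t = 0}"
    then show "t \<in> {t \<in> B'. f (t + c) = 0}" using assms(2)[of t] by auto
  qed
  have "inj_on (\<lambda>t. t - c) S" for S by (auto simp: inj_on_def)
  then show ?thesis using assms(1) unfolding exactly_zeros_def eq by (simp add: card_image)
qed

lemma half_potential_strict_mono:
  assumes "half_potential C f F A" shows "strict_mono_on {0..A} F"
  using positive_derivative_strict_mono_on[of A F f] assms unfolding half_potential_def by blast

text \<open>The sign selects one of the two strictly monotone branches of the well. In a fixed
  quadrant a point is therefore determined by the two parts of its energy; this glues consecutive
  quarters and later identifies the meeting point of two paths.\<close>

lemma half_potential_inj:
  assumes F: "half_potential C f F A" "half_potential C f' (\<lambda>u. F (- u)) (- B)"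
    and eq: "F u = F v" and uv: "u \<in> {B..A}" "v \<in> {B..A}" "0 \<le> u \<and> 0 \<le> v \<or> u \<le> 0 \<and> v \<le> 0"
  shows "u = v"
  using uv(3)
proof
  assume "0 \<le> u \<and> 0 \<le> v"
  then show ?thesis
    using strict_mono_on_eqD[OF half_potential_strict_mono[OF F(1)], of u v] eq uv by auto
next
  assume "u \<le> 0 \<and> v \<le> 0"
  then show ?thesis
    using strict_mono_on_eqD[OF half_potential_strict_mono[OF F(2)], of "- u" "- v"] eq uv by auto
qed

lemma quad_cases: "even n \<Longrightarrow> quad n = QI \<or> quad n = QIII" "odd n \<Longrightarrow> quad n = QIV \<or> quad n = QII"
  by (induction n) auto

context annulus_flow
begin

lemma quarter_flow_ex:
  obtains T U \<tau> where "\<And>n. quarter_flow En (A n) c1 C h k (odd n) (T n) (U n) (\<tau> n)"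
proof -
  define Q where "Q n F \<longleftrightarrow> quarter_flow En (A n) c1 C h k (odd n) (fst F) (fst (snd F)) (snd (snd F))" for n F
  have "\<exists>F. Q n F" if "n < 4" for n
    using quarter_flow_ex_less_4[OF that] unfolding Q_def by auto
  then obtain F where F: "\<And>n. n < 4 \<Longrightarrow> Q n (F n)" by metis
  have quad_mod: "quad (n mod 4) = quad n" for n
    using quad_add_mult_4[of "n mod 4" "n div 4"] by simp
  have odd_mod: "odd (n mod 4) = odd n" for n :: nat by presburger
  have "A (n mod 4) = A n" for n unfolding A_def quad_mod ..
  then have "quarter_flow En (A n) c1 C h k (odd n) (fst (F (n mod 4))) (fst (snd (F (n mod 4)))) (snd (snd (F (n mod 4))))" for n
    using F[of "n mod 4"] unfolding Q_def odd_mod by simp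
  then show ?thesis by (rule that)
qed

lemmas V_inj = half_potential_inj[OF k_pos k_neg]
lemmas H_inj = half_potential_inj[OF h_pos h_neg]

end

section \<open>Whole orbits and the counting of quarter turns\<close>

locale annulus_clock = annulus_flow +
  fixes T :: "nat \<Rightarrow> real \<Rightarrow> real" and U :: "nat \<Rightarrow> real \<times> real \<Rightarrow> real \<times> real" and \<tau> :: "nat \<Rightarrow> real \<times> real \<Rightarrow> real"
    and J :: "real set"
  assumes flow: "quarter_flow En (A n) c1 C h k (odd n) (T n) (U n) (\<tau> n)"
    and J: "{ym..yp} \<subseteq> J"
begin

text \<open>The time at which the orbit of energy \<open>c\<close> that leaves the positive
  \<open>y\<close>-axis at time zero enters quarter \<open>n\<close>, the first quarter having
  number zero.\<close>

definition clock :: "nat \<Rightarrow> real \<Rightarrow> real" where "clock n c = (\<Sum>l<n. T l c)"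

lemma clock_Suc: "clock (Suc n) c = clock n c + T n c" and clock_0: "clock 0 c = 0"
  by (simp_all add: clock_def)

lemma T_cont: "continuous_on {c1..C} (T n)" and T_pos: "c \<in> {c1..C} \<Longrightarrow> 0 < T n c"
  and U_cont: "continuous_on {(c, t). c \<in> {c1..C} \<and> t \<in> {0..T n c}} (U n)"
  and En_cont: "continuous_on (A n) En" and \<tau>_cont: "continuous_on (A n) (\<tau> n)"
  using flow[of n] by (simp_all add: quarter_flow_def)

lemma U_props: "\<forall>c\<in>{c1..C}. \<forall>t\<in>{0..T n c}. U n (c, t) \<in> A n \<and> En (U n (c, t)) = c \<and>
      (fst (U n (c, t)) = 0 \<longleftrightarrow> t = (if odd n then T n c else 0)) \<and>
      (snd (U n (c, t)) = 0 \<longleftrightarrow> t = (if odd n then 0 else T n c))"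
  using flow[of n] unfolding quarter_flow_def by (elim conjE) assumption

lemma U_derivs: "\<forall>c\<in>{c1..C}. \<forall>t\<in>{0<..<T n c}.
    ((\<lambda>t. fst (U n (c, t))) has_real_derivative h (snd (U n (c, t)))) (at t) \<and>
    ((\<lambda>t. snd (U n (c, t))) has_real_derivative - k (fst (U n (c, t)))) (at t)"
  using flow[of n] unfolding quarter_flow_def by (elim conjE) assumption

lemma \<tau>_props: "\<forall>z\<in>A n. En z \<in> {c1..C} \<and> \<tau> n z \<in> {0..T n (En z)} \<and> U n (En z, \<tau> n z) = z"
  using flow[of n] unfolding quarter_flow_def by (elim conjE) assumption

lemmas U_deriv = U_derivs[rule_format]
lemmas \<tau> = \<tau>_props[rule_format]

lemma U_A: "c \<in> {c1..C} \<Longrightarrow> t \<in> {0..T n c} \<Longrightarrow> U n (c, t) \<in> A n"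
  and U_En: "c \<in> {c1..C} \<Longrightarrow> t \<in> {0..T n c} \<Longrightarrow> En (U n (c, t)) = c"
  and U_fst_0: "c \<in> {c1..C} \<Longrightarrow> t \<in> {0..T n c} \<Longrightarrow> fst (U n (c, t)) = 0 \<longleftrightarrow> t = (if odd n then T n c else 0)"
  and U_snd_0: "c \<in> {c1..C} \<Longrightarrow> t \<in> {0..T n c} \<Longrightarrow> snd (U n (c, t)) = 0 \<longleftrightarrow> t = (if odd n then 0 else T n c)"
  using U_props[of n] by simp_all

lemma clock_cont: "continuous_on {c1..C} (clock n)"
  unfolding clock_def by (intro continuous_intros T_cont)

lemma clock_less: "c \<in> {c1..C} \<Longrightarrow> i < j \<Longrightarrow> clock i c < clock j c"
  by (rule lift_Suc_mono_less[of "\<lambda>n. clock n c"]) (simp_all add: clock_Suc T_pos)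

lemma clock_le: "c \<in> {c1..C} \<Longrightarrow> i \<le> j \<Longrightarrow> clock i c \<le> clock j c"
  using clock_less[of c i j] by (cases "i = j") auto

lemma clock_less_iff: "c \<in> {c1..C} \<Longrightarrow> clock i c < clock j c \<longleftrightarrow> i < j"
  using clock_less[of c i j] clock_le[of c j i] by (cases "i < j") auto

text \<open>Both points have energy \<open>c\<close> and lie on the half-axis shared by the two
  quadrants, where the energy is injective.\<close>

lemma U_junction: assumes c: "c \<in> {c1..C}" shows "U n (c, T n c) = U (Suc n) (c, 0)"
proof -
  let ?z = "U n (c, T n c)" and ?w = "U (Suc n) (c, 0)"
  have T: "0 \<le> T n c" "0 \<le> T (Suc n) c" using T_pos[OF c] by (auto simp: less_imp_le)
  then have A: "?z \<in> A n" "?w \<in> A (Suc n)" and E: "En ?z = c" "En ?w = c"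
    using U_A[OF c] U_En[OF c] by auto
  have box: "fst ?z \<in> {xm..xp}" "snd ?z \<in> {ym..yp}" "fst ?w \<in> {xm..xp}" "snd ?w \<in> {ym..yp}"
    "?z \<in> closed_quadrant (quad n)" "?w \<in> closed_quadrant (qnext (quad n))"
    using A unfolding A_def by auto
  have En: "H (snd ?z) + V (fst ?z) = H (snd ?w) + V (fst ?w)" using E by (simp add: En_def case_prod_unfold)
  show ?thesis
  proof (cases "even n")
    case True
    have 0: "snd ?z = 0" "snd ?w = 0" using U_snd_0[OF c, of _ n] U_snd_0[OF c, of _ "Suc n"] T True by auto
    have "fst ?z = fst ?w"
      by (rule V_inj) (use box En 0 quad_cases(1)[OF True] in \<open>auto simp: case_prod_unfold\<close>)
    then show ?thesis using 0 by (simp add: prod_eq_iff)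
  next
    case False
    have 0: "fst ?z = 0" "fst ?w = 0" using U_fst_0[OF c, of _ n] U_fst_0[OF c, of _ "Suc n"] T False by auto
    have "snd ?z = snd ?w"
      by (rule H_inj) (use box En 0 quad_cases(2)[OF False] in \<open>auto simp: case_prod_unfold\<close>)
    then show ?thesis using 0 by (simp add: prod_eq_iff)
  qed
qed

text \<open>Quarters are joined end to end; the derivatives are left open at the clock times, which
  are finitely many.\<close>

lemma orbit_sol:
  assumes c: "c \<in> {c1..C}"
  shows "\<exists>x y. piecewise_sol J h k (\<lambda>_. 1) 0 (clock N c) x y \<and> (x (clock N c), y (clock N c)) = U N (c, 0) \<and>
    (\<forall>n<N. \<forall>t\<in>{clock n c..clock (Suc n) c}. (x t, y t) = U n (c, t - clock n c))"
proof (induction N)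
  case 0
  have "U 0 (c, 0) \<in> A 0" using U_A[OF c] T_pos[OF c, of 0] by auto
  then have "snd (U 0 (c, 0)) \<in> J" using J by (auto simp: A_def)
  then have "piecewise_sol J h k (\<lambda>_. 1) 0 (clock 0 c) (\<lambda>_. fst (U 0 (c, 0))) (\<lambda>_. snd (U 0 (c, 0)))"
    unfolding piecewise_sol_def by (auto intro!: exI[of _ "{}"] simp: clock_0)
  then show ?case
    by (intro exI[of _ "\<lambda>_. fst (U 0 (c, 0))"] exI[of _ "\<lambda>_. snd (U 0 (c, 0))"]) auto
next
  case (Suc N)
  then obtain x y where xy: "piecewise_sol J h k (\<lambda>_. 1) 0 (clock N c) x y"
    "(x (clock N c), y (clock N c)) = U N (c, 0)"
    "\<And>n t. n < N \<Longrightarrow> t \<in> {clock n c..clock (Suc n) c} \<Longrightarrow> (x t, y t) = U n (c, t - clock n c)" by blast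
  let ?b = "clock N c"
  let ?u = "\<lambda>t. fst (U N (c, t - ?b))" and ?v = "\<lambda>t. snd (U N (c, t - ?b))"
  have cont: "continuous_on {?b..clock (Suc N) c} (\<lambda>t. U N (c, t - ?b))"
    using c by (intro continuous_on_compose2[OF U_cont] continuous_intros) (auto simp: clock_Suc)
  have "piecewise_sol J h k (\<lambda>_. 1) ?b (clock (Suc N) c) ?u ?v"
    unfolding piecewise_sol_def
  proof (intro conjI exI[of _ "{}"] ballI)
    show "?v ` {?b..clock (Suc N) c} \<subseteq> J"
      using U_A[OF c, of _ N] J by (auto simp: clock_Suc A_def)
    fix t assume "t \<in> {?b<..<clock (Suc N) c} - {}"
    then have "t - ?b \<in> {0<..<T N c}" by (auto simp: clock_Suc)
    from U_deriv[OF c this] show "(?u has_real_derivative h (?v t)) (at t)" "(?v has_real_derivative - (1 * k (?u t))) (at t)"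
      using DERIV_shift[of "\<lambda>s. fst (U N (c, s))" _ t "- ?b"] DERIV_shift[of "\<lambda>s. snd (U N (c, s))" _ t "- ?b"] by auto
  qed (use cont in \<open>auto intro!: continuous_intros\<close>)
  note sol = piecewise_sol_join[OF xy(1) this]
  let ?x = "\<lambda>t. if t \<le> ?b then x t else ?u t" and ?y = "\<lambda>t. if t \<le> ?b then y t else ?v t"
  have le: "0 \<le> ?b" "?b < clock (Suc N) c" using clock_le[OF c, of 0 N] clock_less[OF c, of N "Suc N"] by (auto simp: clock_0)
  have "piecewise_sol J h k (\<lambda>_. 1) 0 (clock (Suc N) c) ?x ?y"
    using sol xy(2) le by (auto simp: prod_eq_iff)
  moreover have "(?x t, ?y t) = U n (c, t - clock n c)" if "n < Suc N" "t \<in> {clock n c..clock (Suc n) c}" for n t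
  proof (cases "n = N")
    case True
    then show ?thesis using that xy(2) by (cases "t = ?b") (auto simp: prod_eq_iff)
  next
    case False
    then have "t \<le> ?b" using that clock_le[OF c, of "Suc n" N] by auto
    then show ?thesis using that False xy(3)[of n t] by auto
  qed
  moreover have "(?x (clock (Suc N) c), ?y (clock (Suc N) c)) = U (Suc N) (c, 0)"
    using le U_junction[OF c, of N] by (auto simp: clock_Suc)
  ultimately show ?case by blast
qed

lemma clock_interval:
  assumes "c \<in> {c1..C}" "s \<in> {0..clock (Suc N) c}"
  obtains n where "n \<le> N" "s \<in> {clock n c..clock (Suc n) c}"
  using assms(2)
proof (induction N arbitrary: thesis)
  case 0 then show ?case using 0(1)[of 0] by (auto simp: clock_0)
next
  case (Suc N)
  show ?case
  proof (cases "s \<le> clock (Suc N) c")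
    case True then show ?thesis using Suc by (metis atLeastAtMost_iff le_SucI)
  next
    case False then show ?thesis using Suc(2)[of "Suc N"] Suc(3) by auto
  qed
qed

text \<open>\<open>x\<close> vanishes exactly at the even clock times and \<open>y\<close> at the
  odd ones. A start at \<open>clock k0 c\<close> or an end at \<open>clock (Suc n) c\<close> lies on
  the \<open>y\<close>-axis and must not count as a zero of \<open>x\<close>, hence the open
  interval; a start at \<open>clock (Suc k0) c\<close> or an end at \<open>clock n c\<close> lies on
  the \<open>x\<close>-axis and has to count for \<open>y\<close>, hence the closed one.\<close>

lemma orbit_zeros:
  assumes c: "c \<in> {c1..C}"
    and xy: "\<And>l t. l \<le> n \<Longrightarrow> t \<in> {clock l c..clock (Suc l) c} \<Longrightarrow> (x t, y t) = U l (c, t - clock l c)"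
    and parity: "even k0" "odd n" "k0 < n"
    and a: "a \<in> {clock k0 c..clock (Suc k0) c}" and b: "b \<in> {clock n c..clock (Suc n) c}"
  shows "exactly_zeros ((n - 1 - k0) div 2) x {a<..<b}" "exactly_zeros ((n + 1 - k0) div 2) y {a..b}"
proof -
  obtain i0 where i0: "k0 = 2 * i0" using parity(1) by (elim evenE)
  obtain j0 where j0: "n = 2 * j0 + 1" using parity(2) by (elim oddE)
  have ij: "i0 \<le> j0" using parity(3) i0 j0 by simp
  have zeros: "(x t = 0 \<longleftrightarrow> t = (if odd l then clock (Suc l) c else clock l c)) \<and>
      (y t = 0 \<longleftrightarrow> t = (if odd l then clock l c else clock (Suc l) c))"
    if "l \<le> n" "t \<in> {clock l c..clock (Suc l) c}" for l t
    using xy[OF that] U_fst_0[OF c, of "t - clock l c" l] U_snd_0[OF c, of "t - clock l c" l] that(2)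
    by (auto simp: clock_Suc prod_eq_iff)
  have range: "\<exists>l\<le>n. t \<in> {clock l c..clock (Suc l) c}" if "t \<in> {a..b}" for t
  proof -
    have "t \<in> {0..clock (Suc n) c}" using that a b clock_le[OF c, of 0 k0] by (auto simp: clock_0)
    then show ?thesis using clock_interval[OF c] by blast
  qed
  have inj: "inj_on (\<lambda>i. clock (f i) c) S" if "inj f" for S and f :: "nat \<Rightarrow> nat"
    using clock_less_iff[OF c] that by (auto simp: inj_on_def) (metis linorder_neqE_nat less_irrefl)
  have x_zeros: "{t \<in> {a<..<b}. x t = 0} = (\<lambda>i. clock (2 * i) c) ` {i0 + 1..j0}"
  proof (rule equalityI; rule subsetI)
    fix t assume t: "t \<in> {t \<in> {a<..<b}. x t = 0}"
    then obtain l where l: "l \<le> n" "t \<in> {clock l c..clock (Suc l) c}" using range[of t] by auto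
    \<comment> \<open>\<open>x\<close> vanishes at the end of an odd quarter and at the start of an
      even one; in both cases that instant is an even clock time.\<close>
    define l' where "l' = (if odd l then Suc l else l)"
    have l': "even l'" "t = clock l' c"
      using zeros[OF l, THEN conjunct1] t unfolding l'_def by (simp_all split: if_splits)
    then obtain i where i: "l' = 2 * i" by (elim evenE)
    have "clock k0 c < t" "t < clock (Suc n) c" using t a b by auto
    then have "k0 < l'" "l' < Suc n" using clock_less_iff[OF c] l' by auto
    then show "t \<in> (\<lambda>i. clock (2 * i) c) ` {i0 + 1..j0}" using l' i i0 j0 by auto
  next
    fix t assume "t \<in> (\<lambda>i. clock (2 * i) c) ` {i0 + 1..j0}"
    then obtain i where i: "i0 + 1 \<le> i" "i \<le> j0" "t = clock (2 * i) c" by auto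
    have "clock (Suc k0) c < t" "t < clock n c" using i i0 j0 clock_less_iff[OF c] by auto
    moreover have "x t = 0" using zeros[of "2 * i" t] i j0 clock_less[OF c, of "2 * i" "Suc (2 * i)"] by auto
    ultimately show "t \<in> {t \<in> {a<..<b}. x t = 0}" using a b by auto
  qed
  have y_zeros: "{t \<in> {a..b}. y t = 0} = (\<lambda>i. clock (2 * i + 1) c) ` {i0..j0}"
  proof (rule equalityI; rule subsetI)
    fix t assume t: "t \<in> {t \<in> {a..b}. y t = 0}"
    then obtain l where l: "l \<le> n" "t \<in> {clock l c..clock (Suc l) c}" using range[of t] by auto
    define l' where "l' = (if odd l then l else Suc l)"
    have l': "odd l'" "t = clock l' c"
      using zeros[OF l, THEN conjunct2] t unfolding l'_def by (simp_all split: if_splits)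
    then obtain i where i: "l' = 2 * i + 1" by (elim oddE)
    have "clock k0 c \<le> t" "t \<le> clock (Suc n) c" using t a b by auto
    then have "k0 \<le> l'" "l' \<le> Suc n" using clock_less_iff[OF c] l' by (metis not_le)+
    then show "t \<in> (\<lambda>i. clock (2 * i + 1) c) ` {i0..j0}" using l' i i0 j0 by auto
  next
    fix t assume "t \<in> (\<lambda>i. clock (2 * i + 1) c) ` {i0..j0}"
    then obtain i where i: "i0 \<le> i" "i \<le> j0" "t = clock (2 * i + 1) c" by auto
    have "clock (Suc k0) c \<le> t" "t \<le> clock n c" using i i0 j0 clock_le[OF c] by auto
    moreover have "y t = 0" using zeros[of "2 * i + 1" t] i j0 clock_less[OF c, of "2 * i + 1" "Suc (2 * i + 1)"] by auto
    ultimately show "t \<in> {t \<in> {a..b}. y t = 0}" using a b by auto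
  qed
  have "card {i0 + 1..j0} = (n - 1 - k0) div 2" "card {i0..j0} = (n + 1 - k0) div 2" using i0 j0 ij by auto
  moreover have "inj (\<lambda>i::nat. 2 * i)" "inj (\<lambda>i::nat. 2 * i + 1)" by (auto simp: inj_def)
  ultimately show "exactly_zeros ((n - 1 - k0) div 2) x {a<..<b}" "exactly_zeros ((n + 1 - k0) div 2) y {a..b}"
    unfolding exactly_zeros_def x_zeros y_zeros using inj by (auto simp: card_image)
qed

text \<open>By \<open>slow\<close>, the start of \<open>p\<close> falls short of quarter
  \<open>n\<close> even if it lies at the end of quarter \<open>k0\<close>; by \<open>fast\<close>,
  the end of \<open>p\<close> gets past quarter \<open>n\<close> even if it lies at the beginning of
  quarter \<open>k0\<close>. By continuity a subpath sweeps the whole of quarter \<open>n\<close>,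
  which for odd \<open>n\<close> is entered from the \<open>x\<close>-axis and left through the
  \<open>y\<close>-axis.\<close>

lemma stretch:
  assumes p: "path p" "path_image p \<subseteq> A k0" and parity: "even k0" "odd n" "k0 < n"
    and slow: "tb - ta < clock n (En (pathstart p)) - clock (Suc k0) (En (pathstart p))"
    and fast: "clock (Suc n) (En (pathfinish p)) - clock k0 (En (pathfinish p)) < tb - ta"
  obtains q where "path q" "path_image q \<subseteq> A n" "snd (pathstart q) = 0" "fst (pathfinish q) = 0"
    "\<And>z'. z' \<in> path_image q \<Longrightarrow> \<exists>z\<in>path_image p. \<exists>x y. piecewise_sol J h k (\<lambda>_. 1) ta tb x y \<and>
       (x ta, y ta) = z \<and> (x tb, y tb) = z' \<and>
       exactly_zeros ((n - 1 - k0) div 2) x {ta<..<tb} \<and> exactly_zeros ((n + 1 - k0) div 2) y {ta..tb}"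
proof -
  \<comment> \<open>\<open>a z\<close> is the clock time of \<open>z\<close> on its orbit and
    \<open>b z\<close> that of its image after the stage. \<open>u z\<close> lies in
    \<open>{0..1}\<close> exactly when the image falls into quarter \<open>n\<close>, and then
    \<open>\<Phi> z\<close> is this image.\<close>
  define a where "a = (\<lambda>z. clock k0 (En z) + \<tau> k0 z)"
  define b where "b = (\<lambda>z. a z + (tb - ta))"
  define u where "u = (\<lambda>z. (b z - clock n (En z)) / T n (En z))"
  define \<Phi> where "\<Phi> = (\<lambda>z. U n (En z, b z - clock n (En z)))"
  let ?P = "path_image p"
  have E: "En z \<in> {c1..C}" "\<tau> k0 z \<in> {0..T k0 (En z)}" "U k0 (En z, \<tau> k0 z) = z" if "z \<in> ?P" for z
    using \<tau>[of z k0] that p(2) by auto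
  have a: "a z \<in> {clock k0 (En z)..clock (Suc k0) (En z)}" if "z \<in> ?P" for z
    using E[OF that] unfolding a_def by (auto simp: clock_Suc)
  have cE: "continuous_on ?P En" "continuous_on ?P (\<tau> k0)"
    using p(2) continuous_on_subset[OF En_cont] continuous_on_subset[OF \<tau>_cont] by blast+
  have cT: "continuous_on ?P (\<lambda>z. clock l (En z))" "continuous_on ?P (\<lambda>z. T l (En z))" for l
    using E by (auto intro!: continuous_on_compose2[OF clock_cont cE(1)] continuous_on_compose2[OF T_cont cE(1)])
  have cb: "continuous_on ?P b" unfolding b_def a_def by (intro continuous_intros cT cE)
  have "T n (En z) \<noteq> 0" if "z \<in> ?P" for z using T_pos[OF E(1)[OF that], of n] by simp
  then have cu: "continuous_on ?P u" unfolding u_def by (intro continuous_intros cT cb) simp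
  have ends: "pathstart p \<in> ?P" "pathfinish p \<in> ?P" by auto
  have "u (pathstart p) \<le> 0"
    using a[OF ends(1)] slow T_pos[OF E(1)[OF ends(1)], of n] unfolding u_def b_def
    by (auto intro!: divide_nonpos_pos)
  moreover have "1 \<le> u (pathfinish p)"
    using a[OF ends(2)] fast T_pos[OF E(1)[OF ends(2)], of n] unfolding u_def b_def
    by (auto simp: clock_Suc)
  ultimately obtain q where q: "path q" "path_image q \<subseteq> ?P" "u (pathstart q) = 0" "u (pathfinish q) = 1"
    "\<And>z. z \<in> path_image q \<Longrightarrow> 0 \<le> u z \<and> u z \<le> 1"
    using path_crossing[OF p(1) cu, of 0 1] by auto
  have phase: "b z - clock n (En z) \<in> {0..T n (En z)}" if "z \<in> path_image q" for z
    using q(5)[OF that] T_pos[OF E(1), of z n] that q(2) unfolding u_def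
    by (auto simp: zero_le_divide_iff divide_le_eq)
  have "continuous_on (path_image q) \<Phi>" unfolding \<Phi>_def
    using phase E(1) q(2)
    by (intro continuous_on_compose2[OF U_cont] continuous_intros continuous_on_subset[OF cE(1)]
        continuous_on_subset[OF cb] continuous_on_subset[OF cT(1)]) auto
  note path = path_continuous_image[OF q(1) this]
  have qends: "pathstart q \<in> path_image q" "pathfinish q \<in> path_image q" by auto
  show ?thesis
  proof (rule that[of "\<Phi> \<circ> q"])
    show "path (\<Phi> \<circ> q)" by (rule path)
    show "path_image (\<Phi> \<circ> q) \<subseteq> A n"
      unfolding path_image_compose \<Phi>_def using U_A[OF E(1) phase] q(2) by auto
    have "b (pathstart q) - clock n (En (pathstart q)) = 0"
      using q(3) T_pos[OF E(1), of "pathstart q" n] qends q(2) unfolding u_def by auto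
    then show "snd (pathstart (\<Phi> \<circ> q)) = 0"
      unfolding pathstart_compose \<Phi>_def using U_snd_0[OF E(1) phase, of "pathstart q"] qends q(2) parity by auto
    have "b (pathfinish q) - clock n (En (pathfinish q)) = T n (En (pathfinish q))"
      using q(4) T_pos[OF E(1), of "pathfinish q" n] qends q(2) unfolding u_def by (auto simp: divide_eq_eq)
    then show "fst (pathfinish (\<Phi> \<circ> q)) = 0"
      unfolding pathfinish_compose \<Phi>_def using U_fst_0[OF E(1) phase, of "pathfinish q"] qends q(2) parity by auto
    fix z' assume "z' \<in> path_image (\<Phi> \<circ> q)"
    then obtain z where zq: "z \<in> path_image q" and z': "z' = \<Phi> z" by (auto simp: path_image_compose)
    have z: "z \<in> ?P" using zq q(2) by auto
    let ?c = "En z"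
    have c: "?c \<in> {c1..C}" using E(1)[OF z] .
    have b: "b z \<in> {clock n ?c..clock (Suc n) ?c}" using phase[OF zq] by (auto simp: clock_Suc)
    obtain x y where xy: "piecewise_sol J h k (\<lambda>_. 1) 0 (clock (Suc n) ?c) x y"
      "\<And>l t. l \<le> n \<Longrightarrow> t \<in> {clock l ?c..clock (Suc l) ?c} \<Longrightarrow> (x t, y t) = U l (?c, t - clock l ?c)"
      using orbit_sol[OF c, of "Suc n"] by (auto simp: less_Suc_eq_le)
    \<comment> \<open>The orbit runs on its own clock; the shift moves the clock time
      \<open>a z\<close> to \<open>ta\<close>.\<close>
    let ?s = "a z - ta"
    have "0 \<le> a z" using a[OF z] clock_le[OF c, of 0 k0] by (auto simp: clock_0)
    then have "piecewise_sol J h k (\<lambda>_. 1) (a z) (b z) x y"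
      using b by (intro piecewise_sol_subinterval[OF xy(1)]) auto
    from piecewise_sol_shift[OF this, of ?s]
    have sol: "piecewise_sol J h k (\<lambda>_. 1) ta tb (\<lambda>t. x (t + ?s)) (\<lambda>t. y (t + ?s))"
      by (simp add: b_def)
    define X Y where "X = (\<lambda>t. x (t + ?s))" and "Y = (\<lambda>t. y (t + ?s))"
    have ab: "ta + ?s = a z" "tb + ?s = b z" by (simp_all add: b_def)
    have "(X ta, Y ta) = z"
      unfolding X_def Y_def ab using xy(2)[OF _ a[OF z]] parity E(3)[OF z] by (simp add: a_def)
    moreover have "(X tb, Y tb) = z'"
      unfolding X_def Y_def ab using xy(2)[OF _ b] z' by (simp add: \<Phi>_def)
    moreover have "exactly_zeros ((n - 1 - k0) div 2) X {ta<..<tb}" unfolding X_def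
      by (rule exactly_zeros_shift[OF orbit_zeros(1)[OF c xy(2) parity a[OF z] b]]) (auto simp: b_def)
    moreover have "exactly_zeros ((n + 1 - k0) div 2) Y {ta..tb}" unfolding Y_def
      by (rule exactly_zeros_shift[OF orbit_zeros(2)[OF c xy(2) parity a[OF z] b]]) (auto simp: b_def)
    ultimately show "\<exists>z\<in>?P. \<exists>x y. piecewise_sol J h k (\<lambda>_. 1) ta tb x y \<and>
       (x ta, y ta) = z \<and> (x tb, y tb) = z' \<and>
       exactly_zeros ((n - 1 - k0) div 2) x {ta<..<tb} \<and> exactly_zeros ((n + 1 - k0) div 2) y {ta..tb}"
      using z sol unfolding X_def[symmetric] Y_def[symmetric] by blast
  qed
qed

end

subsection \<open>Planar crossings\<close>

text \<open>The path is cut three times. It is followed up to height \<open>yb\<close>, which it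
  attains because its end on the \<open>y\<close>-axis satisfies
  \<open>H \<ge> c1 \<ge> H yb\<close>; there \<open>far\<close> puts the sheared point beyond the
  level \<open>c2'\<close>. It is then started at the last point that is sheared onto the
  \<open>y\<close>-axis; the height there is at most \<open>yb\<close>, so the new energy is at most
  \<open>c1'\<close>. Finally it is cut to the part between the energies \<open>c1'\<close> and
  \<open>c2'\<close>.\<close>

lemma linear_stretch:
  fixes h H V0 V1 :: "real \<Rightarrow> real"
  assumes q: "path q" "\<And>z. z \<in> path_image q \<Longrightarrow> fst z \<le> 0 \<and> snd z \<in> {0..Y} \<and> H (snd z) + V0 (fst z) \<in> {c1..c2}"
    and start: "snd (pathstart q) = 0" and finish: "fst (pathfinish q) = 0"
    and H: "continuous_on {0..Y} H" "strict_mono_on {0..Y} H" and h: "continuous_on {0..Y} h" "h 0 = 0"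
    and V: "V0 0 = 0" "V1 0 = 0" "continuous_on UNIV V1"
    and yb: "0 < yb" "yb \<le> Y" "H yb \<le> c1" "H yb \<le> c1'" and c': "c1' < c2'"
    and far: "\<And>x. x \<le> 0 \<Longrightarrow> H yb + V0 x \<le> c2 \<Longrightarrow> 0 \<le> x + h yb * \<sigma> \<and> c2' \<le> H yb + V1 (x + h yb * \<sigma>)"
  obtains r where "path r" "\<And>z'. z' \<in> path_image r \<Longrightarrow>
      0 \<le> fst z' \<and> snd z' \<in> {0..Y} \<and> H (snd z') + V1 (fst z') \<in> {c1'..c2'} \<and>
      (\<exists>z\<in>path_image q. z' = (fst z + h (snd z) * \<sigma>, snd z))"
    "H (snd (pathstart r)) + V1 (fst (pathstart r)) = c1'"
    "H (snd (pathfinish r)) + V1 (fst (pathfinish r)) = c2'"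
proof -
  define \<phi> where "\<phi> = (\<lambda>z. fst z + h (snd z) * \<sigma>)"
  define E where "E = (\<lambda>z. H (snd z) + V1 (\<phi> z))"
  have sub: "continuous_on S f \<Longrightarrow> path_image q' \<subseteq> S \<Longrightarrow> continuous_on (path_image q') f"
    for S q' and f :: "real \<times> real \<Rightarrow> real" by (rule continuous_on_subset)
  have c\<phi>: "continuous_on (path_image q) \<phi>" unfolding \<phi>_def
    using q(2) by (intro continuous_intros continuous_on_compose2[OF h(1)]) auto
  have cE: "continuous_on (path_image q) E" unfolding E_def
    using q(2) by (intro continuous_intros continuous_on_compose2[OF H(1)] continuous_on_compose2[OF V(3) c\<phi>]) auto
  have H_le: "H y \<le> H yb" if "y \<in> {0..yb}" for y
    using strict_mono_on_imp_mono_on[OF H(2)] that yb unfolding mono_on_def by auto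
  have "pathfinish q \<in> path_image q" by auto
  from q(2)[OF this] have "snd (pathfinish q) \<in> {0..Y}" "c1 \<le> H (snd (pathfinish q))"
    using finish V(1) by auto
  then have "yb \<le> snd (pathfinish q)"
    using strict_mono_onD[OF H(2), of "snd (pathfinish q)" yb] yb by force
  then obtain q1 where q1: "path q1" "path_image q1 \<subseteq> path_image q" "snd (pathstart q1) = 0" "snd (pathfinish q1) = yb"
     "\<And>z. z \<in> path_image q1 \<Longrightarrow> 0 \<le> snd z \<and> snd z \<le> yb"
    using path_crossing[OF q(1) continuous_on_snd[OF continuous_on_id], of 0 yb] start yb(1) by auto
  have ends1: "pathstart q1 \<in> path_image q" "pathfinish q1 \<in> path_image q" using q1(2) by auto
  \<comment> \<open>The start lies on the \<open>x\<close>-axis, which the shear fixes since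
    \<open>h 0 = 0\<close>, so it remains in the left half-plane.\<close>
  have "\<phi> (pathstart q1) \<le> 0" using q(2)[OF ends1(1)] q1(3) h(2) unfolding \<phi>_def by auto
  moreover have far': "0 \<le> \<phi> (pathfinish q1)" "c2' \<le> E (pathfinish q1)"
    using q(2)[OF ends1(2)] q1(4) far[of "fst (pathfinish q1)"] unfolding E_def \<phi>_def by auto
  ultimately obtain q2 where q2: "path q2" "path_image q2 \<subseteq> path_image q1" "\<phi> (pathstart q2) = 0"
    "pathfinish q2 = pathfinish q1" "\<And>z. z \<in> path_image q2 \<Longrightarrow> 0 \<le> \<phi> z"
    using path_last_zero[OF q1(1) sub[OF c\<phi> q1(2)]] by blast
  have "pathstart q2 \<in> path_image q1" using q2(2) by auto
  then have "E (pathstart q2) \<le> c1'"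
    using q1(5)[of "pathstart q2"] q2(3) H_le[of "snd (pathstart q2)"] V(2) yb unfolding E_def by auto
  moreover have "path_image q2 \<subseteq> path_image q" using q1(2) q2(2) by blast
  ultimately obtain q3 where q3: "path q3" "path_image q3 \<subseteq> path_image q2" "E (pathstart q3) = c1'" "E (pathfinish q3) = c2'"
    "\<And>z. z \<in> path_image q3 \<Longrightarrow> c1' \<le> E z \<and> E z \<le> c2'"
    using path_crossing[OF q2(1) sub[OF cE], of c1' c2'] far'(2) q2(4) c' by auto
  have im: "path_image q3 \<subseteq> path_image q" using q1(2) q2(2) q3(2) by blast
  let ?\<Phi> = "\<lambda>z. (\<phi> z, snd z)"
  show ?thesis
  proof (rule that[of "?\<Phi> \<circ> q3"])
    show "path (?\<Phi> \<circ> q3)"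
      by (intro path_continuous_image q3(1) continuous_intros sub[OF c\<phi> im])
    fix z' assume "z' \<in> path_image (?\<Phi> \<circ> q3)"
    then obtain z where z: "z \<in> path_image q3" "z' = ?\<Phi> z" by (auto simp: path_image_compose)
    have "0 \<le> \<phi> z" using z(1) q2(5)[of z] q3(2) by blast
    moreover have zq: "z \<in> path_image q" using z im by auto
    ultimately show "0 \<le> fst z' \<and> snd z' \<in> {0..Y} \<and> H (snd z') + V1 (fst z') \<in> {c1'..c2'} \<and>
      (\<exists>z\<in>path_image q. z' = (fst z + h (snd z) * \<sigma>, snd z))"
      using q(2)[OF zq] q3(5)[OF z(1)] z(2) by (auto simp: E_def \<phi>_def intro!: bexI[of _ z])
  qed (use q3(3,4) in \<open>simp_all add: E_def pathstart_compose pathfinish_compose\<close>)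
qed

text \<open>The energy \<open>E\<close> and the quotient \<open>H / E\<close> map \<open>A\<close>
  injectively into a rectangle. The quotient is zero at the start of \<open>q\<close> and one at its
  end, so the image of \<open>p\<close> joins the vertical sides and that of \<open>q\<close> the
  horizontal ones. The images need not fill the rectangle; injectivity pulls their common point back
  to \<open>A\<close>.\<close>

lemma annulus_crossing:
  fixes p q :: "real \<Rightarrow> real \<times> real" and H V :: "real \<Rightarrow> real"
  defines "E \<equiv> \<lambda>z. H (snd z) + V (fst z)"
  assumes pq: "path p" "path_image p \<subseteq> A" "path q" "path_image q \<subseteq> A"
    and cont: "continuous_on A (\<lambda>z. H (snd z))" "continuous_on A (\<lambda>z. V (fst z))"
    and inj: "\<And>z w. z \<in> A \<Longrightarrow> w \<in> A \<Longrightarrow> H (snd z) = H (snd w) \<Longrightarrow> V (fst z) = V (fst w) \<Longrightarrow> z = w"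
    and nonneg: "\<And>z. z \<in> A \<Longrightarrow> 0 \<le> H (snd z) \<and> 0 \<le> V (fst z) \<and> E z \<in> {c1..C}" and c1: "0 < c1"
    and p_ends: "E (pathstart p) = c1" "E (pathfinish p) = C"
    and q_ends: "H (snd (pathstart q)) = 0" "V (fst (pathfinish q)) = 0"
  obtains z where "z \<in> path_image p" "z \<in> path_image q"
proof -
  define \<Xi> :: "real \<times> real \<Rightarrow> real^2" where "\<Xi> = (\<lambda>z. \<chi> i. if i = 1 then E z else H (snd z) / E z)"
  have E_pos: "0 < E z" if "z \<in> A" for z using nonneg[OF that] c1 by auto
  have cE: "continuous_on A E" unfolding E_def by (intro continuous_intros cont)
  have "continuous_on A (\<lambda>z. if i = (1::2) then E z else H (snd z) / E z)" for i
    using E_pos by (cases "i = 1") (auto intro!: continuous_intros cE cont simp: less_imp_neq[symmetric])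
  then have c\<Xi>: "continuous_on A \<Xi>" unfolding \<Xi>_def by (intro continuous_on_vec_lambda)
  let ?a = "\<chi> i. if i = (1::2) then c1 else 0" and ?b = "\<chi> i. if i = (1::2) then C else 1"
  have box: "\<Xi> z \<in> cbox ?a ?b" if "z \<in> A" for z
    using nonneg[OF that] E_pos[OF that] unfolding mem_box_cart \<Xi>_def
    by (auto simp: divide_le_eq E_def)
  have ends: "pathstart p \<in> A" "pathfinish p \<in> A" "pathstart q \<in> A" "pathfinish q \<in> A" using pq by auto
  obtain \<xi> where "\<xi> \<in> path_image (\<Xi> \<circ> p)" "\<xi> \<in> path_image (\<Xi> \<circ> q)"
  proof (rule fashoda[of "\<Xi> \<circ> p" "\<Xi> \<circ> q" ?a ?b])
    show "path (\<Xi> \<circ> p)" "path (\<Xi> \<circ> q)"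
      using pq by (auto intro!: path_continuous_image continuous_on_subset[OF c\<Xi>])
    show "path_image (\<Xi> \<circ> p) \<subseteq> cbox ?a ?b" "path_image (\<Xi> \<circ> q) \<subseteq> cbox ?a ?b"
      unfolding path_image_compose using box pq by blast+
    show "pathfinish (\<Xi> \<circ> q) $ 2 = ?b $ 2"
      using q_ends(2) E_pos[OF ends(4)] by (simp add: pathfinish_compose \<Xi>_def E_def)
  qed (use p_ends q_ends in \<open>simp_all add: pathstart_compose pathfinish_compose \<Xi>_def\<close>)
  then obtain z w where zw: "z \<in> path_image p" "w \<in> path_image q" "\<Xi> z = \<Xi> w"
    by (auto simp: path_image_compose)
  then have A: "z \<in> A" "w \<in> A" using pq by auto
  have "E z = E w" "H (snd z) / E z = H (snd w) / E w"
    using arg_cong[OF zw(3), of "\<lambda>v. v $ 1"] arg_cong[OF zw(3), of "\<lambda>v. v $ 2"] by (simp_all add: \<Xi>_def)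
  then have "E z = E w" "H (snd z) = H (snd w)" using E_pos[OF A(2)] by auto
  then have "z = w" using inj[OF A] unfolding E_def by auto
  then show ?thesis using that zw by auto
qed

subsection \<open>The oscillator\<close>

lemma primitive_deriv:
  assumes f: "continuous_on (einterval a b) f" and 0: "0 \<in> einterval a b" and y: "y \<in> einterval a b"
  shows "(primitive f has_real_derivative f y) (at y)"
proof -
  obtain r where r: "r > 0" "\<And>u. \<bar>u - y\<bar> \<le> r \<Longrightarrow> u \<in> einterval a b"
  proof -
    have "open (einterval a b)" by simp
    then obtain r where "r > 0" "cball y r \<subseteq> einterval a b" using y open_contains_cball by blast
    then have "u \<in> einterval a b" if "\<bar>u - y\<bar> \<le> r" for u
      using subsetD[of "cball y r" "einterval a b" u] that by (simp add: dist_real_def abs_minus_commute)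
    then show ?thesis using that \<open>r > 0\<close> by blast
  qed
  \<comment> \<open>A compact interval inside the domain that contains the base point zero and has
    \<open>y\<close> in its interior, so that the derivative within it is a full one.\<close>
  define l u where "l = min 0 (y - r)" and "u = max 0 (y + r)"
  have lu: "l \<in> einterval a b" "u \<in> einterval a b" using r 0 unfolding l_def u_def by (auto simp: min_def max_def)
  have sub: "{l..u} \<subseteq> einterval a b"
  proof
    fix x assume "x \<in> {l..u}"
    then have "ereal l \<le> ereal x" "ereal x \<le> ereal u" by auto
    moreover have "a < ereal l" "ereal u < b" using lu by (auto simp: einterval_iff)
    ultimately show "x \<in> einterval a b" unfolding einterval_iff by (blast intro: less_le_trans le_less_trans)
  qed
  have "((\<lambda>u. LBINT y=ereal 0..ereal u. f y) has_vector_derivative f y) (at y within {l..u})"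
    using r by (intro interval_integral_FTC2 continuous_on_subset[OF f sub]) (auto simp: l_def u_def)
  moreover have "at y within {l..u} = at y"
    using r by (intro at_within_Icc_at) (auto simp: l_def u_def)
  moreover have "primitive f = (\<lambda>u. LBINT y=ereal 0..ereal u. f y)"
    by (rule ext) (simp add: primitive_def zero_ereal_def)
  ultimately show ?thesis by (simp add: has_real_derivative_iff_has_vector_derivative)
qed

lemma primitive_0 [simp]: "primitive f 0 = 0"
  by (simp add: primitive_def flip: zero_ereal_def)

text \<open>\<open>Lim\<close> carries information only once convergence is known. A monotone
  \<open>H\<close> converges at the end point to its supremum, and a number below a supremum is
  exceeded by some value.\<close>

lemma Lim_at_left_bound:
  fixes H :: "real \<Rightarrow> real" and \<rho> :: ereal
  assumes \<rho>: "0 < \<rho>" and mono: "\<And>u v. 0 \<le> u \<Longrightarrow> u \<le> v \<Longrightarrow> ereal v < \<rho> \<Longrightarrow> H u \<le> H v"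
    and c: "ereal c < Lim (at_left \<rho>) (\<lambda>y. ereal (H (real_of_ereal y)))"
  obtains y where "0 \<le> y" "ereal y < \<rho>" "c < H y"
proof -
  define S where "S = (SUP y\<in>{y. 0 \<le> y \<and> ereal y < \<rho>}. ereal (H y))"
  have real: "0 \<le> real_of_ereal z" "ereal (real_of_ereal z) = z" if "0 < z" "z < \<rho>" for z
    using that by (cases z; auto)+
  have "((\<lambda>y. ereal (H (real_of_ereal y))) \<longlongrightarrow> S) (at_left \<rho>)"
  proof (rule order_tendstoI)
    fix s assume "s < S"
    then obtain y where y: "0 \<le> y" "ereal y < \<rho>" "s < ereal (H y)" unfolding S_def less_SUP_iff by auto
    have "s < ereal (H (real_of_ereal z))" if "ereal y < z" "z < \<rho>" for z
    proof -
      have "0 < z" using y(1) that(1) by (metis ereal_less_eq(5) le_less_trans)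
      note z = real[OF this that(2)]
      have "y \<le> real_of_ereal z" using that(1) z(2) by (metis ereal_less_eq(3) less_imp_le)
      then have "H y \<le> H (real_of_ereal z)" using y(1) z(2) that(2) by (intro mono) auto
      then show ?thesis using y(3) by (metis ereal_less_eq(3) less_le_trans)
    qed
    then show "eventually (\<lambda>x. s < ereal (H (real_of_ereal x))) (at_left \<rho>)"
      using y(2) unfolding eventually_at_left[OF \<rho>] by blast
  next
    fix s assume s: "S < s"
    have "ereal (H (real_of_ereal z)) < s" if "0 < z" "z < \<rho>" for z
    proof -
      have "ereal (H (real_of_ereal z)) \<le> S" unfolding S_def
        using real[OF that] that(2) by (intro SUP_upper) auto
      then show ?thesis using s by simp
    qed
    then show "eventually (\<lambda>x. ereal (H (real_of_ereal x)) < s) (at_left \<rho>)"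
      using \<rho> unfolding eventually_at_left[OF \<rho>] by blast
  qed
  moreover have "\<not> trivial_limit (at_left \<rho>)"
    unfolding trivial_limit_def eventually_at_left[OF \<rho>] using dense by blast
  ultimately have "Lim (at_left \<rho>) (\<lambda>y. ereal (H (real_of_ereal y))) = S" by (rule tendsto_Lim[rotated])
  then have "ereal c < S" using c by simp
  then show ?thesis unfolding S_def less_SUP_iff using that by auto
qed

lemma Lim_at_right_bound:
  fixes H :: "real \<Rightarrow> real" and \<rho> :: ereal
  assumes \<rho>: "\<rho> < 0" and mono: "\<And>u v. u \<le> 0 \<Longrightarrow> v \<le> u \<Longrightarrow> \<rho> < ereal v \<Longrightarrow> H u \<le> H v"
    and c: "ereal c < Lim (at_right \<rho>) (\<lambda>y. ereal (H (real_of_ereal y)))"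
  obtains y where "y \<le> 0" "\<rho> < ereal y" "c < H y"
proof -
  define S where "S = (SUP y\<in>{y. y \<le> 0 \<and> \<rho> < ereal y}. ereal (H y))"
  have real: "real_of_ereal z \<le> 0" "ereal (real_of_ereal z) = z" if "z < 0" "\<rho> < z" for z
    using that by (cases z; auto)+
  have "((\<lambda>y. ereal (H (real_of_ereal y))) \<longlongrightarrow> S) (at_right \<rho>)"
  proof (rule order_tendstoI)
    fix s assume "s < S"
    then obtain y where y: "y \<le> 0" "\<rho> < ereal y" "s < ereal (H y)" unfolding S_def less_SUP_iff by auto
    have "s < ereal (H (real_of_ereal z))" if "z < ereal y" "\<rho> < z" for z
    proof -
      have "z < 0" using y(1) that(1) by (metis ereal_less_eq(4) less_le_trans)
      note z = real[OF this that(2)]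
      have "real_of_ereal z \<le> y" using that(1) z(2) by (metis ereal_less_eq(3) less_imp_le)
      then have "H y \<le> H (real_of_ereal z)" using y(1) z(2) that(2) by (intro mono) auto
      then show ?thesis using y(3) by (metis ereal_less_eq(3) less_le_trans)
    qed
    then show "eventually (\<lambda>x. s < ereal (H (real_of_ereal x))) (at_right \<rho>)"
      using y(2) unfolding eventually_at_right[OF \<rho>] by blast
  next
    fix s assume s: "S < s"
    have "ereal (H (real_of_ereal z)) < s" if "z < 0" "\<rho> < z" for z
    proof -
      have "ereal (H (real_of_ereal z)) \<le> S" unfolding S_def
        using real[OF that] that(2) by (intro SUP_upper) auto
      then show ?thesis using s by simp
    qed
    then show "eventually (\<lambda>x. ereal (H (real_of_ereal x)) < s) (at_right \<rho>)"
      using \<rho> unfolding eventually_at_right[OF \<rho>] by blast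
  qed
  moreover have "\<not> trivial_limit (at_right \<rho>)"
    unfolding trivial_limit_def eventually_at_right[OF \<rho>] using dense by blast
  ultimately have "Lim (at_right \<rho>) (\<lambda>y. ereal (H (real_of_ereal y))) = S" by (rule tendsto_Lim[rotated])
  then have "ereal c < S" using c by simp
  then show ?thesis unfolding S_def less_SUP_iff using that by auto
qed

lemma half_potentialI:
  assumes "0 < A" "F 0 = 0" "F A = C" "f 0 = 0" "continuous_on {0..A} f" "\<And>u. u \<in> {0<..A} \<Longrightarrow> 0 < f u"
    "\<And>u. u \<in> {0..A} \<Longrightarrow> (F has_real_derivative f u) (at u)"
  shows "half_potential C f F A"
  using assms unfolding half_potential_def by (auto intro: has_field_derivative_at_within)

locale oscillator =
  fixes \<rho>m \<rho>p :: ereal and h g :: "real \<Rightarrow> real"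
  assumes rho: "\<rho>m < 0" "0 < \<rho>p"
    and h_cont: "continuous_on (einterval \<rho>m \<rho>p) h" and h_mono: "strict_mono_on (einterval \<rho>m \<rho>p) h" and h_0: "h 0 = 0"
    and g_cont: "continuous_on UNIV g" and g_0: "g 0 = 0" and g_sign: "\<And>u. u \<noteq> 0 \<Longrightarrow> 0 < g u * u"
begin

abbreviation "J \<equiv> einterval \<rho>m \<rho>p"
abbreviation "H \<equiv> primitive h"
abbreviation "G \<equiv> primitive g"

lemma J_0: "0 \<in> J" using rho by (simp add: einterval_iff zero_ereal_def)

lemma J_pos: assumes "0 \<le> y" shows "y \<in> J \<longleftrightarrow> ereal y < \<rho>p"
proof -
  have "0 \<le> ereal y" using assms by simp
  then show ?thesis using less_le_trans[OF rho(1)] by (auto simp: einterval_iff)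
qed

lemma J_neg: assumes "y \<le> 0" shows "y \<in> J \<longleftrightarrow> \<rho>m < ereal y"
proof -
  have "ereal y \<le> 0" using assms by simp
  then show ?thesis using le_less_trans[OF _ rho(2)] by (auto simp: einterval_iff)
qed

lemma J_convex: "u \<in> J \<Longrightarrow> v \<in> J \<Longrightarrow> {u..v} \<subseteq> J"
  by (auto simp: einterval_iff) (metis ereal_less_eq(3) less_le_trans, metis ereal_less_eq(3) le_less_trans)

lemma h_pos: "y \<in> J \<Longrightarrow> 0 < y \<Longrightarrow> 0 < h y" and h_neg: "y \<in> J \<Longrightarrow> y < 0 \<Longrightarrow> h y < 0"
  using strict_mono_onD[OF h_mono J_0, of y] strict_mono_onD[OF h_mono _ J_0, of y] h_0 by auto

lemma g_pos: "0 < x \<Longrightarrow> 0 < g x" and g_neg: "x < 0 \<Longrightarrow> g x < 0"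
  using g_sign[of x] by (auto simp: zero_less_mult_iff)

lemma H_deriv: "y \<in> J \<Longrightarrow> (H has_real_derivative h y) (at y)"
  by (rule primitive_deriv[OF h_cont J_0])

lemma G_deriv: "(G has_real_derivative g x) (at x)"
  by (rule primitive_deriv[of "-\<infinity>" \<infinity>]) (simp_all add: g_cont)

lemma H_less: assumes "0 \<le> u" "u < v" "v \<in> J" shows "H u < H v"
proof (rule DERIV_pos_imp_increasing_open[OF assms(2)])
  have sub: "{u..v} \<subseteq> J" using J_convex[OF J_0 assms(3)] assms(1) by auto
  show "continuous_on {u..v} H"
    using sub by (intro DERIV_continuous_on[where D = h] has_field_derivative_at_within[OF H_deriv]) auto
  fix x assume x: "u < x" "x < v"
  then have "x \<in> J" using sub by auto
  then show "\<exists>y. (H has_real_derivative y) (at x) \<and> 0 < y"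
    using H_deriv[of x] h_pos[of x] x assms(1) by auto
qed

lemma H_less': assumes "v \<le> 0" "u < v" "u \<in> J" shows "H v < H u"
proof (rule DERIV_neg_imp_decreasing_open[OF assms(2)])
  have sub: "{u..v} \<subseteq> J" using J_convex[OF assms(3) J_0] assms(1) by auto
  show "continuous_on {u..v} H"
    using sub by (intro DERIV_continuous_on[where D = h] has_field_derivative_at_within[OF H_deriv]) auto
  fix x assume x: "u < x" "x < v"
  then have "x \<in> J" using sub by auto
  then show "\<exists>y. (H has_real_derivative y) (at x) \<and> y < 0"
    using H_deriv[of x] h_neg[of x] x assms(1) by auto
qed

lemma G_cont: "continuous_on S G"
  by (intro DERIV_continuous_on[where D = g] has_field_derivative_at_within[OF G_deriv])

lemma H_cont: "continuous_on J H"
  by (intro DERIV_continuous_on[where D = h] has_field_derivative_at_within[OF H_deriv])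

lemma G_less: assumes "0 \<le> u" "u < v" shows "G u < G v"
  using assms by (intro DERIV_pos_imp_increasing_open[OF assms(2) _ G_cont]) (auto intro!: exI G_deriv g_pos)

lemma G_less': assumes "v \<le> 0" "u < v" shows "G v < G u"
  using assms by (intro DERIV_neg_imp_decreasing_open[OF assms(2) _ G_cont]) (auto intro!: exI G_deriv g_neg)

lemma H_inv_pos: "0 \<le> y \<Longrightarrow> y \<in> J \<Longrightarrow> H_inv_pos \<rho>p h (H y) = y"
  unfolding H_inv_pos_def
proof (rule inv_into_f_f)
  show "inj_on H {y. 0 \<le> y \<and> ereal y < \<rho>p}"
    by (rule linorder_inj_onI) (use H_less J_pos in \<open>force+\<close>)
qed (simp add: J_pos)

lemma H_inv_neg: "y \<le> 0 \<Longrightarrow> y \<in> J \<Longrightarrow> H_inv_neg \<rho>m h (H y) = y"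
  unfolding H_inv_neg_def
proof (rule inv_into_f_f)
  show "inj_on H {y. \<rho>m < ereal y \<and> y \<le> 0}"
    by (rule linorder_inj_onI) (use H_less' J_neg in \<open>force+\<close>)
qed (simp add: J_neg)

text \<open>Below \<open>H_star\<close> the level \<open>c\<close> is exceeded by some value of
  \<open>H\<close>, hence attained by the intermediate value theorem. Only then is the
  \<open>inv_into\<close> in \<open>H_inv_pos\<close> a genuine preimage.\<close>

lemma level_pos:
  assumes c: "0 < c" "ereal c < H_star \<rho>m \<rho>p h"
  shows "H_inv_pos \<rho>p h c \<in> J" "0 < H_inv_pos \<rho>p h c" "H (H_inv_pos \<rho>p h c) = c"
proof -
  have "H u \<le> H v" if "0 \<le> u" "u \<le> v" "ereal v < \<rho>p" for u v
    using H_less[of u v] J_pos[of v] that by (cases "u = v") auto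
  moreover have "ereal c < Lim (at_left \<rho>p) (\<lambda>y. ereal (H (real_of_ereal y)))"
    using c(2) unfolding H_star_def by simp
  ultimately obtain y where y: "0 \<le> y" "ereal y < \<rho>p" "c < H y" using Lim_at_left_bound[OF rho(2)] by blast
  have yJ: "y \<in> J" using J_pos y by simp
  have "\<exists>z\<ge>0. z \<le> y \<and> H z = c"
    using y c(1) J_convex[OF J_0 yJ] by (intro IVT' continuous_on_subset[OF H_cont]) auto
  then obtain z where z: "0 \<le> z" "z \<le> y" "H z = c" by auto
  then have "z \<in> J" "z \<noteq> 0" using J_convex[OF J_0 yJ] c(1) by auto
  then show "H_inv_pos \<rho>p h c \<in> J" "0 < H_inv_pos \<rho>p h c" "H (H_inv_pos \<rho>p h c) = c"
    using H_inv_pos[of z] z by auto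
qed

lemma level_neg:
  assumes c: "0 < c" "ereal c < H_star \<rho>m \<rho>p h"
  shows "H_inv_neg \<rho>m h c \<in> J" "H_inv_neg \<rho>m h c < 0" "H (H_inv_neg \<rho>m h c) = c"
proof -
  have "H u \<le> H v" if "u \<le> 0" "v \<le> u" "\<rho>m < ereal v" for u v
    using H_less'[of u v] J_neg[of v] that by (cases "u = v") auto
  moreover have "ereal c < Lim (at_right \<rho>m) (\<lambda>y. ereal (H (real_of_ereal y)))"
    using c(2) unfolding H_star_def by simp
  ultimately obtain y where y: "y \<le> 0" "\<rho>m < ereal y" "c < H y" using Lim_at_right_bound[OF rho(1)] by blast
  have yJ: "y \<in> J" using J_neg y by simp
  have "\<exists>z\<ge>y. z \<le> 0 \<and> H z = c"
    using y c(1) J_convex[OF yJ J_0] by (intro IVT2' continuous_on_subset[OF H_cont]) auto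
  then obtain z where z: "z \<le> 0" "y \<le> z" "H z = c" by auto
  then have "z \<in> J" "z \<noteq> 0" using J_convex[OF yJ J_0] c(1) by auto
  then show "H_inv_neg \<rho>m h c \<in> J" "H_inv_neg \<rho>m h c < 0" "H (H_inv_neg \<rho>m h c) = c"
    using H_inv_neg[of z] z by auto
qed

lemma annulus_flow_levels:
  assumes mu: "0 < mu" and c: "0 < c1" "c1 \<le> c2" "ereal c2 < H_star \<rho>m \<rho>p h"
    and x: "Xm < 0" "0 < Xp" "mu * G Xm = c2" "mu * G Xp = c2"
  shows "annulus_flow h (\<lambda>x. mu * g x) H (\<lambda>x. mu * G x) (H_inv_neg \<rho>m h c2) (H_inv_pos \<rho>p h c2) Xm Xp c1 c2"
proof -
  have c2: "0 < c2" using c by simp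
  note P = level_pos[OF c2 c(3)] and N = level_neg[OF c2 c(3)]
  have J: "u \<in> J" if "H_inv_neg \<rho>m h c2 \<le> u" "u \<le> H_inv_pos \<rho>p h c2" for u
    using J_convex[OF N(1) P(1)] that by auto
  show ?thesis
  proof
    show "half_potential c2 h H (H_inv_pos \<rho>p h c2)"
      by (intro half_potentialI)
        (use P N J h_0 in \<open>auto intro!: continuous_on_subset[OF h_cont] H_deriv h_pos\<close>)
    have "((\<lambda>u. H (- u)) has_real_derivative - h (- u)) (at u)" if "- u \<in> J" for u
      using H_deriv[OF that] by (simp add: DERIV_mirror)
    then show "half_potential c2 (\<lambda>u. - h (- u)) (\<lambda>u. H (- u)) (- H_inv_neg \<rho>m h c2)"
      by (intro half_potentialI)
        (use P N J h_0 in \<open>auto intro!: continuous_on_compose2[OF h_cont] continuous_intros h_neg\<close>)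
    show "half_potential c2 (\<lambda>x. mu * g x) (\<lambda>x. mu * G x) Xp"
      by (intro half_potentialI)
        (use x g_0 g_pos mu in \<open>auto intro!: continuous_intros continuous_on_subset[OF g_cont] DERIV_cmult[OF G_deriv]\<close>)
    have "((\<lambda>u. mu * G (- u)) has_real_derivative - (mu * g (- u))) (at u)" for u
      using DERIV_cmult[OF G_deriv, of mu "- u"] DERIV_mirror[of "\<lambda>x. mu * G x" _ u] by simp
    then show "half_potential c2 (\<lambda>u. - (mu * g (- u))) (\<lambda>u. mu * G (- u)) (- Xm)"
      by (intro half_potentialI)
        (use x g_0 g_neg mu in \<open>auto intro!: continuous_on_compose2[OF g_cont] continuous_intros mult_pos_neg\<close>)
  qed (use c in auto)
qed

end

section \<open>A single annulus with positive weight\<close>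

locale oscillator_annulus = oscillator +
  fixes mu c1 c2 :: real and xm xp :: "real \<Rightarrow> real"
  assumes mu: "0 < mu" and levels: "0 < c1" "c1 < c2" "ereal c2 < H_star \<rho>m \<rho>p h"
    and orbits: "\<And>c. c \<in> {c1..c2} \<Longrightarrow> xm c < 0 \<and> 0 < xp c \<and> mu * G (xm c) = c \<and> mu * G (xp c) = c"
begin

abbreviation "ann \<equiv> annulus \<rho>m \<rho>p h g 0 mu c1 c2"
abbreviation "time \<equiv> quadrant_time \<rho>m \<rho>p h g 0 mu xm xp"
abbreviation "per \<equiv> period \<rho>m \<rho>p h g 0 mu xm xp"

sublocale flow: annulus_flow h "\<lambda>x. mu * g x" H "\<lambda>x. mu * G x" "H_inv_neg \<rho>m h c2" "H_inv_pos \<rho>p h c2" "xm c2" "xp c2" c1 c2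
  by (rule annulus_flow_levels) (use mu levels orbits[of c2] in auto)

lemma energy_eq: "energy h g 0 mu z = H (snd z) + mu * G (fst z)"
  by (simp add: energy_def potential_def case_prod_unfold)

lemma En_eq: "flow.En = energy h g 0 mu"
  by (rule ext) (simp add: flow.En_def energy_eq case_prod_unfold)

lemma H_nonneg: "y \<in> J \<Longrightarrow> 0 \<le> H y"
  using H_less[of 0 y] H_less'[of 0 y] by (cases y "0::real" rule: linorder_cases) (auto simp: less_imp_le)

lemma G_nonneg: "0 \<le> G x"
  using G_less[of 0 x] G_less'[of 0 x] by (cases x "0::real" rule: linorder_cases) (auto simp: less_imp_le)

text \<open>Both parts of the energy are nonnegative, so each is at most \<open>c2\<close>;
  monotonicity on the half-axes turns this into bounds on the coordinates.\<close>

lemma ann_bounds: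
  assumes "z \<in> ann"
  shows "snd z \<in> {H_inv_neg \<rho>m h c2..H_inv_pos \<rho>p h c2}" "fst z \<in> {xm c2..xp c2}"
proof -
  have z: "snd z \<in> J" "H (snd z) + mu * G (fst z) \<le> c2"
    using assms energy_eq[of z] unfolding annulus_def by (auto simp: case_prod_unfold)
  have c2: "0 < c2" using levels by simp
  note P = level_pos[OF c2 levels(3)] and N = level_neg[OF c2 levels(3)]
  have "0 \<le> mu * G (fst z)" using mu G_nonneg by simp
  then have "H (snd z) \<le> c2" "mu * G (fst z) \<le> c2" using z H_nonneg[OF z(1)] by auto
  then show "snd z \<in> {H_inv_neg \<rho>m h c2..H_inv_pos \<rho>p h c2}"
    using H_less[of "H_inv_pos \<rho>p h c2" "snd z"] H_less'[of "H_inv_neg \<rho>m h c2" "snd z"] P N z(1)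
    by (auto simp flip: not_less)
  have "G (fst z) \<le> G (xp c2)" "G (fst z) \<le> G (xm c2)"
    using \<open>mu * G (fst z) \<le> c2\<close> orbits[of c2] levels
      mult_left_le_imp_le[OF _ mu, of "G (fst z)" "G (xp c2)"] mult_left_le_imp_le[OF _ mu, of "G (fst z)" "G (xm c2)"] by auto
  then show "fst z \<in> {xm c2..xp c2}"
    using G_less[of "xp c2" "fst z"] G_less'[of "xm c2" "fst z"] orbits[of c2] levels
    by (auto simp flip: not_less)
qed

lemma J_bounds: "{H_inv_neg \<rho>m h c2..H_inv_pos \<rho>p h c2} \<subseteq> J"
  using level_pos[of c2] level_neg[of c2] levels by (intro J_convex) auto

lemma A_eq: "flow.A n = ann \<inter> closed_quadrant (quad n)"
proof -
  have "z \<in> ann \<longleftrightarrow> fst z \<in> {xm c2..xp c2} \<and> snd z \<in> {H_inv_neg \<rho>m h c2..H_inv_pos \<rho>p h c2} \<and> flow.En z \<in> {c1..c2}" for z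
    using ann_bounds[of z] J_bounds unfolding En_eq by (auto simp: annulus_def)
  then show ?thesis unfolding flow.A_def by auto
qed

text \<open>Along a quarter orbit \<open>x\<close> can replace time as variable, and conservation of
  energy recovers \<open>y\<close> from \<open>x\<close> by a branch of the inverse of
  \<open>H\<close>. This links the constructed times with the integrals in the twist
  conditions.\<close>

lemma quarter_time_eq:
  assumes clock: "annulus_clock h (\<lambda>x. mu * g x) H (\<lambda>x. mu * G x) (H_inv_neg \<rho>m h c2) (H_inv_pos \<rho>p h c2)
      (xm c2) (xp c2) c1 c2 T U \<tau> J"
    and c: "c \<in> {c1..c2}"
  shows "T n c = time (quad n) c"
proof -
  interpret annulus_clock h "\<lambda>x. mu * g x" H "\<lambda>x. mu * G x" "H_inv_neg \<rho>m h c2" "H_inv_pos \<rho>p h c2"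
      "xm c2" "xp c2" c1 c2 T U \<tau> J by (rule clock)
  define X Y where "X = (\<lambda>t. fst (U n (c, t)))" and "Y = (\<lambda>t. snd (U n (c, t)))"
  have pos: "0 < T n c" using T_pos[OF c] .
  have XY: "Y t \<in> J" "(X t, Y t) \<in> closed_quadrant (quad n)" "H (Y t) + mu * G (X t) = c" if "t \<in> {0..T n c}" for t
    using U_A[OF c that] U_En[OF c that] unfolding A_eq En_eq energy_eq X_def Y_def by (auto simp: annulus_def)
  have X0: "X t = 0 \<longleftrightarrow> t = (if odd n then T n c else 0)" if "t \<in> {0..T n c}" for t
    using U_fst_0[OF c that] unfolding X_def .
  have Y0: "Y t = 0 \<longleftrightarrow> t = (if odd n then 0 else T n c)" if "t \<in> {0..T n c}" for t
    using U_snd_0[OF c that] unfolding Y_def .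
  have cU: "continuous_on {0..T n c} (\<lambda>t. U n (c, t))"
    using c by (intro continuous_on_compose2[OF U_cont] continuous_intros) auto
  have cX: "continuous_on {0..T n c} X" and cY: "continuous_on {0..T n c} Y"
    unfolding X_def Y_def by (intro continuous_intros cU)+
  have chY: "continuous_on {0<..<T n c} (\<lambda>t. h (Y t))"
    using XY(1) by (intro continuous_on_compose2[OF h_cont continuous_on_subset[OF cY]]) auto
  have X': "(X has_real_derivative h (Y t)) (at t)" if "t \<in> {0<..<T n c}" for t
    using U_deriv[OF c that] unfolding X_def Y_def by auto
  have pot: "potential g 0 mu x = mu * G x" for x by (simp add: potential_def)
  have cH: "c - mu * G (X t) = H (Y t)" if "t \<in> {0..T n c}" for t using XY(3)[OF that] by simp
  have xc: "xm c < 0" "0 < xp c" "mu * G (xm c) = c" "mu * G (xp c) = c" using orbits[OF c] by auto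
  have Gp: "X t = xp c" if "t \<in> {0..T n c}" "Y t = 0" "0 \<le> X t" for t
  proof -
    have "G (X t) = G (xp c)" using XY(3)[OF that(1)] xc mu that(2) by auto
    then show ?thesis using G_less[of "X t" "xp c"] G_less[of "xp c" "X t"] that xc by (cases "X t" "xp c" rule: linorder_cases) auto
  qed
  have Gm: "X t = xm c" if "t \<in> {0..T n c}" "Y t = 0" "X t \<le> 0" for t
  proof -
    have "G (X t) = G (xm c)" using XY(3)[OF that(1)] xc mu that(2) by auto
    then show ?thesis using G_less'[of "X t" "xm c"] G_less'[of "xm c" "X t"] that xc by (cases "X t" "xm c" rule: linorder_cases) auto
  qed
  have ends: "0 \<in> {0..T n c}" "T n c \<in> {0..T n c}" using pos by auto
  have inner: "Y t \<noteq> 0" if "t \<in> {0<..<T n c}" for t using Y0[of t] that by auto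
  \<comment> \<open>In the upper half-plane \<open>x\<close> increases, in the lower one, treated by
    \<open>down\<close>, it decreases; the sign of \<open>Y\<close> also decides which branch of the
    inverse of \<open>H\<close> is taken.\<close>
  have up: "(LBINT u=ereal (X 0)..ereal (X (T n c)). 1 / h (H_inv_pos \<rho>p h (c - mu * G u))) = T n c"
    if Y: "\<And>t. t \<in> {0..T n c} \<Longrightarrow> 0 \<le> Y t"
  proof (rule time_integral_increasing[OF pos cX chY], intro conjI X')
    fix t assume t: "t \<in> {0<..<T n c}"
    then have "0 \<le> Y t" "Y t \<in> J" using XY(1)[of t] Y[of t] by auto
    then show "0 < h (Y t)" "h (H_inv_pos \<rho>p h (c - mu * G (X t))) = h (Y t)"
      using h_pos[of "Y t"] inner[OF t] H_inv_pos[of "Y t"] cH[of t] t by auto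
  qed
  have down: "(LBINT u=ereal (X (T n c))..ereal (X 0). 1 / (- h (H_inv_neg \<rho>m h (c - mu * G u)))) = T n c"
    if Y: "\<And>t. t \<in> {0..T n c} \<Longrightarrow> Y t \<le> 0"
  proof (rule time_integral_decreasing[OF pos cX continuous_on_minus[OF chY]], intro conjI)
    fix t assume t: "t \<in> {0<..<T n c}"
    then have "Y t \<le> 0" "Y t \<in> J" using XY(1)[of t] Y[of t] by auto
    then show "0 < - h (Y t)" "- h (H_inv_neg \<rho>m h (c - mu * G (X t))) = - h (Y t)"
      using h_neg[of "Y t"] inner[OF t] H_inv_neg[of "Y t"] cH[of t] t by auto
    show "(X has_real_derivative - (- h (Y t))) (at t)" using X'[OF t] by simp
  qed
  have parity: "odd n \<longleftrightarrow> quad n = QIV \<or> quad n = QII"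
    using quad_cases[of n] by (cases "even n") auto
  show ?thesis
  proof (cases "quad n")
    case QI
    then have "X 0 = 0" "X (T n c) = xp c"
      using X0[OF ends(1)] Y0[OF ends(2)] Gp[OF ends(2)] XY(2)[OF ends(2)] parity by auto
    then show ?thesis using up XY(2) unfolding QI by (simp add: pot zero_ereal_def)
  next
    case QIV
    then have "X (T n c) = 0" "X 0 = xp c"
      using X0[OF ends(2)] Y0[OF ends(1)] Gp[OF ends(1)] XY(2)[OF ends(1)] parity by auto
    then show ?thesis using down XY(2) unfolding QIV by (simp add: pot zero_ereal_def)
  next
    case QIII
    then have "X 0 = 0" "X (T n c) = xm c"
      using X0[OF ends(1)] Y0[OF ends(2)] Gm[OF ends(2)] XY(2)[OF ends(2)] parity by auto
    then show ?thesis using down XY(2) unfolding QIII by (simp add: pot zero_ereal_def)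
  next
    case QII
    then have "X (T n c) = 0" "X 0 = xm c"
      using X0[OF ends(2)] Y0[OF ends(1)] Gm[OF ends(1)] XY(2)[OF ends(1)] parity by auto
    then show ?thesis using up XY(2) unfolding QII by (simp add: pot zero_ereal_def)
  qed
qed

lemma period_rotate: "time q c + time (qnext q) c + time (qnext (qnext q)) c + time (qnext (qnext (qnext q))) c = per c"
  by (cases q) (simp_all add: period_def)

text \<open>Four consecutive quarters make up one period, so the sums in the twist conditions are
  differences of clock times: from \<open>Suc k0\<close> to \<open>k0 + 3 + 4 * \<alpha>\<close> for
  \<open>d\<close>, and from \<open>k0\<close> to \<open>k0 + 2 + 4 * \<beta>\<close> for
  \<open>e\<close>. Monotonicity of the clock passes from these to any admissible
  \<open>n\<close>.\<close>

lemma nonlinear_stage: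
  assumes p: "path p" "path_image p \<subseteq> ann \<inter> closed_quadrant (quad k0)" and parity: "even k0" "odd n"
    and n: "k0 + 3 + 4 * \<alpha> \<le> n" "n \<le> k0 + 1 + 4 * \<beta>"
    and ends: "energy h g 0 mu (pathstart p) = d" "energy h g 0 mu (pathfinish p) = e"
    and de: "d \<in> {c1..c2}" "e \<in> {c1..c2}"
    and slow: "tb - ta < time (qnext (quad k0)) d + time (qnext (qnext (quad k0))) d + real \<alpha> * per d"
    and fast: "time (quad k0) e + time (qnext (quad k0)) e + real \<beta> * per e < tb - ta"
  obtains q where "path q" "path_image q \<subseteq> ann \<inter> closed_quadrant (quad n)"
    "snd (pathstart q) = 0" "fst (pathfinish q) = 0"
    "\<And>z'. z' \<in> path_image q \<Longrightarrow> \<exists>z\<in>path_image p. \<exists>x y. piecewise_sol J h g (\<lambda>_. mu) ta tb x y \<and>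
       (x ta, y ta) = z \<and> (x tb, y tb) = z' \<and>
       exactly_zeros ((n - 1 - k0) div 2) x {ta<..<tb} \<and> exactly_zeros ((n + 1 - k0) div 2) y {ta..tb}"
proof -
  obtain T U \<tau> where TU: "\<And>n. quarter_flow flow.En (flow.A n) c1 c2 h (\<lambda>x. mu * g x) (odd n) (T n) (U n) (\<tau> n)"
    by (rule flow.quarter_flow_ex) (rule that)
  interpret clk: annulus_clock h "\<lambda>x. mu * g x" H "\<lambda>x. mu * G x" "H_inv_neg \<rho>m h c2" "H_inv_pos \<rho>p h c2"
      "xm c2" "xp c2" c1 c2 T U \<tau> J
    by unfold_locales (use TU J_bounds in auto)
  have T: "T l c = time (quad l) c" if "c \<in> {c1..c2}" for l c
    by (rule quarter_time_eq[OF clk.annulus_clock_axioms that])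
  have turn: "clk.clock (l + 4 * j) c = clk.clock l c + real j * per c" if c: "c \<in> {c1..c2}" for l j c
  proof (induction j)
    case (Suc j)
    have eq: "l + 4 * Suc j = Suc (Suc (Suc (Suc (l + 4 * j))))" by simp
    have "clk.clock (l + 4 * Suc j) c = clk.clock (l + 4 * j) c + per c"
      unfolding eq using period_rotate[of "quad (l + 4 * j)" c] by (simp add: clk.clock_Suc T[OF c])
    then show ?case using Suc by (simp add: algebra_simps)
  qed simp
  have "clk.clock (k0 + 3 + 4 * \<alpha>) d \<le> clk.clock n d" by (rule clk.clock_le[OF de(1) n(1)])
  moreover have "clk.clock (k0 + 3 + 4 * \<alpha>) d = clk.clock (Suc k0) d + time (qnext (quad k0)) d
      + time (qnext (qnext (quad k0))) d + real \<alpha> * per d"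
    unfolding turn[OF de(1)] by (simp add: numeral_3_eq_3 clk.clock_Suc T[OF de(1)])
  ultimately have slow': "tb - ta < clk.clock n d - clk.clock (Suc k0) d" using slow by simp
  have "clk.clock (Suc n) e \<le> clk.clock (k0 + 2 + 4 * \<beta>) e" using n(2) by (intro clk.clock_le[OF de(2)]) simp
  moreover have "clk.clock (k0 + 2 + 4 * \<beta>) e = clk.clock k0 e + time (quad k0) e
      + time (qnext (quad k0)) e + real \<beta> * per e"
    unfolding turn[OF de(2)] by (simp add: numeral_2_eq_2 clk.clock_Suc T[OF de(2)])
  ultimately have fast': "clk.clock (Suc n) e - clk.clock k0 e < tb - ta" using fast by simp
  have sol: "piecewise_sol J h (\<lambda>x. mu * g x) (\<lambda>_. 1) ta tb x y \<longleftrightarrow> piecewise_sol J h g (\<lambda>_. mu) ta tb x y" for x y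
    by (simp add: piecewise_sol_def)
  show ?thesis
    by (rule clk.stretch[of p k0 n tb ta])
      (use p parity n slow' fast' ends that in \<open>simp_all add: A_eq En_eq sol\<close>)
qed

text \<open>The prescribed arc joins the two boundaries of the annulus, \<open>q\<close> joins the
  two axes, and both stay in the same quadrant.\<close>

lemma final_crossing:
  assumes q: "path q" "path_image q \<subseteq> ann \<inter> closed_quadrant Q" "snd (pathstart q) = 0" "fst (pathfinish q) = 0"
    and r: "annulus_arc \<rho>m \<rho>p h g 0 mu c1 c2 r" "r \<subseteq> closed_quadrant Q"
  obtains z where "z \<in> path_image q" "z \<in> r"
proof -
  obtain \<gamma> where \<gamma>: "arc \<gamma>" "path_image \<gamma> = r" "energy h g 0 mu (pathstart \<gamma>) = c1" "energy h g 0 mu (pathfinish \<gamma>) = c2"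
    and rA: "r \<subseteq> ann" using r(1) unfolding annulus_arc_def by auto
  let ?A = "ann \<inter> closed_quadrant Q"
  have J: "snd z \<in> J" if "z \<in> ?A" for z using that by (auto simp: annulus_def)
  obtain z where "z \<in> path_image \<gamma>" "z \<in> path_image q"
  proof (rule annulus_crossing[of \<gamma> ?A q H "\<lambda>x. mu * G x" c1 c2])
    show "continuous_on ?A (\<lambda>z. H (snd z))"
      using J by (intro continuous_on_compose2[OF H_cont] continuous_intros) auto
    show "continuous_on ?A (\<lambda>z. mu * G (fst z))"
      by (intro continuous_intros continuous_on_compose2[OF G_cont[of UNIV]]) auto
    show "z = w" if "z \<in> ?A" "w \<in> ?A" "H (snd z) = H (snd w)" "mu * G (fst z) = mu * G (fst w)" for z w
    proof -
      have b: "snd z \<in> {H_inv_neg \<rho>m h c2..H_inv_pos \<rho>p h c2}" "fst z \<in> {xm c2..xp c2}"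
        "snd w \<in> {H_inv_neg \<rho>m h c2..H_inv_pos \<rho>p h c2}" "fst w \<in> {xm c2..xp c2}"
        using ann_bounds that(1,2) by blast+
      have s: "0 \<le> fst z \<and> 0 \<le> fst w \<or> fst z \<le> 0 \<and> fst w \<le> 0" "0 \<le> snd z \<and> 0 \<le> snd w \<or> snd z \<le> 0 \<and> snd w \<le> 0"
        using that(1,2) by (cases Q; auto)+
      show "z = w" using flow.V_inj[OF that(4) b(2,4) s(1)] flow.H_inj[OF that(3) b(1,3) s(2)]
        by (simp add: prod_eq_iff)
    qed
    show "0 \<le> H (snd z) \<and> 0 \<le> mu * G (fst z) \<and> H (snd z) + mu * G (fst z) \<in> {c1..c2}" if "z \<in> ?A" for z
      using H_nonneg[OF J[OF that]] G_nonneg mu that energy_eq[of z] by (auto simp: annulus_def)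
  qed (use \<gamma> rA r(2) q levels in \<open>auto simp: arc_imp_path energy_eq\<close>)
  then show ?thesis using that \<gamma>(2) by auto
qed

end

section \<open>The shear on the intervals of zero weight\<close>

context oscillator
begin

lemma linear_sol: "y \<in> J \<Longrightarrow> piecewise_sol J h g (\<lambda>_. 0) ta tb (\<lambda>t. x + h y * (t - ta)) (\<lambda>_. y)"
  unfolding piecewise_sol_def by (auto intro!: continuous_intros exI[of _ "{}"] derivative_eq_intros)

lemma linear_zeros:
  assumes t: "ta \<le> tb" and y: "y \<in> J" "y \<noteq> 0"
    and x: "x \<le> 0 \<and> 0 \<le> x + h y * (tb - ta) \<or> 0 \<le> x \<and> x + h y * (tb - ta) \<le> 0"
  shows "exactly_zeros 1 (\<lambda>t. x + h y * (t - ta)) {ta..tb}" "exactly_zeros 0 (\<lambda>_. y) {ta..tb}"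
proof -
  let ?t = "- x / h y"
  have k: "h y \<noteq> 0" using h_pos[OF y(1)] h_neg[OF y(1)] y(2) by (cases "0 < y") auto
  have "0 \<le> ?t \<and> ?t \<le> tb - ta"
  proof (cases "0 < h y")
    case True
    then have "0 \<le> h y * (tb - ta)" using t by simp
    then have "x \<le> 0" "- x \<le> (tb - ta) * h y" using x by (auto simp: mult.commute)
    then show ?thesis unfolding pos_divide_le_eq[OF True] using True by (simp add: divide_nonpos_pos)
  next
    case False
    then have n: "h y < 0" using k by simp
    then have "h y * (tb - ta) \<le> 0" using t by (simp add: mult_nonpos_nonneg)
    then have "0 \<le> x" "(tb - ta) * h y \<le> - x" using x by (auto simp: mult.commute)
    then show ?thesis unfolding neg_divide_le_eq[OF n] using n by (simp add: divide_nonneg_neg)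
  qed
  moreover have "x + h y * (t - ta) = 0 \<longleftrightarrow> t = ta + ?t" for t using k by (auto simp: field_simps)
  ultimately have "{t \<in> {ta..tb}. x + h y * (t - ta) = 0} = {ta + ?t}" by (auto simp del: divide_minus_left)
  then show "exactly_zeros 1 (\<lambda>t. x + h y * (t - ta)) {ta..tb}" unfolding exactly_zeros_def by simp
  show "exactly_zeros 0 (\<lambda>_. y) {ta..tb}" using y(2) unfolding exactly_zeros_def by simp
qed

lemma linear_link:
  assumes t: "ta \<le> tb" and a: "oscillator_annulus \<rho>m \<rho>p h g mu c1 c2 xm xp"
    and z: "z \<in> annulus \<rho>m \<rho>p h g 0 mu c1 c2" "z' = (fst z + h (snd z) * (tb - ta), snd z)"
    and opposite: "fst z \<le> 0 \<and> 0 \<le> fst z' \<or> 0 \<le> fst z \<and> fst z' \<le> 0"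
  shows "\<exists>x y. piecewise_sol J h g (\<lambda>_. 0) ta tb x y \<and>
       (x ta, y ta) = z \<and> (x tb, y tb) = z' \<and> exactly_zeros 1 x {ta..tb} \<and> exactly_zeros 0 y {ta..tb}"
proof -
  interpret oscillator_annulus \<rho>m \<rho>p h g mu c1 c2 xm xp by (rule a)
  have J: "snd z \<in> J" using z(1) by (auto simp: annulus_def)
  \<comment> \<open>On the \<open>x\<close>-axis the shear is the identity; then
    \<open>opposite\<close> forces \<open>z\<close> to be the origin, whose energy is below
    \<open>c1\<close>.\<close>
  have "snd z \<noteq> 0"
  proof
    assume 0: "snd z = 0"
    then have "fst z = 0" using z(2) opposite h_0 by auto
    then show False using 0 z(1) energy_eq[of z] levels by (auto simp: annulus_def)
  qed
  then have "exactly_zeros 1 (\<lambda>t. fst z + h (snd z) * (t - ta)) {ta..tb}" "exactly_zeros 0 (\<lambda>_. snd z) {ta..tb}"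
    using linear_zeros[OF t J, of "fst z"] opposite z(2) by auto
  then show ?thesis using z(2) linear_sol[OF J, of ta tb "fst z"]
    by (intro exI[of _ "\<lambda>t. fst z + h (snd z) * (t - ta)"] exI[of _ "\<lambda>_. snd z"]) auto
qed

lemma H_le: "0 \<le> u \<Longrightarrow> u \<le> v \<Longrightarrow> v \<in> J \<Longrightarrow> H u \<le> H v"
  using H_less[of u v] by (cases "u = v") auto

lemma H_le': "v \<le> 0 \<Longrightarrow> u \<le> v \<Longrightarrow> u \<in> J \<Longrightarrow> H v \<le> H u"
  using H_less'[of v u] by (cases "u = v") auto

lemma G_inv_pos: assumes "0 \<le> v" "v \<le> G X" "0 \<le> X" shows "0 \<le> G_inv_pos g v" "G (G_inv_pos g v) = v"
proof -
  have "\<exists>x\<ge>0. x \<le> X \<and> G x = v" using assms by (intro IVT' G_cont) auto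
  then have "v \<in> G ` {0..}" by auto
  then show "0 \<le> G_inv_pos g v" "G (G_inv_pos g v) = v"
    using inv_into_into[of v G "{0..}"] f_inv_into_f[of v G "{0..}"] unfolding G_inv_pos_def by auto
qed

lemma G_inv_neg: assumes "0 \<le> v" "v \<le> G X" "X \<le> 0" shows "G_inv_neg g v \<le> 0" "G (G_inv_neg g v) = v"
proof -
  have "\<exists>x\<ge>X. x \<le> 0 \<and> G x = v" using assms by (intro IVT2' G_cont) auto
  then have "v \<in> G ` {..0}" by auto
  then show "G_inv_neg g v \<le> 0" "G (G_inv_neg g v) = v"
    using inv_into_into[of v G "{..0}"] f_inv_into_f[of v G "{..0}"] unfolding G_inv_neg_def by auto
qed

text \<open>\<open>H yb \<le> c1\<close> makes the path reach the height \<open>yb\<close>, and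
  \<open>H yb \<le> c1'\<close> keeps points sheared onto the \<open>y\<close>-axis up to this
  height from lying beyond the inner boundary of the next annulus. At height \<open>yb\<close> the
  first annulus extends to the left as far as \<open>X0\<close> and the next one to the right as far
  as \<open>X1\<close>; the transition condition says that the displacement
  \<open>h yb * ?\<sigma>\<close> is at least \<open>X1 - X0\<close>.\<close>

lemma linear_stage_II_I:
  assumes a0: "oscillator_annulus \<rho>m \<rho>p h g mu0 c1 c2 xm xp"
    and a1: "oscillator_annulus \<rho>m \<rho>p h g mu1 c1' c2' xm' xp'"
  defines "yb \<equiv> min (H_inv_pos \<rho>p h c1) (H_inv_pos \<rho>p h c1')"
  assumes t: "ta \<le> tb"
    and trans: "(G_inv_pos g ((c2' - H yb) / mu1) - G_inv_neg g ((c2 - H yb) / mu0)) / h yb \<le> tb - ta"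
    and q: "path q" "path_image q \<subseteq> annulus \<rho>m \<rho>p h g 0 mu0 c1 c2 \<inter> closed_quadrant QII"
      "snd (pathstart q) = 0" "fst (pathfinish q) = 0"
  shows "\<exists>r. path r \<and> path_image r \<subseteq> annulus \<rho>m \<rho>p h g 0 mu1 c1' c2' \<inter> closed_quadrant QI \<and>
    energy h g 0 mu1 (pathstart r) = c1' \<and> energy h g 0 mu1 (pathfinish r) = c2' \<and>
    (\<forall>z'\<in>path_image r. \<exists>z\<in>path_image q. \<exists>x y. piecewise_sol J h g (\<lambda>_. 0) ta tb x y \<and>
       (x ta, y ta) = z \<and> (x tb, y tb) = z' \<and> exactly_zeros 1 x {ta..tb} \<and> exactly_zeros 0 y {ta..tb})"
proof -
  interpret a0: oscillator_annulus \<rho>m \<rho>p h g mu0 c1 c2 xm xp by (rule a0)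
  interpret a1: oscillator_annulus \<rho>m \<rho>p h g mu1 c1' c2' xm' xp' by (rule a1)
  define Y where "Y = H_inv_pos \<rho>p h c2"
  let ?\<sigma> = "tb - ta"
  have star: "ereal c1 < H_star \<rho>m \<rho>p h" "ereal c1' < H_star \<rho>m \<rho>p h"
    using a0.levels a1.levels by (auto intro: less_trans[of "ereal c1" "ereal c2"] less_trans[of "ereal c1'" "ereal c2'"])
  note L = level_pos[OF a0.levels(1) star(1)] and L' = level_pos[OF a1.levels(1) star(2)]
  have Y: "Y \<in> J" "0 < Y" "H Y = c2" unfolding Y_def using a0.levels by (auto intro!: level_pos)
  have yb: "0 < yb" "yb \<in> J" unfolding yb_def using L L' by (auto simp: min_def)
  have Hyb: "H yb \<le> c1" "H yb \<le> c1'"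
    using H_le[of yb "H_inv_pos \<rho>p h c1"] H_le[of yb "H_inv_pos \<rho>p h c1'"] L L' yb unfolding yb_def by auto
  have ybY: "yb \<le> Y" using H_le[of Y yb] Y yb Hyb a0.levels by (cases "yb \<le> Y") auto
  have JY: "{0..Y} \<subseteq> J" using J_convex[OF J_0 Y(1)] .
  have hyb: "0 < h yb" using h_pos yb by auto
  define X0 X1 where "X0 = G_inv_neg g ((c2 - H yb) / mu0)" and "X1 = G_inv_pos g ((c2' - H yb) / mu1)"
  have "0 \<le> H yb" using a0.H_nonneg yb by auto
  have X0: "X0 \<le> 0" "mu0 * G X0 = c2 - H yb"
    using G_inv_neg[of "(c2 - H yb) / mu0" "xm c2"] a0.orbits[of c2] a0.levels a0.mu Hyb \<open>0 \<le> H yb\<close>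
    unfolding X0_def by (auto simp: field_simps)
  have X1: "0 \<le> X1" "mu1 * G X1 = c2' - H yb"
    using G_inv_pos[of "(c2' - H yb) / mu1" "xp' c2'"] a1.orbits[of c2'] a1.levels a1.mu Hyb \<open>0 \<le> H yb\<close>
    unfolding X1_def by (auto simp: field_simps)
  have shift: "X1 - X0 \<le> h yb * ?\<sigma>" using trans hyb unfolding X0_def X1_def by (simp add: divide_le_eq mult.commute)
  obtain r where r: "path r" "\<And>z'. z' \<in> path_image r \<Longrightarrow>
      0 \<le> fst z' \<and> snd z' \<in> {0..Y} \<and> H (snd z') + mu1 * G (fst z') \<in> {c1'..c2'} \<and>
      (\<exists>z\<in>path_image q. z' = (fst z + h (snd z) * ?\<sigma>, snd z))"
    "H (snd (pathstart r)) + mu1 * G (fst (pathstart r)) = c1'"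
    "H (snd (pathfinish r)) + mu1 * G (fst (pathfinish r)) = c2'"
  proof (rule linear_stretch[of q Y H "\<lambda>x. mu0 * G x" c1 c2 h "\<lambda>x. mu1 * G x" yb c1' c2' ?\<sigma>])
    show "path q" by (rule q(1))
    show "fst z \<le> 0 \<and> snd z \<in> {0..Y} \<and> H (snd z) + mu0 * G (fst z) \<in> {c1..c2}" if "z \<in> path_image q" for z
    proof -
      have z: "z \<in> annulus \<rho>m \<rho>p h g 0 mu0 c1 c2" "z \<in> closed_quadrant QII" using q(2) that by auto
      then show ?thesis using a0.ann_bounds(1)[OF z(1)] a0.energy_eq[of z] unfolding Y_def by (auto simp: annulus_def)
    qed
    show "continuous_on {0..Y} H" "continuous_on {0..Y} h"
      using continuous_on_subset[OF H_cont JY] continuous_on_subset[OF h_cont JY] .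
    show "strict_mono_on {0..Y} H" using H_less JY by (auto intro!: strict_mono_onI)
    show "continuous_on UNIV (\<lambda>x. mu1 * G x)" by (intro continuous_intros G_cont)
    fix x assume x: "x \<le> 0" "H yb + mu0 * G x \<le> c2"
    then have "mu0 * G x \<le> mu0 * G X0" using X0 by simp
    then have "G x \<le> G X0" using a0.mu by simp
    then have "X0 \<le> x" using G_less'[of X0 x] X0 by (cases "X0 \<le> x") auto
    then have X: "X1 \<le> x + h yb * ?\<sigma>" using shift by simp
    then have "G X1 \<le> G (x + h yb * ?\<sigma>)" using G_less[of X1 "x + h yb * ?\<sigma>"] X1 by (cases "X1 = x + h yb * ?\<sigma>") auto
    then have "mu1 * G X1 \<le> mu1 * G (x + h yb * ?\<sigma>)" using a1.mu by simp
    then show "0 \<le> x + h yb * ?\<sigma> \<and> c2' \<le> H yb + mu1 * G (x + h yb * ?\<sigma>)" using X X1 by auto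
  qed (use q h_0 yb ybY Hyb a1.levels in auto)
  show ?thesis
  proof (intro exI[of _ r] conjI ballI)
    show "path r" by (rule r(1))
    show "path_image r \<subseteq> annulus \<rho>m \<rho>p h g 0 mu1 c1' c2' \<inter> closed_quadrant QI"
    proof
      fix z assume z: "z \<in> path_image r"
      then show "z \<in> annulus \<rho>m \<rho>p h g 0 mu1 c1' c2' \<inter> closed_quadrant QI"
        using r(2)[OF z] JY a1.energy_eq[of z] by (auto simp: annulus_def)
    qed
    fix z' assume "z' \<in> path_image r"
    from r(2)[OF this] obtain z where z': "0 \<le> fst z'" and z: "z \<in> path_image q" "z' = (fst z + h (snd z) * ?\<sigma>, snd z)"
      by auto
    have zA: "z \<in> annulus \<rho>m \<rho>p h g 0 mu0 c1 c2" "fst z \<le> 0"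
      using q(2) z(1) by auto
    show "\<exists>z\<in>path_image q. \<exists>x y. piecewise_sol J h g (\<lambda>_. 0) ta tb x y \<and>
       (x ta, y ta) = z \<and> (x tb, y tb) = z' \<and> exactly_zeros 1 x {ta..tb} \<and> exactly_zeros 0 y {ta..tb}"
      using linear_link[OF t a0 zA(1) z(2)] zA(2) z' z(1) by blast
  qed (use r(3,4) a1.energy_eq in auto)
qed

text \<open>The point reflection \<open>uminus\<close> carries the quadrants IV and III to II and I,
  so \<open>linear_stretch\<close> applies to the reflected path with \<open>h\<close>,
  \<open>H\<close> and \<open>G\<close> reflected accordingly. The maximum of two negative heights
  is again the one nearer to the \<open>x\<close>-axis.\<close>

lemma linear_stage_IV_III:
  assumes a0: "oscillator_annulus \<rho>m \<rho>p h g mu0 c1 c2 xm xp"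
    and a1: "oscillator_annulus \<rho>m \<rho>p h g mu1 c1' c2' xm' xp'"
  defines "yb \<equiv> max (H_inv_neg \<rho>m h c1) (H_inv_neg \<rho>m h c1')"
  assumes t: "ta \<le> tb"
    and trans: "(G_inv_pos g ((c2 - H yb) / mu0) - G_inv_neg g ((c2' - H yb) / mu1)) / (- h yb) \<le> tb - ta"
    and q: "path q" "path_image q \<subseteq> annulus \<rho>m \<rho>p h g 0 mu0 c1 c2 \<inter> closed_quadrant QIV"
      "snd (pathstart q) = 0" "fst (pathfinish q) = 0"
  shows "\<exists>r. path r \<and> path_image r \<subseteq> annulus \<rho>m \<rho>p h g 0 mu1 c1' c2' \<inter> closed_quadrant QIII \<and>
    energy h g 0 mu1 (pathstart r) = c1' \<and> energy h g 0 mu1 (pathfinish r) = c2' \<and>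
    (\<forall>z'\<in>path_image r. \<exists>z\<in>path_image q. \<exists>x y. piecewise_sol J h g (\<lambda>_. 0) ta tb x y \<and>
       (x ta, y ta) = z \<and> (x tb, y tb) = z' \<and> exactly_zeros 1 x {ta..tb} \<and> exactly_zeros 0 y {ta..tb})"
proof -
  interpret a0: oscillator_annulus \<rho>m \<rho>p h g mu0 c1 c2 xm xp by (rule a0)
  interpret a1: oscillator_annulus \<rho>m \<rho>p h g mu1 c1' c2' xm' xp' by (rule a1)
  define Y where "Y = H_inv_neg \<rho>m h c2"
  let ?\<sigma> = "tb - ta"
  have star: "ereal c1 < H_star \<rho>m \<rho>p h" "ereal c1' < H_star \<rho>m \<rho>p h"
    using a0.levels a1.levels by (auto intro: less_trans[of "ereal c1" "ereal c2"] less_trans[of "ereal c1'" "ereal c2'"])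
  note L = level_neg[OF a0.levels(1) star(1)] and L' = level_neg[OF a1.levels(1) star(2)]
  have Y: "Y \<in> J" "Y < 0" "H Y = c2" unfolding Y_def using a0.levels by (auto intro!: level_neg)
  have yb: "yb < 0" "yb \<in> J" unfolding yb_def using L L' by (auto simp: max_def)
  have Hyb: "H yb \<le> c1" "H yb \<le> c1'"
    using H_le'[of yb "H_inv_neg \<rho>m h c1"] H_le'[of yb "H_inv_neg \<rho>m h c1'"] L L' yb unfolding yb_def by auto
  have ybY: "Y \<le> yb" using H_le'[of Y yb] Y yb Hyb a0.levels by (cases "Y \<le> yb") auto
  have JY: "{Y..0} \<subseteq> J" using J_convex[OF Y(1) J_0] .
  have hyb: "h yb < 0" using h_neg yb by auto
  define X0 X1 where "X0 = G_inv_pos g ((c2 - H yb) / mu0)" and "X1 = G_inv_neg g ((c2' - H yb) / mu1)"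
  have "0 \<le> H yb" using a0.H_nonneg yb by auto
  have X0: "0 \<le> X0" "mu0 * G X0 = c2 - H yb"
    using G_inv_pos[of "(c2 - H yb) / mu0" "xp c2"] a0.orbits[of c2] a0.levels a0.mu Hyb \<open>0 \<le> H yb\<close>
    unfolding X0_def by (auto simp: field_simps)
  have X1: "X1 \<le> 0" "mu1 * G X1 = c2' - H yb"
    using G_inv_neg[of "(c2' - H yb) / mu1" "xm' c2'"] a1.orbits[of c2'] a1.levels a1.mu Hyb \<open>0 \<le> H yb\<close>
    unfolding X1_def by (auto simp: field_simps)
  have "0 < - h yb" using hyb by simp
  from trans[unfolded pos_divide_le_eq[OF this]] have shift: "X0 - X1 \<le> - h yb * ?\<sigma>"
    unfolding X0_def X1_def by (simp add: mult.commute)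
  obtain r where r: "path r" "\<And>z'. z' \<in> path_image r \<Longrightarrow>
      0 \<le> fst z' \<and> snd z' \<in> {0..- Y} \<and> H (- snd z') + mu1 * G (- fst z') \<in> {c1'..c2'} \<and>
      (\<exists>z\<in>path_image (uminus \<circ> q). z' = (fst z + - h (- snd z) * ?\<sigma>, snd z))"
    "H (- snd (pathstart r)) + mu1 * G (- fst (pathstart r)) = c1'"
    "H (- snd (pathfinish r)) + mu1 * G (- fst (pathfinish r)) = c2'"
  proof (rule linear_stretch[of "uminus \<circ> q" "- Y" "\<lambda>y. H (- y)" "\<lambda>x. mu0 * G (- x)" c1 c2 "\<lambda>y. - h (- y)"
        "\<lambda>x. mu1 * G (- x)" "- yb" c1' c2' ?\<sigma>])
    show "path (uminus \<circ> q)" by (intro path_continuous_image q(1) continuous_intros)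
    show "fst z \<le> 0 \<and> snd z \<in> {0..- Y} \<and> H (- snd z) + mu0 * G (- fst z) \<in> {c1..c2}"
      if z: "z \<in> path_image (uminus \<circ> q)" for z
    proof -
      have "- z \<in> path_image q" using z by (auto simp: path_image_compose)
      then have z: "- z \<in> annulus \<rho>m \<rho>p h g 0 mu0 c1 c2" "- z \<in> closed_quadrant QIV" using q(2) by auto
      then show ?thesis using a0.ann_bounds(1)[OF z(1)] a0.energy_eq[of "- z"] unfolding Y_def
        by (auto simp: annulus_def case_prod_unfold)
    qed
    show "continuous_on {0..- Y} (\<lambda>y. H (- y))" "continuous_on {0..- Y} (\<lambda>y. - h (- y))"
      using JY by (auto intro!: continuous_intros continuous_on_compose2[OF H_cont] continuous_on_compose2[OF h_cont])
    show "strict_mono_on {0..- Y} (\<lambda>y. H (- y))"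
    proof (rule strict_mono_onI)
      fix u v assume "u \<in> {0..- Y}" "v \<in> {0..- Y}" "u < v"
      then show "H (- u) < H (- v)" using H_less'[of "- u" "- v"] subsetD[OF JY, of "- v"] by auto
    qed
    show "continuous_on UNIV (\<lambda>x. mu1 * G (- x))"
      by (intro continuous_intros continuous_on_compose2[OF G_cont[of UNIV]]) auto
    fix x assume x: "x \<le> 0" "H (- (- yb)) + mu0 * G (- x) \<le> c2"
    then have "mu0 * G (- x) \<le> mu0 * G X0" using X0 by simp
    then have "G (- x) \<le> G X0" using a0.mu by simp
    then have "- x \<le> X0" using G_less[of X0 "- x"] X0 by (cases "- x \<le> X0") auto
    then have X: "- (x - h yb * ?\<sigma>) \<le> X1" using shift by simp
    then have "G X1 \<le> G (- (x - h yb * ?\<sigma>))"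
      using G_less'[of X1 "- (x - h yb * ?\<sigma>)"] X1 by (cases "X1 = - (x - h yb * ?\<sigma>)") auto
    then have "mu1 * G X1 \<le> mu1 * G (- (x - h yb * ?\<sigma>))" using a1.mu by simp
    then show "0 \<le> x + - h (- (- yb)) * ?\<sigma> \<and> c2' \<le> H (- (- yb)) + mu1 * G (- (x + - h (- (- yb)) * ?\<sigma>))"
      using X X1 by auto
  qed (use q h_0 yb ybY Hyb a1.levels in \<open>auto simp: pathstart_compose pathfinish_compose\<close>)
  show ?thesis
  proof (intro exI[of _ "uminus \<circ> r"] conjI ballI)
    show "path (uminus \<circ> r)" by (intro path_continuous_image r(1) continuous_intros)
    show "path_image (uminus \<circ> r) \<subseteq> annulus \<rho>m \<rho>p h g 0 mu1 c1' c2' \<inter> closed_quadrant QIII"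
    proof
      fix z assume "z \<in> path_image (uminus \<circ> r)"
      then have z: "- z \<in> path_image r" by (auto simp: path_image_compose)
      show "z \<in> annulus \<rho>m \<rho>p h g 0 mu1 c1' c2' \<inter> closed_quadrant QIII"
        using r(2)[OF z] JY a1.energy_eq[of z] by (auto simp: annulus_def case_prod_unfold)
    qed
    fix z' assume "z' \<in> path_image (uminus \<circ> r)"
    then have "- z' \<in> path_image r" by (auto simp: path_image_compose)
    from r(2)[OF this] obtain w where z': "fst z' \<le> 0" and w: "w \<in> path_image (uminus \<circ> q)"
      "- z' = (fst w + - h (- snd w) * ?\<sigma>, snd w)" by auto
    define z where "z = - w"
    have z: "z \<in> path_image q" "z' = (fst z + h (snd z) * ?\<sigma>, snd z)"
      using w unfolding z_def by (auto simp: path_image_compose prod_eq_iff)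
    have zA: "z \<in> annulus \<rho>m \<rho>p h g 0 mu0 c1 c2" "0 \<le> fst z"
      using q(2) z(1) by auto
    show "\<exists>z\<in>path_image q. \<exists>x y. piecewise_sol J h g (\<lambda>_. 0) ta tb x y \<and>
       (x ta, y ta) = z \<and> (x tb, y tb) = z' \<and> exactly_zeros 1 x {ta..tb} \<and> exactly_zeros 0 y {ta..tb}"
      using linear_link[OF t a0 zA(1) z(2)] zA(2) z' z(1) by blast
  qed (use r(3,4) a1.energy_eq in \<open>auto simp: pathstart_compose pathfinish_compose\<close>)
qed

end

subsection \<open>Chains of annuli\<close>

lemma exactly_zeros_cong:
  assumes "\<And>t. t \<in> B \<Longrightarrow> f' t = f t" shows "exactly_zeros n f' B \<longleftrightarrow> exactly_zeros n f B"
proof -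
  have "{t \<in> B. f' t = 0} = {t \<in> B. f t = 0}" using assms by auto
  then show ?thesis unfolding exactly_zeros_def by simp
qed

text \<open>One choice of the nodal data \<open>\<kappa>\<close>, \<open>j\<close> and
  \<open>qL\<close> is fixed, with \<open>lam\<close> already set to zero; the theorem instantiates
  the locale for every choice.\<close>

locale nodal_bvp = oscillator +
  fixes m :: nat and t s \<mu> c1 c2 d e :: "nat \<Rightarrow> real" and a :: "real \<Rightarrow> real"
    and xm xp :: "nat \<Rightarrow> real \<Rightarrow> real" and r0 rL :: "(real \<times> real) set" and \<alpha> \<beta> j :: "nat \<Rightarrow> nat"
    and \<kappa> :: "nat \<Rightarrow> quadrant" and qL :: quadrant
  assumes grid: "t 0 = 0" "\<And>i. i \<le> m \<Longrightarrow> t i < s i" "\<And>i. i < m \<Longrightarrow> s i < t (Suc i)"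
    and ann: "\<And>i. i \<le> m \<Longrightarrow> oscillator_annulus \<rho>m \<rho>p h g (\<mu> i) (c1 i) (c2 i) (xm i) (xp i)"
    and weight_on: "\<And>i u. i \<le> m \<Longrightarrow> u \<in> {t i..s i} \<Longrightarrow> a u = \<mu> i"
    and weight_off: "\<And>i u. i < m \<Longrightarrow> u \<in> {s i<..<t (Suc i)} \<Longrightarrow> a u = 0"
    and arc_0: "annulus_arc \<rho>m \<rho>p h g 0 (\<mu> 0) (c1 0) (c2 0) r0" "r0 \<subseteq> closed_quadrant (\<kappa> 0)"
    and arc_L: "annulus_arc \<rho>m \<rho>p h g 0 (\<mu> m) (c1 m) (c2 m) rL" "rL \<subseteq> closed_quadrant qL"
    and de: "\<And>i. i \<le> m \<Longrightarrow> d i \<in> {c1 i, c2 i} \<and> e i \<in> {c1 i, c2 i} \<and> d i \<noteq> e i"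
    and twist_d: "\<And>i q. i \<le> m \<Longrightarrow> q \<in> {QI, QIII} \<Longrightarrow>
           quadrant_time \<rho>m \<rho>p h g 0 (\<mu> i) (xm i) (xp i) (qnext q) (d i) +
           quadrant_time \<rho>m \<rho>p h g 0 (\<mu> i) (xm i) (xp i) (qnext (qnext q)) (d i) +
           real (\<alpha> i) * period \<rho>m \<rho>p h g 0 (\<mu> i) (xm i) (xp i) (d i) > s i - t i"
    and twist_e: "\<And>i q. i \<le> m \<Longrightarrow> q \<in> {QI, QIII} \<Longrightarrow>
           quadrant_time \<rho>m \<rho>p h g 0 (\<mu> i) (xm i) (xp i) q (e i) +
           quadrant_time \<rho>m \<rho>p h g 0 (\<mu> i) (xm i) (xp i) (qnext q) (e i) +
           real (\<beta> i) * period \<rho>m \<rho>p h g 0 (\<mu> i) (xm i) (xp i) (e i) < s i - t i"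
    and transition: "\<And>i. i < m \<Longrightarrow>
           transition_II_I \<rho>p h g \<mu> c1 c2 i \<le> t (Suc i) - s i \<and>
           transition_IV_III \<rho>m h g \<mu> c1 c2 i \<le> t (Suc i) - s i"
    and \<kappa>: "\<And>i. i \<le> m \<Longrightarrow> \<kappa> i \<in> {QI, QIII}" and qL: "qL \<in> {QII, QIV}"
    and j: "\<And>i. i \<le> m \<Longrightarrow> 1 \<le> j i \<and> j i \<le> \<beta> i - \<alpha> i"
begin

definition region where
  "region i Q = annulus \<rho>m \<rho>p h g 0 (\<mu> i) (c1 i) (c2 i) \<inter> closed_quadrant Q"

text \<open>The quadrant in which interval \<open>i\<close> of positive weight has to end. The shear
  preserves \<open>y\<close> and has to lead from II to I or from IV to III, so it is the
  predecessor of the next starting quadrant.\<close>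

definition target where "target i = (if i < m then qprev (\<kappa> (Suc i)) else qL)"

definition xz where "xz i = (if target i = qprev (\<kappa> i) then 2 * (\<alpha> i + j i) - 1 else 2 * (\<alpha> i + j i))"
definition yz where "yz i = (if target i = qprev (\<kappa> i) then 2 * (\<alpha> i + j i) else 2 * (\<alpha> i + j i) + 1)"

text \<open>Partial solutions up to time \<open>b\<close>, with \<open>k\<close> the index of the
  last starting time recorded and \<open>l\<close> the number of intervals of positive weight
  completed. The chain alternates between \<open>nodal i i (t i)\<close> and
  \<open>nodal i (Suc i) (s i)\<close>.\<close>

definition nodal where
  "nodal k l b x y \<longleftrightarrow> piecewise_sol J h g a 0 b x y \<and> (x 0, y 0) \<in> r0 \<and>
     (\<forall>i\<le>k. (x (t i), y (t i)) \<in> region i (\<kappa> i)) \<and>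
     (\<forall>i<l. exactly_zeros (xz i) x {t i<..<s i} \<and> exactly_zeros (yz i) y {t i..s i}) \<and>
     (\<forall>i<k. exactly_zeros 1 x {s i..t (Suc i)} \<and> exactly_zeros 0 y {s i..t (Suc i)})"

lemma t_mono: "i \<le> k \<Longrightarrow> k \<le> m \<Longrightarrow> t i \<le> t k"
proof (induction k)
  case (Suc k)
  then show ?case using grid(2)[of k] grid(3)[of k] by (cases "i = Suc k") auto
qed simp

lemma t_nonneg: "i \<le> m \<Longrightarrow> 0 \<le> t i" using t_mono[of 0 i] grid(1) by simp

lemma s_le_t: "i < k \<Longrightarrow> k \<le> m \<Longrightarrow> s i \<le> t k"
  using t_mono[of "Suc i" k] grid(3)[of i] by simp

lemma target: assumes "i \<le> m" shows "target i = qprev (\<kappa> i) \<or> target i = qnext (\<kappa> i)"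
  using \<kappa>[OF assms] \<kappa>[of "Suc i"] qL assms unfolding target_def by (cases "i < m") auto

text \<open>Every property recorded so far concerns times up to \<open>b\<close>, where the joined
  functions agree with the old ones.\<close>

lemma nodal_join:
  assumes n: "nodal k l b x y" and kl: "k \<le> m" "l \<le> Suc k" "t k \<le> b" "0 < l \<Longrightarrow> s (l - 1) \<le> b" "b \<le> b'"
    and u: "piecewise_sol J h g a b b' u v" "x b = u b" "y b = v b"
  defines "x' \<equiv> \<lambda>r. if r \<le> b then x r else u r" and "y' \<equiv> \<lambda>r. if r \<le> b then y r else v r"
  shows "nodal k l b' x' y'" "\<And>r. r \<in> {b..b'} \<Longrightarrow> x' r = u r \<and> y' r = v r"
proof -
  have b: "0 \<le> b" using t_nonneg[OF kl(1)] kl(3) by simp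
  have eq: "x' r = x r" "y' r = y r" if "r \<le> b" for r using that unfolding x'_def y'_def by auto
  have tb: "t i \<le> b" if "i \<le> k" for i using t_mono[OF that kl(1)] kl(3) by simp
  have sb: "s i \<le> b" if "i < l" for i
  proof (cases "i = l - 1")
    case False
    then have "i < k" using that kl(2) by simp
    then show ?thesis using s_le_t[of i k] kl by simp
  qed (use that kl(4) in auto)
  have "piecewise_sol J h g a 0 b' x' y'"
    unfolding x'_def y'_def by (rule piecewise_sol_join) (use n u b kl in \<open>auto simp: nodal_def\<close>)
  moreover have "exactly_zeros (xz i) x' {t i<..<s i} \<and> exactly_zeros (yz i) y' {t i..s i}" if "i < l" for i
    using n that sb[OF that] exactly_zeros_cong[of "{t i<..<s i}" x' x] exactly_zeros_cong[of "{t i..s i}" y' y]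
    by (auto simp: nodal_def eq)
  moreover have "exactly_zeros 1 x' {s i..t (Suc i)} \<and> exactly_zeros 0 y' {s i..t (Suc i)}" if "i < k" for i
    using n that tb[of "Suc i"] exactly_zeros_cong[of "{s i..t (Suc i)}" x' x] exactly_zeros_cong[of "{s i..t (Suc i)}" y' y]
    by (auto simp: nodal_def eq)
  ultimately show "nodal k l b' x' y'" using n b tb unfolding nodal_def by (auto simp: eq)
  show "x' r = u r \<and> y' r = v r" if "r \<in> {b..b'}" for r
    using that u(2,3) unfolding x'_def y'_def by auto
qed

text \<open>Either boundary may be the slow one; if necessary, reversing the path makes it start at
  the slow energy \<open>d i\<close>.\<close>

lemma energy_ends:
  assumes "i \<le> m" "path p" "path_image p \<subseteq> X" "{energy h g 0 (\<mu> i) (pathstart p), energy h g 0 (\<mu> i) (pathfinish p)} = {c1 i, c2 i}"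
  obtains p' where "path p'" "path_image p' \<subseteq> X" "path_image p' = path_image p"
    "energy h g 0 (\<mu> i) (pathstart p') = d i" "energy h g 0 (\<mu> i) (pathfinish p') = e i"
proof -
  have "d i = c1 i \<and> e i = c2 i \<or> d i = c2 i \<and> e i = c1 i" using de[OF assms(1)] by auto
  then have "{d i, e i} = {c1 i, c2 i}" by (elim disjE conjE) (simp_all add: insert_commute)
  then have "{energy h g 0 (\<mu> i) (pathstart p), energy h g 0 (\<mu> i) (pathfinish p)} = {d i, e i}" using assms(4) by simp
  then have "energy h g 0 (\<mu> i) (pathstart p) = d i \<and> energy h g 0 (\<mu> i) (pathfinish p) = e i \<or>
    energy h g 0 (\<mu> i) (pathstart p) = e i \<and> energy h g 0 (\<mu> i) (pathfinish p) = d i"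
    unfolding doubleton_eq_iff .
  then show ?thesis
  proof
    assume "energy h g 0 (\<mu> i) (pathstart p) = d i \<and> energy h g 0 (\<mu> i) (pathfinish p) = e i"
    then show ?thesis using that[of p] assms(2,3) by simp
  next
    assume "energy h g 0 (\<mu> i) (pathstart p) = e i \<and> energy h g 0 (\<mu> i) (pathfinish p) = d i"
    then show ?thesis using that[of "reversepath p"] assms(2,3) by simp
  qed
qed

lemma nonlinear_step:
  assumes i: "i \<le> m" and p: "path p" "path_image p \<subseteq> region i (\<kappa> i)"
    and ends: "{energy h g 0 (\<mu> i) (pathstart p), energy h g 0 (\<mu> i) (pathfinish p)} = {c1 i, c2 i}"
    and nod: "\<And>z. z \<in> path_image p \<Longrightarrow> \<exists>x y. nodal i i (t i) x y \<and> (x (t i), y (t i)) = z"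
  shows "\<exists>q. path q \<and> path_image q \<subseteq> region i (target i) \<and> snd (pathstart q) = 0 \<and> fst (pathfinish q) = 0 \<and>
    (\<forall>z\<in>path_image q. \<exists>x y. nodal i (Suc i) (s i) x y \<and> (x (s i), y (s i)) = z)"
proof -
  interpret ai: oscillator_annulus \<rho>m \<rho>p h g "\<mu> i" "c1 i" "c2 i" "xm i" "xp i" by (rule ann[OF i])
  obtain p' where p': "path p'" "path_image p' \<subseteq> region i (\<kappa> i)" "path_image p' = path_image p"
    "energy h g 0 (\<mu> i) (pathstart p') = d i" "energy h g 0 (\<mu> i) (pathfinish p') = e i"
    by (rule energy_ends[OF i p ends]) (rule that)
  define k0 :: nat where "k0 = (if \<kappa> i = QI then 0 else 2)"
  have k0: "quad k0 = \<kappa> i" "even k0" using \<kappa>[OF i] unfolding k0_def by (auto simp: numeral_2_eq_2)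
  \<comment> \<open>The \<open>j i\<close>-th admissible number in the target quadrant: counting
    starts at \<open>k0 + 3 + 4 * \<alpha> i\<close> for the predecessor quadrant and at
    \<open>k0 + 5 + 4 * \<alpha> i\<close> for the successor. The truncated subtraction is exact
    since \<open>1 \<le> j i\<close>.\<close>
  define n where "n = (if target i = qprev (\<kappa> i) then k0 + 3 + 4 * (\<alpha> i + j i - 1) else k0 + 1 + 4 * (\<alpha> i + j i))"
  have qn: "quad n = target i"
  proof (cases "target i = qprev (\<kappa> i)")
    case True
    then have n: "n = k0 + 3 + 4 * (\<alpha> i + j i - 1)" unfolding n_def by simp
    have "quad (k0 + 3) = qprev (quad k0)" by (cases "quad k0") (auto simp: numeral_3_eq_3)
    then show ?thesis unfolding n quad_add_mult_4 using True k0 by simp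
  next
    case False
    then have n: "n = k0 + 1 + 4 * (\<alpha> i + j i)" unfolding n_def by simp
    show ?thesis unfolding n quad_add_mult_4 using False k0 target[OF i] by auto
  qed
  have odd: "odd n" using k0(2) unfolding n_def by auto
  have j': "1 \<le> j i" "j i \<le> \<beta> i - \<alpha> i" using j[OF i] by auto
  have n_bounds: "k0 + 3 + 4 * \<alpha> i \<le> n" "n \<le> k0 + 1 + 4 * \<beta> i" using j' unfolding n_def by (auto split: if_splits)
  have counts: "(n - 1 - k0) div 2 = xz i" "(n + 1 - k0) div 2 = yz i"
    using j' unfolding n_def xz_def yz_def by auto
  have im: "path_image p' \<subseteq> ai.ann \<inter> closed_quadrant (quad k0)" using p'(2) k0(1) unfolding region_def by simp
  have lev: "d i \<in> {c1 i..c2 i}" "e i \<in> {c1 i..c2 i}" using de[OF i] ai.levels by auto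
  obtain q where q: "path q" "path_image q \<subseteq> ai.ann \<inter> closed_quadrant (quad n)"
    "snd (pathstart q) = 0" "fst (pathfinish q) = 0"
    "\<And>z'. z' \<in> path_image q \<Longrightarrow> \<exists>z\<in>path_image p'. \<exists>x y. piecewise_sol J h g (\<lambda>_. \<mu> i) (t i) (s i) x y \<and>
       (x (t i), y (t i)) = z \<and> (x (s i), y (s i)) = z' \<and>
       exactly_zeros ((n - 1 - k0) div 2) x {t i<..<s i} \<and> exactly_zeros ((n + 1 - k0) div 2) y {t i..s i}"
    by (rule ai.nonlinear_stage[OF p'(1) im k0(2) odd n_bounds p'(4,5) lev
        twist_d[OF i \<kappa>[OF i], folded k0(1)] twist_e[OF i \<kappa>[OF i], folded k0(1)]]) (rule that)
  show ?thesis
  proof (intro exI[of _ q] conjI ballI)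
    show "path_image q \<subseteq> region i (target i)" using q(2) qn unfolding region_def by simp
    fix z' assume "z' \<in> path_image q"
    from q(5)[OF this] obtain u v where uv: "(u (t i), v (t i)) \<in> path_image p"
      "piecewise_sol J h g (\<lambda>_. \<mu> i) (t i) (s i) u v" "(u (s i), v (s i)) = z'"
      "exactly_zeros (xz i) u {t i<..<s i}" "exactly_zeros (yz i) v {t i..s i}"
      unfolding counts p'(3) by auto
    obtain x y where xy: "nodal i i (t i) x y" "(x (t i), y (t i)) = (u (t i), v (t i))"
      using nod[OF uv(1)] by auto
    have sol: "piecewise_sol J h g a (t i) (s i) u v"
      by (rule piecewise_sol_cong[OF uv(2)]) (use weight_on[OF i] in auto)
    have ts: "t i \<le> s i" using grid(2)[OF i] by simp
    have pre: "s (i - 1) \<le> t i" if "0 < i" using s_le_t[of "i - 1" i] that i by simp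
    let ?x = "\<lambda>r. if r \<le> t i then x r else u r" and ?y = "\<lambda>r. if r \<le> t i then y r else v r"
    have J: "nodal i i (s i) ?x ?y" "\<And>r. r \<in> {t i..s i} \<Longrightarrow> ?x r = u r \<and> ?y r = v r"
      using nodal_join[OF xy(1) i _ _ pre ts sol] xy(2) by auto
    have "exactly_zeros (xz i) ?x {t i<..<s i}" "exactly_zeros (yz i) ?y {t i..s i}"
      using uv(4,5) exactly_zeros_cong[of "{t i<..<s i}" ?x u] exactly_zeros_cong[of "{t i..s i}" ?y v] J(2) by auto
    then have "nodal i (Suc i) (s i) ?x ?y" using J(1) unfolding nodal_def by (auto simp: less_Suc_eq)
    moreover have "(?x (s i), ?y (s i)) = z'" using J(2)[of "s i"] ts uv(3) by auto
    ultimately show "\<exists>x y. nodal i (Suc i) (s i) x y \<and> (x (s i), y (s i)) = z'" by blast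
  qed (use q(1,3,4) in auto)
qed

lemma linear_step:
  assumes i: "i < m" and q: "path q" "path_image q \<subseteq> region i (target i)"
    "snd (pathstart q) = 0" "fst (pathfinish q) = 0"
    and nod: "\<And>z. z \<in> path_image q \<Longrightarrow> \<exists>x y. nodal i (Suc i) (s i) x y \<and> (x (s i), y (s i)) = z"
  shows "\<exists>p. path p \<and> path_image p \<subseteq> region (Suc i) (\<kappa> (Suc i)) \<and>
    {energy h g 0 (\<mu> (Suc i)) (pathstart p), energy h g 0 (\<mu> (Suc i)) (pathfinish p)} = {c1 (Suc i), c2 (Suc i)} \<and>
    (\<forall>z\<in>path_image p. \<exists>x y. nodal (Suc i) (Suc i) (t (Suc i)) x y \<and> (x (t (Suc i)), y (t (Suc i))) = z)"
proof -
  have i': "i \<le> m" "Suc i \<le> m" using i by auto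
  have st: "s i \<le> t (Suc i)" using grid(3)[OF i] by simp
  have "\<exists>r. path r \<and> path_image r \<subseteq> region (Suc i) (\<kappa> (Suc i)) \<and>
    energy h g 0 (\<mu> (Suc i)) (pathstart r) = c1 (Suc i) \<and> energy h g 0 (\<mu> (Suc i)) (pathfinish r) = c2 (Suc i) \<and>
    (\<forall>z'\<in>path_image r. \<exists>z\<in>path_image q. \<exists>x y. piecewise_sol J h g (\<lambda>_. 0) (s i) (t (Suc i)) x y \<and>
       (x (s i), y (s i)) = z \<and> (x (t (Suc i)), y (t (Suc i))) = z' \<and>
       exactly_zeros 1 x {s i..t (Suc i)} \<and> exactly_zeros 0 y {s i..t (Suc i)})"
    (is "\<exists>r. ?r1 r \<and> ?r2 r \<and> ?r3 r \<and> ?r4 r \<and> ?r5 r")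
  proof (cases "\<kappa> (Suc i) = QI")
    case True
    then have "target i = QII" using i unfolding target_def by simp
    then show ?thesis
      using linear_stage_II_I[OF ann[OF i'(1)] ann[OF i'(2)] st _ q(1) _ q(3,4)] transition[OF i, THEN conjunct1] q(2)
      unfolding True region_def transition_II_I_def Let_def by auto
  next
    case False
    then have \<kappa>3: "\<kappa> (Suc i) = QIII" using \<kappa>[OF i'(2)] by auto
    then have "target i = QIV" using i unfolding target_def by simp
    then show ?thesis
      using linear_stage_IV_III[OF ann[OF i'(1)] ann[OF i'(2)] st _ q(1) _ q(3,4)] transition[OF i, THEN conjunct2] q(2)
      unfolding \<kappa>3 region_def transition_IV_III_def Let_def by auto
  qed
  then obtain r where r: "?r1 r" "?r2 r" "?r3 r" "?r4 r" "?r5 r" by blast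
  show ?thesis
  proof (intro exI[of _ r] conjI ballI)
    fix z' assume z': "z' \<in> path_image r"
    from r(5)[rule_format, OF this] obtain u v where uv: "(u (s i), v (s i)) \<in> path_image q"
      "piecewise_sol J h g (\<lambda>_. 0) (s i) (t (Suc i)) u v" "(u (t (Suc i)), v (t (Suc i))) = z'"
      "exactly_zeros 1 u {s i..t (Suc i)}" "exactly_zeros 0 v {s i..t (Suc i)}" by auto
    obtain x y where xy: "nodal i (Suc i) (s i) x y" "(x (s i), y (s i)) = (u (s i), v (s i))"
      using nod[OF uv(1)] by auto
    have sol: "piecewise_sol J h g a (s i) (t (Suc i)) u v"
      by (rule piecewise_sol_cong[OF uv(2)]) (use weight_off[OF i] in auto)
    have ts: "t i \<le> s i" using grid(2)[OF i'(1)] by simp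
    let ?x = "\<lambda>r. if r \<le> s i then x r else u r" and ?y = "\<lambda>r. if r \<le> s i then y r else v r"
    have J: "nodal i (Suc i) (t (Suc i)) ?x ?y" "\<And>r. r \<in> {s i..t (Suc i)} \<Longrightarrow> ?x r = u r \<and> ?y r = v r"
      using nodal_join[OF xy(1) i'(1) _ ts _ st sol] xy(2) by auto
    have "exactly_zeros 1 ?x {s i..t (Suc i)}" "exactly_zeros 0 ?y {s i..t (Suc i)}"
      using uv(4,5) exactly_zeros_cong[of "{s i..t (Suc i)}" ?x u] exactly_zeros_cong[of "{s i..t (Suc i)}" ?y v] J(2) by auto
    moreover have eq: "(?x (t (Suc i)), ?y (t (Suc i))) = z'" using J(2)[of "t (Suc i)"] st uv(3) by auto
    moreover have "z' \<in> region (Suc i) (\<kappa> (Suc i))" using r(2) z' by auto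
    ultimately have "nodal (Suc i) (Suc i) (t (Suc i)) ?x ?y"
      using J(1) unfolding nodal_def by (auto simp: less_Suc_eq le_Suc_eq simp del: split_paired_All)
    then show "\<exists>x y. nodal (Suc i) (Suc i) (t (Suc i)) x y \<and> (x (t (Suc i)), y (t (Suc i))) = z'" using eq by blast
  qed (use r(1-4) in auto)
qed

text \<open>The invariant of the chain: a path that joins the two boundaries, in either direction,
  inside the prescribed quadrant, and each point of which is reached by a solution with the
  prescribed past.\<close>

lemma nodal_path:
  "i \<le> m \<Longrightarrow> \<exists>p. path p \<and> path_image p \<subseteq> region i (\<kappa> i) \<and>
    {energy h g 0 (\<mu> i) (pathstart p), energy h g 0 (\<mu> i) (pathfinish p)} = {c1 i, c2 i} \<and>
    (\<forall>z\<in>path_image p. \<exists>x y. nodal i i (t i) x y \<and> (x (t i), y (t i)) = z)"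
proof (induction i)
  case 0
  obtain \<gamma> where \<gamma>: "arc \<gamma>" "path_image \<gamma> = r0" "energy h g 0 (\<mu> 0) (pathstart \<gamma>) = c1 0"
    "energy h g 0 (\<mu> 0) (pathfinish \<gamma>) = c2 0" "r0 \<subseteq> annulus \<rho>m \<rho>p h g 0 (\<mu> 0) (c1 0) (c2 0)"
    using arc_0(1) unfolding annulus_arc_def by auto
  have r0: "r0 \<subseteq> region 0 (\<kappa> 0)" using \<gamma>(5) arc_0(2) unfolding region_def by auto
  show ?case
  proof (intro exI[of _ \<gamma>] conjI ballI)
    fix z assume z: "z \<in> path_image \<gamma>"
    \<comment> \<open>At \<open>t 0 = 0\<close> the time interval is a single point, so constant
      functions are solutions on it.\<close>
    have "nodal 0 0 (t 0) (\<lambda>_. fst z) (\<lambda>_. snd z)"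
      using z \<gamma>(2) r0 \<gamma>(5) grid(1) unfolding nodal_def piecewise_sol_def
      by (auto intro!: exI[of _ "{}"] simp: annulus_def)
    then show "\<exists>x y. nodal 0 0 (t 0) x y \<and> (x (t 0), y (t 0)) = z"
      by (intro exI[of _ "\<lambda>_. fst z"] exI[of _ "\<lambda>_. snd z"]) auto
  qed (use \<gamma> r0 in \<open>auto simp: arc_imp_path\<close>)
next
  case (Suc i)
  then have i: "i \<le> m" "i < m" by auto
  then obtain p where "path p" "path_image p \<subseteq> region i (\<kappa> i)"
    "{energy h g 0 (\<mu> i) (pathstart p), energy h g 0 (\<mu> i) (pathfinish p)} = {c1 i, c2 i}"
    "\<forall>z\<in>path_image p. \<exists>x y. nodal i i (t i) x y \<and> (x (t i), y (t i)) = z" using Suc.IH by auto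
  from nonlinear_step[OF i(1) this(1-3)] this(4)
  obtain q where "path q" "path_image q \<subseteq> region i (target i)" "snd (pathstart q) = 0" "fst (pathfinish q) = 0"
    "\<forall>z\<in>path_image q. \<exists>x y. nodal i (Suc i) (s i) x y \<and> (x (s i), y (s i)) = z" by auto
  from linear_step[OF i(2) this(1-4)] this(5) show ?case by auto
qed

lemma nodal_solution: "\<exists>x y. nodal m (Suc m) (s m) x y \<and> (x (s m), y (s m)) \<in> rL"
proof -
  interpret am: oscillator_annulus \<rho>m \<rho>p h g "\<mu> m" "c1 m" "c2 m" "xm m" "xp m" by (rule ann) simp
  obtain p where "path p" "path_image p \<subseteq> region m (\<kappa> m)"
    "{energy h g 0 (\<mu> m) (pathstart p), energy h g 0 (\<mu> m) (pathfinish p)} = {c1 m, c2 m}"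
    "\<forall>z\<in>path_image p. \<exists>x y. nodal m m (t m) x y \<and> (x (t m), y (t m)) = z" using nodal_path[of m] by auto
  from nonlinear_step[OF order_refl this(1-3)] this(4)
  obtain q where q: "path q" "path_image q \<subseteq> region m (target m)" "snd (pathstart q) = 0" "fst (pathfinish q) = 0"
    "\<forall>z\<in>path_image q. \<exists>x y. nodal m (Suc m) (s m) x y \<and> (x (s m), y (s m)) = z" by auto
  have "target m = qL" by (simp add: target_def)
  then obtain z where "z \<in> path_image q" "z \<in> rL"
    using am.final_crossing[OF q(1) _ q(3,4) arc_L] q(2) unfolding region_def by auto
  moreover from this(1) q(5) obtain x y where "nodal m (Suc m) (s m) x y" "(x (s m), y (s m)) = z" by blast
  ultimately show ?thesis by (intro exI[of _ x] exI[of _ y]) simp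
qed

text \<open>The sum is a crude bound for the largest weight; some bound is needed to make
  \<open>y\<close> Lipschitz.\<close>

lemma weight_bounded: "u \<in> {0..s m} \<Longrightarrow> \<bar>a u\<bar> \<le> (\<Sum>i\<le>m. \<mu> i)"
proof -
  assume u: "u \<in> {0..s m}"
  have mu: "0 \<le> \<mu> i" if "i \<le> m" for i
    using oscillator_annulus.mu[OF ann[OF that]] by simp
  have "\<exists>i\<le>k. u \<in> {t i..s i} \<or> (i < k \<and> u \<in> {s i<..<t (Suc i)})" if "k \<le> m" "u \<le> s k" for k
    using that
  proof (induction k)
    case 0 then show ?case using u grid(1) by auto
  next
    case (Suc k)
    show ?case
    proof (cases "u \<le> s k")
      case True then show ?thesis using Suc by (meson Suc_leD le_SucI less_SucI)
    next
      case False
      show ?thesis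
      proof (cases "u < t (Suc k)")
        case True then show ?thesis using False by (intro exI[of _ k]) auto
      next
        case not_less: False then show ?thesis using Suc.prems by (intro exI[of _ "Suc k"]) auto
      qed
    qed
  qed
  from this[of m] u obtain i where "i \<le> m" "u \<in> {t i..s i} \<or> (i < m \<and> u \<in> {s i<..<t (Suc i)})" by auto
  then have "a u = \<mu> i \<or> a u = 0" using weight_on weight_off by auto
  moreover have "\<mu> i \<le> (\<Sum>i\<le>m. \<mu> i)" using \<open>i \<le> m\<close> mu by (intro member_le_sum) auto
  ultimately show "\<bar>a u\<bar> \<le> (\<Sum>i\<le>m. \<mu> i)" using mu[OF \<open>i \<le> m\<close>] by auto
qed

lemma bvp_nodal_solution:
  "\<exists>(x, y) \<in> bvp_solutions \<rho>m \<rho>p h g 0 a (s m) r0 rL.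
     (\<forall>i\<le>m. (x (t i), y (t i)) \<in> region i (\<kappa> i)) \<and>
     (\<forall>i\<le>m. exactly_zeros (xz i) x {t i<..<s i} \<and> exactly_zeros (yz i) y {t i..s i}) \<and>
     (\<forall>i<m. exactly_zeros 1 x {s i..t (Suc i)} \<and> exactly_zeros 0 y {s i..t (Suc i)})"
proof -
  obtain x y where xy: "nodal m (Suc m) (s m) x y" "(x (s m), y (s m)) \<in> rL" using nodal_solution by auto
  have tm: "0 \<le> t m" "t m \<le> s m" using t_nonneg[of m] grid(2)[of m] by auto
  \<comment> \<open>\<open>bvp_solutions\<close> consists of extensional functions, hence the
    restriction.\<close>
  define x' y' where "x' = restrict x {0..s m}" and "y' = restrict y {0..s m}"
  have eq: "x' r = x r" "y' r = y r" if "r \<in> {0..s m}" for r using that unfolding x'_def y'_def by auto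
  have "piecewise_sol J h g a 0 (s m) x y" using xy(1) by (simp add: nodal_def)
  then have "piecewise_sol J h g a 0 (s m) x' y'" by (rule piecewise_sol_cong) (use eq in auto)
  then have "caratheodory_sol \<rho>m \<rho>p h g 0 a 0 (s m) x' y'"
    by (rule piecewise_sol_caratheodory[OF _ h_cont g_cont weight_bounded])
  then have "(x', y') \<in> bvp_solutions \<rho>m \<rho>p h g 0 a (s m) r0 rL"
    unfolding bvp_solutions_def using xy tm eq by (auto simp: nodal_def x'_def y'_def)
  moreover have ts: "{t i..s i} \<subseteq> {0..s m}" "{t i<..<s i} \<subseteq> {0..s m}" if "i \<le> m" for i
    using t_nonneg[OF that] s_le_t[of i m] tm that by (cases "i = m"; fastforce)+
  have st: "{s i..t (Suc i)} \<subseteq> {0..s m}" if "i < m" for i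
    using t_nonneg[of i] t_mono[of "Suc i" m] tm that grid(2)[of i] by fastforce
  have "exactly_zeros n x' B \<longleftrightarrow> exactly_zeros n x B" "exactly_zeros n y' B \<longleftrightarrow> exactly_zeros n y B" if "B \<subseteq> {0..s m}" for n B
    using that eq by (auto intro!: exactly_zeros_cong)
  note cong = this[OF ts(1)] this[OF ts(2)] this[OF st]
  have "t i \<in> {0..s m}" if "i \<le> m" for i using ts(1)[OF that] grid(2)[OF that] by auto
  ultimately show ?thesis using xy(1) unfolding nodal_def
    by (intro bexI[of _ "(x', y')"]) (auto simp: cong eq less_Suc_eq_le)
qed

end

section \<open>Distinct solutions from distinct nodal data\<close>

theorem theorem6p1:
  fixes m :: nat and t s \<mu> c1 c2 d e :: "nat \<Rightarrow> real" and L lam :: real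
    and a h g :: "real \<Rightarrow> real" and \<rho>m \<rho>p :: ereal
    and xm xp :: "nat \<Rightarrow> real \<Rightarrow> real"
    and r0 rL :: "(real \<times> real) set"
    and \<alpha> \<beta> :: "nat \<Rightarrow> nat"
  assumes m: "1 \<le> m"
    and grid: "t 0 = 0" "s m = L" "\<And>i. i \<le> m \<Longrightarrow> t i < s i" "\<And>i. i < m \<Longrightarrow> s i < t (Suc i)"
    and mu_pos: "\<And>i. i \<le> m \<Longrightarrow> 0 < \<mu> i"
    and weight_on: "\<And>i u. i \<le> m \<Longrightarrow> u \<in> {t i..s i} \<Longrightarrow> a u = \<mu> i"
    and weight_off: "\<And>i u. i < m \<Longrightarrow> u \<in> {s i<..<t (Suc i)} \<Longrightarrow> a u = 0"
    and rho: "\<rho>m < 0" "0 < \<rho>p"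
    and h_homeo: "\<exists>\<phi> \<sigma>m \<sigma>p. \<sigma>m < (0::ereal) \<and> 0 < \<sigma>p \<and>
           homeomorphism (einterval \<sigma>m \<sigma>p) (einterval \<rho>m \<rho>p) \<phi> h \<and>
           strict_mono_on (einterval \<sigma>m \<sigma>p) \<phi>"
    and h_0: "h 0 = 0"
    and g: "continuous_on UNIV g" "g 0 = 0" "\<And>u. u \<noteq> 0 \<Longrightarrow> 0 < g u * u"
    and unique_N: "\<And>i. i \<le> m \<Longrightarrow> ivp_uniqueness \<rho>m \<rho>p h g lam (\<lambda>_. \<mu> i)"
    and unique_L: "ivp_uniqueness \<rho>m \<rho>p h g lam (\<lambda>_. 0)"
    and levels: "\<And>i. i \<le> m \<Longrightarrow> 0 < c1 i \<and> c1 i < c2 i \<and> ereal (c2 i) < H_star \<rho>m \<rho>p h"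
    and orbits: "\<And>i c. i \<le> m \<Longrightarrow> c \<in> {c1 i..c2 i} \<Longrightarrow>
           xm i c < 0 \<and> 0 < xp i c \<and>
           potential g lam (\<mu> i) (xm i c) = c \<and> potential g lam (\<mu> i) (xp i c) = c \<and>
           (\<forall>u\<in>{xm i c<..<xp i c}. potential g lam (\<mu> i) u < c) \<and>
           deriv (potential g lam (\<mu> i)) (xm i c) < 0 \<and>
           0 < deriv (potential g lam (\<mu> i)) (xp i c)"
    and arc_0: "annulus_arc \<rho>m \<rho>p h g lam (\<mu> 0) (c1 0) (c2 0) r0"
    and arc_L: "annulus_arc \<rho>m \<rho>p h g lam (\<mu> m) (c1 m) (c2 m) rL"
    and lambda_0: "lam = 0"
    and quadrant_0: "r0 \<subseteq> closed_quadrant QI \<or> r0 \<subseteq> closed_quadrant QIII"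
    and quadrant_L: "rL \<subseteq> closed_quadrant QII \<or> rL \<subseteq> closed_quadrant QIV"
    and de: "\<And>i. i \<le> m \<Longrightarrow> d i \<in> {c1 i, c2 i} \<and> e i \<in> {c1 i, c2 i} \<and> d i \<noteq> e i"
    and alpha_beta: "\<And>i. i \<le> m \<Longrightarrow> \<alpha> i < \<beta> i"
    and twist_d: "\<And>i \<kappa>. i \<le> m \<Longrightarrow> \<kappa> \<in> {QI, QIII} \<Longrightarrow>
           quadrant_time \<rho>m \<rho>p h g lam (\<mu> i) (xm i) (xp i) (qnext \<kappa>) (d i) +
           quadrant_time \<rho>m \<rho>p h g lam (\<mu> i) (xm i) (xp i) (qnext (qnext \<kappa>)) (d i) +
           real (\<alpha> i) * period \<rho>m \<rho>p h g lam (\<mu> i) (xm i) (xp i) (d i) > s i - t i"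
    and twist_e: "\<And>i \<kappa>. i \<le> m \<Longrightarrow> \<kappa> \<in> {QI, QIII} \<Longrightarrow>
           quadrant_time \<rho>m \<rho>p h g lam (\<mu> i) (xm i) (xp i) \<kappa> (e i) +
           quadrant_time \<rho>m \<rho>p h g lam (\<mu> i) (xm i) (xp i) (qnext \<kappa>) (e i) +
           real (\<beta> i) * period \<rho>m \<rho>p h g lam (\<mu> i) (xm i) (xp i) (e i) < s i - t i"
    and transition: "\<And>i. i < m \<Longrightarrow>
           transition_II_I \<rho>p h g \<mu> c1 c2 i \<le> t (Suc i) - s i \<and>
           transition_IV_III \<rho>m h g \<mu> c1 c2 i \<le> t (Suc i) - s i"
  shows "(\<exists>S \<subseteq> bvp_solutions \<rho>m \<rho>p h g lam a L r0 rL.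
            finite S \<and> card S \<ge> 2 ^ m * (\<Prod>i=0..m. \<beta> i - \<alpha> i)) \<and>
         (\<forall>\<kappa>0\<in>{QI, QIII}. \<forall>qL\<in>{QII, QIV}.
            r0 \<subseteq> closed_quadrant \<kappa>0 \<longrightarrow> rL \<subseteq> closed_quadrant qL \<longrightarrow>
            (\<forall>\<kappa> j. \<kappa> 0 = \<kappa>0 \<longrightarrow> (\<forall>i\<in>{1..m}. \<kappa> i \<in> {QI, QIII}) \<longrightarrow>
               (\<forall>i\<le>m. 1 \<le> j i \<and> j i \<le> \<beta> i - \<alpha> i) \<longrightarrow>
               (\<exists>(x, y) \<in> bvp_solutions \<rho>m \<rho>p h g lam a L r0 rL.
                  (\<forall>i\<le>m. (x (t i), y (t i)) \<in>
                      annulus \<rho>m \<rho>p h g lam (\<mu> i) (c1 i) (c2 i) \<inter> closed_quadrant (\<kappa> i)) \<and>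
                  (\<forall>i<m. \<kappa> (Suc i) = \<kappa> i \<longrightarrow>
                      exactly_zeros (2 * (\<alpha> i + j i) - 1) x {t i<..<s i} \<and>
                      exactly_zeros (2 * (\<alpha> i + j i)) y {t i..s i}) \<and>
                  (\<forall>i<m. \<kappa> (Suc i) \<noteq> \<kappa> i \<longrightarrow>
                      exactly_zeros (2 * (\<alpha> i + j i)) x {t i<..<s i} \<and>
                      exactly_zeros (2 * (\<alpha> i + j i) + 1) y {t i..s i}) \<and>
                  (\<forall>i<m. exactly_zeros 1 x {s i..t (Suc i)} \<and>
                         exactly_zeros 0 y {s i..t (Suc i)}) \<and>
                  (qL = qprev (\<kappa> m) \<longrightarrow>
                      exactly_zeros (2 * (\<alpha> m + j m) - 1) x {t m<..<s m} \<and>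
                      exactly_zeros (2 * (\<alpha> m + j m)) y {t m..s m}) \<and>
                  (qL = qnext (\<kappa> m) \<longrightarrow>
                      exactly_zeros (2 * (\<alpha> m + j m)) x {t m<..<s m} \<and>
                      exactly_zeros (2 * (\<alpha> m + j m) + 1) y {t m..s m}))))"
proof -
  note s_m = grid(2)
  obtain \<phi> \<sigma>m \<sigma>p where hom: "homeomorphism (einterval \<sigma>m \<sigma>p) (einterval \<rho>m \<rho>p) \<phi> h"
    and \<phi>: "strict_mono_on (einterval \<sigma>m \<sigma>p) \<phi>"
    using h_homeo by (elim exE conjE) (rule that)
  \<comment> \<open>\<open>h\<close> inherits monotonicity from its increasing inverse
    \<open>\<phi>\<close>.\<close>
  have h_mono: "strict_mono_on (einterval \<rho>m \<rho>p) h"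
  proof (rule strict_mono_onI)
    fix u v assume uv: "u \<in> einterval \<rho>m \<rho>p" "v \<in> einterval \<rho>m \<rho>p" "u < v"
    have "h u \<in> einterval \<sigma>m \<sigma>p" "h v \<in> einterval \<sigma>m \<sigma>p" "\<phi> (h u) = u" "\<phi> (h v) = v"
      using imageI[OF uv(1), of h] imageI[OF uv(2), of h] homeomorphism_image2[OF hom]
        homeomorphism_apply2[OF hom uv(1)] homeomorphism_apply2[OF hom uv(2)] by simp_all
    then show "h u < h v" using strict_mono_onD[OF \<phi>, of "h v" "h u"] uv(3)
      by (cases "h u" "h v" rule: linorder_cases) auto
  qed
  interpret oscillator \<rho>m \<rho>p h g
    by unfold_locales (fact rho homeomorphism_cont2[OF hom] h_mono h_0 g)+
  have ann: "oscillator_annulus \<rho>m \<rho>p h g (\<mu> i) (c1 i) (c2 i) (xm i) (xp i)" if i: "i \<le> m" for i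
  proof
    fix c assume "c \<in> {c1 i..c2 i}"
    from orbits[OF i this] show "xm i c < 0 \<and> 0 < xp i c \<and> \<mu> i * G (xm i c) = c \<and> \<mu> i * G (xp i c) = c"
      by (simp add: lambda_0 potential_def)
  qed (use levels[OF i] mu_pos[OF i] in auto)
  \<comment> \<open>The nodal clauses of the conclusion as one predicate, needed for the
    classification and also for telling solutions apart in the count.\<close>
  define spec where "spec qL \<kappa> j z \<longleftrightarrow> (case z of (x, y) \<Rightarrow>
      (\<forall>i\<le>m. (x (t i), y (t i)) \<in> annulus \<rho>m \<rho>p h g lam (\<mu> i) (c1 i) (c2 i) \<inter> closed_quadrant (\<kappa> i)) \<and>
      (\<forall>i<m. \<kappa> (Suc i) = \<kappa> i \<longrightarrow>
          exactly_zeros (2 * (\<alpha> i + j i) - 1) x {t i<..<s i} \<and>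
          exactly_zeros (2 * (\<alpha> i + j i)) y {t i..s i}) \<and>
      (\<forall>i<m. \<kappa> (Suc i) \<noteq> \<kappa> i \<longrightarrow>
          exactly_zeros (2 * (\<alpha> i + j i)) x {t i<..<s i} \<and>
          exactly_zeros (2 * (\<alpha> i + j i) + 1) y {t i..s i}) \<and>
      (\<forall>i<m. exactly_zeros 1 x {s i..t (Suc i)} \<and> exactly_zeros 0 y {s i..t (Suc i)}) \<and>
      (qL = qprev (\<kappa> m) \<longrightarrow>
          exactly_zeros (2 * (\<alpha> m + j m) - 1) x {t m<..<s m} \<and>
          exactly_zeros (2 * (\<alpha> m + j m)) y {t m..s m}) \<and>
      (qL = qnext (\<kappa> m) \<longrightarrow>
          exactly_zeros (2 * (\<alpha> m + j m)) x {t m<..<s m} \<and>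
          exactly_zeros (2 * (\<alpha> m + j m) + 1) y {t m..s m}))" for qL \<kappa> j and z :: "(real \<Rightarrow> real) \<times> (real \<Rightarrow> real)"
  let ?B = "bvp_solutions \<rho>m \<rho>p h g lam a L r0 rL"
  have solution: "\<exists>z\<in>?B. spec qL \<kappa> j z"
    if qL: "qL \<in> {QII, QIV}" and r: "r0 \<subseteq> closed_quadrant (\<kappa> 0)" "rL \<subseteq> closed_quadrant qL"
      and \<kappa>: "\<forall>i\<le>m. \<kappa> i \<in> {QI, QIII}" and j: "\<forall>i\<le>m. 1 \<le> j i \<and> j i \<le> \<beta> i - \<alpha> i" for qL \<kappa> j
  proof -
    interpret nodal_bvp \<rho>m \<rho>p h g m t s \<mu> c1 c2 d e a xm xp r0 rL \<alpha> \<beta> j \<kappa> qL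
      by (intro nodal_bvp.intro nodal_bvp_axioms.intro)
        (fact oscillator_axioms grid(1,3,4) ann weight_on weight_off arc_0[unfolded lambda_0] r arc_L[unfolded lambda_0] de
          twist_d[unfolded lambda_0] twist_e[unfolded lambda_0] transition \<kappa>[rule_format] qL j[rule_format])+
    obtain x y where B: "(x, y) \<in> ?B" and reg: "\<forall>i\<le>m. (x (t i), y (t i)) \<in> region i (\<kappa> i)"
      and tz: "\<forall>i\<le>m. exactly_zeros (xz i) x {t i<..<s i} \<and> exactly_zeros (yz i) y {t i..s i}"
      and sz: "\<forall>i<m. exactly_zeros 1 x {s i..t (Suc i)} \<and> exactly_zeros 0 y {s i..t (Suc i)}"
      using bvp_nodal_solution unfolding lambda_0 s_m[symmetric] by blast
    have same: "target i = qprev (\<kappa> i) \<longleftrightarrow> \<kappa> (Suc i) = \<kappa> i" if "i < m" for i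
      using \<kappa>[rule_format, of i] \<kappa>[rule_format, of "Suc i"] that unfolding target_def by auto
    have last: "target m = qL" by (simp add: target_def)
    have nxt: "qnext (\<kappa> m) \<noteq> qprev (\<kappa> m)" by (cases "\<kappa> m") auto
    have "spec qL \<kappa> j (x, y)"
      unfolding spec_def prod.case
    proof (intro conjI allI impI)
      fix i assume "i \<le> m"
      then show "(x (t i), y (t i)) \<in> annulus \<rho>m \<rho>p h g lam (\<mu> i) (c1 i) (c2 i) \<inter> closed_quadrant (\<kappa> i)"
        using reg unfolding region_def lambda_0 by blast
    next
      fix i assume i: "i < m" "\<kappa> (Suc i) = \<kappa> i"
      then show "exactly_zeros (2 * (\<alpha> i + j i) - 1) x {t i<..<s i}" "exactly_zeros (2 * (\<alpha> i + j i)) y {t i..s i}"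
        using tz[rule_format, of i] same[OF i(1)] unfolding xz_def yz_def by auto
    next
      fix i assume i: "i < m" "\<kappa> (Suc i) \<noteq> \<kappa> i"
      then show "exactly_zeros (2 * (\<alpha> i + j i)) x {t i<..<s i}" "exactly_zeros (2 * (\<alpha> i + j i) + 1) y {t i..s i}"
        using tz[rule_format, of i] same[OF i(1)] unfolding xz_def yz_def by auto
    next
      fix i assume "i < m"
      then show "exactly_zeros 1 x {s i..t (Suc i)}" "exactly_zeros 0 y {s i..t (Suc i)}" using sz by blast+
    next
      assume "qL = qprev (\<kappa> m)"
      then show "exactly_zeros (2 * (\<alpha> m + j m) - 1) x {t m<..<s m}" "exactly_zeros (2 * (\<alpha> m + j m)) y {t m..s m}"
        using tz[rule_format, of m] last unfolding xz_def yz_def by auto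
    next
      assume "qL = qnext (\<kappa> m)"
      then show "exactly_zeros (2 * (\<alpha> m + j m)) x {t m<..<s m}" "exactly_zeros (2 * (\<alpha> m + j m) + 1) y {t m..s m}"
        using tz[rule_format, of m] last nxt unfolding xz_def yz_def by auto
    qed
    with B show ?thesis by blast
  qed
  have "\<exists>S\<subseteq>?B. finite S \<and> card S \<ge> 2 ^ m * (\<Prod>i=0..m. \<beta> i - \<alpha> i)"
  proof -
    obtain \<kappa>0 qL where \<kappa>0: "\<kappa>0 \<in> {QI, QIII}" "r0 \<subseteq> closed_quadrant \<kappa>0" and qL: "qL \<in> {QII, QIV}" "rL \<subseteq> closed_quadrant qL"
      using quadrant_0 quadrant_L by blast
    \<comment> \<open>The starting quadrant is dictated by \<open>r0\<close>, so \<open>m\<close>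
      quadrants and \<open>m + 1\<close> winding indices are free. \<open>PiE\<close> fixes the
      functions outside the index sets, so that they can be counted.\<close>
    define I where "I = (PiE {1..m} (\<lambda>_. {QI, QIII})) \<times> (PiE {0..m} (\<lambda>i. {1..\<beta> i - \<alpha> i}))"
    have "\<exists>z\<in>?B. spec qL ((fst p)(0 := \<kappa>0)) (snd p) z" if p: "p \<in> I" for p
    proof (rule solution)
      have "fst p i \<in> {QI, QIII}" if "i \<in> {1..m}" for i using p that unfolding I_def by (auto simp: PiE_iff)
      then show "\<forall>i\<le>m. ((fst p)(0 := \<kappa>0)) i \<in> {QI, QIII}" using \<kappa>0(1) by auto
      show "\<forall>i\<le>m. 1 \<le> snd p i \<and> snd p i \<le> \<beta> i - \<alpha> i" using p unfolding I_def by (auto simp: PiE_iff)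
    qed (use \<kappa>0 qL in auto)
    then obtain f where f: "\<And>p. p \<in> I \<Longrightarrow> f p \<in> ?B \<and> spec qL ((fst p)(0 := \<kappa>0)) (snd p) (f p)" by metis
    have zeros_unique: "k = l" if "exactly_zeros k u B" "exactly_zeros l u B" for k l u B
      using that unfolding exactly_zeros_def by simp
    have "inj_on f I"
    proof (rule inj_onI)
      fix p p' assume p: "p \<in> I" "p' \<in> I" "f p = f p'"
      obtain x y where xy: "f p = (x, y)" by fastforce
      let ?\<kappa> = "(fst p)(0 := \<kappa>0)" and ?\<kappa>' = "(fst p')(0 := \<kappa>0)"
      have spec: "spec qL ?\<kappa> (snd p) (x, y)" "spec qL ?\<kappa>' (snd p') (x, y)"
        using f[OF p(1)] f[OF p(2)] p(3) xy by auto
      have K: "?\<kappa> i \<in> {QI, QIII}" "?\<kappa>' i \<in> {QI, QIII}" if "i \<le> m" for i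
        using p(1,2) that \<kappa>0(1) unfolding I_def by (auto simp: PiE_iff)
      \<comment> \<open>The quadrants I and III meet only in the origin, whose energy zero is below
        \<open>c1 i\<close>; hence a solution determines its quadrants.\<close>
      have \<kappa>_eq: "?\<kappa> i = ?\<kappa>' i" if i: "i \<le> m" for i
      proof (rule ccontr)
        assume ne: "?\<kappa> i \<noteq> ?\<kappa>' i"
        have "(x (t i), y (t i)) \<in> annulus \<rho>m \<rho>p h g lam (\<mu> i) (c1 i) (c2 i) \<inter> closed_quadrant (?\<kappa> i)"
          "(x (t i), y (t i)) \<in> closed_quadrant (?\<kappa>' i)"
          using spec i unfolding spec_def prod.case by blast+
        moreover from this have "x (t i) = 0" "y (t i) = 0" using K[OF i] ne by auto
        ultimately show False using levels[OF i] by (auto simp: annulus_def energy_def potential_def)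
      qed
      have j_eq: "snd p i = snd p' i" if i: "i \<le> m" for i
      proof -
        \<comment> \<open>The offset \<open>b\<close> is one if the target is the successor quadrant
          and zero if it is the predecessor. It agrees for both index pairs because their quadrants
          agree, so the number of zeros of \<open>y\<close> determines the winding index.\<close>
        have "\<exists>b. exactly_zeros (2 * (\<alpha> i + snd p i) + b) y {t i..s i} \<and> exactly_zeros (2 * (\<alpha> i + snd p' i) + b) y {t i..s i}"
        proof (cases "i < m")
          case True
          then have \<kappa>: "?\<kappa> i = ?\<kappa>' i" "?\<kappa> (Suc i) = ?\<kappa>' (Suc i)"
            using \<kappa>_eq[of i] \<kappa>_eq[of "Suc i"] True by simp_all
          show ?thesis
          proof (cases "?\<kappa> (Suc i) = ?\<kappa> i")
            case eq: True
            then have "?\<kappa>' (Suc i) = ?\<kappa>' i" using \<kappa> by simp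
            then show ?thesis using spec eq True unfolding spec_def prod.case by (intro exI[of _ 0]) simp
          next
            case neq: False
            then have "?\<kappa>' (Suc i) \<noteq> ?\<kappa>' i" using \<kappa> by simp
            then show ?thesis using spec neq True unfolding spec_def prod.case by (intro exI[of _ 1]) blast
          qed
        next
          case False
          then have im: "i = m" using i by simp
          have \<kappa>: "?\<kappa> m = ?\<kappa>' m" by (rule \<kappa>_eq) simp
          have "qL = qprev (?\<kappa> m) \<or> qL = qnext (?\<kappa> m)" using K(1)[of m] qL(1) by auto
          then show ?thesis
          proof
            assume q: "qL = qprev (?\<kappa> m)"
            then have "qL = qprev (?\<kappa>' m)" using \<kappa> by simp
            then show ?thesis using spec q unfolding spec_def prod.case im by (intro exI[of _ 0]) simp
          next
            assume q: "qL = qnext (?\<kappa> m)"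
            then have "qL = qnext (?\<kappa>' m)" using \<kappa> by simp
            then show ?thesis using spec q unfolding spec_def prod.case im by (intro exI[of _ 1]) blast
          qed
        qed
        then show ?thesis using zeros_unique by fastforce
      qed
      have "fst p = fst p'"
      proof (rule PiE_ext)
        show "fst p \<in> PiE {1..m} (\<lambda>_. {QI, QIII})" "fst p' \<in> PiE {1..m} (\<lambda>_. {QI, QIII})"
          using p(1,2) unfolding I_def by auto
        show "fst p i = fst p' i" if "i \<in> {1..m}" for i using \<kappa>_eq[of i] that by auto
      qed
      moreover have "snd p = snd p'"
      proof (rule PiE_ext)
        show "snd p \<in> PiE {0..m} (\<lambda>i. {1..\<beta> i - \<alpha> i})" "snd p' \<in> PiE {0..m} (\<lambda>i. {1..\<beta> i - \<alpha> i})"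
          using p(1,2) unfolding I_def by auto
      qed (use j_eq in auto)
      ultimately show "p = p'" by (simp add: prod_eq_iff)
    qed
    moreover have "finite I" unfolding I_def by (intro finite_cartesian_product finite_PiE) auto
    moreover have "card I = 2 ^ m * (\<Prod>i=0..m. \<beta> i - \<alpha> i)"
      unfolding I_def by (simp add: card_cartesian_product card_PiE numeral_2_eq_2)
    moreover have "f ` I \<subseteq> ?B" using f by blast
    ultimately show ?thesis by (intro exI[of _ "f ` I"]) (simp add: card_image)
  qed
  moreover have "\<exists>z\<in>?B. spec qL \<kappa> j z"
    if "\<kappa>0 \<in> {QI, QIII}" "qL \<in> {QII, QIV}" "r0 \<subseteq> closed_quadrant \<kappa>0" "rL \<subseteq> closed_quadrant qL"
      "\<kappa> 0 = \<kappa>0" "\<forall>i\<in>{1..m}. \<kappa> i \<in> {QI, QIII}" "\<forall>i\<le>m. 1 \<le> j i \<and> j i \<le> \<beta> i - \<alpha> i" for \<kappa>0 qL \<kappa> j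
  proof (rule solution)
    show "\<forall>i\<le>m. \<kappa> i \<in> {QI, QIII}"
    proof (intro allI impI)
      fix i assume "i \<le> m"
      then show "\<kappa> i \<in> {QI, QIII}" using that(1,5,6) by (cases "i = 0") auto
    qed
  qed (use that in auto)
  ultimately show ?thesis unfolding spec_def by blast
qed

end
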